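(* Let $p,q>0$ and $a\in\mathbb{R}$ with $a\ne0$, let $(W_t)_{t\ge 0}$, $(W^{(1)}_t)_{t\ge 0}$, $(W^{(2)}_t)_{t\ge 0}$ be three independent standard one-dimensional Brownian motions (started at $0$), and let $\mathfrak Z_t=(X_t,Y_t,Z_t)$, $t\ge0$, be the Brownian motion with drift on $\mathrm{Sol}(p,q)$ given by $$Z_t = a\,t + W_t,\qquad X_t=\int_0^t e^{pZ_s}\,dW^{(1)}_s,\qquad Y_t=\int_0^t e^{-qZ_s}\,dW^{(2)}_s .$$ Let $\gamma^\infty$ be the (random) vertical limit geodesic ray of $(\mathfrak Z_t)$. Then $$\limsup_{t\to\infty}\frac{1}{\log t}\,d\bigl(\mathfrak Z_t,\gamma^\infty\bigr)\le\frac{2}{|a|}\quad\text{almost surely,}$$ where $d(\mathfrak Z_t,\gamma^\infty)=\inf\{d_{\mathrm{Sol}}(\mathfrak Z_t,\gamma^\infty(u)):u\ge0\}$.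
   Context: $\mathrm{Sol}(p,q)$ is $\mathbb{R}^3$ with coordinates $(x,y,z)$ and the Riemannian metric $ds^2=e^{-2pz}\,dx^2+e^{2qz}\,dy^2+dz^2$; $d_{\mathrm{Sol}}$ is the induced Riemannian distance. The integrals are Itô stochastic integrals (continuous versions); $(\mathfrak Z_t)$ is the continuous diffusion started at $(0,0,0)$ with generator $\frac12\bigl(e^{2pz}\partial_x^2+e^{-2qz}\partial_y^2+\partial_z^2\bigr)+a\,\partial_z$. If $a>0$, then $Y_\infty=\lim_{t\to\infty}Y_t$ exists and is finite almost surely, and the vertical limit geodesic ray is $\gamma^\infty(u)=(0,Y_\infty,u)$, $u\ge0$. If $a<0$, then $X_\infty=\lim_{t\to\infty}X_t$ exists and is finite almost surely, and the vertical limit geodesic ray is $\gamma^\infty(u)=(X_\infty,0,-u)$, $u\ge0$. *)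

theory Defs
  imports "HOL-Probability.Probability"
begin

section \<open>Brownian motion and natural filtrations\<close>

text \<open>Processes are indexed by all of \<^typ>\<open>real\<close>, but only their values at times
  \<open>t \<ge> 0\<close> are ever constrained or used.\<close>

definition brownian_motion :: "'a measure \<Rightarrow> (real \<Rightarrow> 'a \<Rightarrow> real) \<Rightarrow> bool" where
  "brownian_motion M B \<longleftrightarrow>
     prob_space M \<and>
     (\<forall>t\<ge>0. B t \<in> borel_measurable M) \<and>
     (AE \<omega> in M. B 0 \<omega> = 0) \<and>
     (\<forall>n (\<tau> :: nat \<Rightarrow> real). 0 \<le> \<tau> 0 \<and> (\<forall>i<n. \<tau> i \<le> \<tau> (Suc i)) \<longrightarrow>
        prob_space.indep_vars M (\<lambda>_. borel) (\<lambda>i \<omega>. B (\<tau> (Suc i)) \<omega> - B (\<tau> i) \<omega>) {..<n}) \<and>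
     (\<forall>s t. 0 \<le> s \<and> s < t \<longrightarrow>
        distributed M lborel (\<lambda>\<omega>. B t \<omega> - B s \<omega>) (normal_density 0 (sqrt (t - s)))) \<and>
     (\<forall>\<omega>\<in>space M. continuous_on {0..} (\<lambda>t. B t \<omega>))"

text \<open>Mutual independence of the members of a list of processes, each regarded as a random
  element of the product space of real functions on \<open>[0,\<infinity>)\<close>.\<close>

definition indep_processes :: "'a measure \<Rightarrow> (real \<Rightarrow> 'a \<Rightarrow> real) list \<Rightarrow> bool" where
  "indep_processes M Bs \<longleftrightarrow>
     prob_space.indep_vars M (\<lambda>_. PiM {0::real..} (\<lambda>_. borel))
       (\<lambda>i \<omega>. \<lambda>t\<in>{0..}. (Bs ! i) t \<omega>) {..<length Bs}"

definition natural_filtration ::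
    "'a measure \<Rightarrow> (real \<Rightarrow> 'a \<Rightarrow> real) set \<Rightarrow> real \<Rightarrow> 'a measure" where
  "natural_filtration M \<B> t =
     sigma (space M) {B s -` A \<inter> space M | B s A. B \<in> \<B> \<and> s \<in> {0..t} \<and> A \<in> sets borel}"

section \<open>The It\^o integral\<close>

text \<open>The class of integrands on \<open>[0,\<infinity>)\<close>: jointly measurable, adapted, and square
  integrable over \<open>[0,t] \<times> \<Omega>\<close> for every \<open>t\<close>.\<close>

definition ito_integrand ::
    "'a measure \<Rightarrow> (real \<Rightarrow> 'a measure) \<Rightarrow> (real \<Rightarrow> 'a \<Rightarrow> real) \<Rightarrow> bool" where
  "ito_integrand M F H \<longleftrightarrow>
     (\<lambda>(s, \<omega>). H s \<omega>) \<in> borel_measurable (restrict_space borel {0..} \<Otimes>\<^sub>M M) \<and>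
     (\<forall>t\<ge>0. H t \<in> borel_measurable (F t)) \<and>
     (\<forall>t\<ge>0. (\<integral>\<^sup>+\<omega>. (\<integral>\<^sup>+s\<in>{0..t}. ennreal ((H s \<omega>)\<^sup>2) \<partial>lborel) \<partial>M) < \<infinity>)"

text \<open>A simple process is given by a number \<open>n\<close> of steps, times \<open>\<tau> 0 \<le> \<dots> \<le> \<tau> n\<close> and bounded
  coefficients \<open>\<xi> i\<close> known at time \<open>\<tau> i\<close>; it has the value \<open>\<xi> i\<close> on \<open>(\<tau> i, \<tau> (i+1)]\<close>.\<close>

definition simple_process ::
    "'a measure \<Rightarrow> (real \<Rightarrow> 'a measure) \<Rightarrow> nat \<Rightarrow> (nat \<Rightarrow> real) \<Rightarrow> (nat \<Rightarrow> 'a \<Rightarrow> real) \<Rightarrow> bool" where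
  "simple_process M F n \<tau> \<xi> \<longleftrightarrow>
     0 \<le> \<tau> 0 \<and> (\<forall>i<n. \<tau> i \<le> \<tau> (Suc i)) \<and>
     (\<forall>i<n. \<xi> i \<in> borel_measurable (F (\<tau> i))) \<and>
     (\<exists>C. \<forall>i<n. \<forall>\<omega>\<in>space M. \<bar>\<xi> i \<omega>\<bar> \<le> C)"

definition simple_value ::
    "nat \<Rightarrow> (nat \<Rightarrow> real) \<Rightarrow> (nat \<Rightarrow> 'a \<Rightarrow> real) \<Rightarrow> real \<Rightarrow> 'a \<Rightarrow> real" where
  "simple_value n \<tau> \<xi> s \<omega> = (\<Sum>i<n. \<xi> i \<omega> * indicator {\<tau> i<..\<tau> (Suc i)} s)"

definition simple_integral ::
    "(real \<Rightarrow> 'a \<Rightarrow> real) \<Rightarrow> nat \<Rightarrow> (nat \<Rightarrow> real) \<Rightarrow> (nat \<Rightarrow> 'a \<Rightarrow> real) \<Rightarrow> real \<Rightarrow> 'a \<Rightarrow> real" where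
  "simple_integral B n \<tau> \<xi> t \<omega> =
     (\<Sum>i<n. \<xi> i \<omega> * (B (min t (\<tau> (Suc i))) \<omega> - B (min t (\<tau> i)) \<omega>))"

text \<open>\<open>I\<close> is a continuous version of the process \<open>t \<mapsto> \<integral>\<^sub>0\<^sup>t H dB\<close>: each \<open>I t\<close> is the
  mean-square limit of the integrals of simple processes that approximate \<open>H\<close> in
  \<open>L\<^sup>2([0,t] \<times> \<Omega>)\<close>. When \<open>B\<close> is a Brownian motion with respect to \<open>F\<close>, the It\^o isometry
  shows that this determines \<open>I\<close> up to a null set, whichever approximations are used.\<close>

definition is_ito_integral ::
    "'a measure \<Rightarrow> (real \<Rightarrow> 'a measure) \<Rightarrow> (real \<Rightarrow> 'a \<Rightarrow> real) \<Rightarrow> (real \<Rightarrow> 'a \<Rightarrow> real) \<Rightarrow>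
       (real \<Rightarrow> 'a \<Rightarrow> real) \<Rightarrow> bool" where
  "is_ito_integral M F B H I \<longleftrightarrow>
     ito_integrand M F H \<and>
     (AE \<omega> in M. continuous_on {0..} (\<lambda>t. I t \<omega>)) \<and>
     (\<forall>t\<ge>0. I t \<in> borel_measurable M \<and>
        (\<exists>n \<tau> \<xi>.
           (\<forall>k::nat. simple_process M F (n k) (\<tau> k) (\<xi> k)) \<and>
           (\<lambda>k. \<integral>\<^sup>+\<omega>. (\<integral>\<^sup>+s\<in>{0..t}.
                   ennreal ((simple_value (n k) (\<tau> k) (\<xi> k) s \<omega> - H s \<omega>)\<^sup>2) \<partial>lborel) \<partial>M)
              \<longlonglongrightarrow> 0 \<and>
           (\<lambda>k. \<integral>\<^sup>+\<omega>. ennreal ((simple_integral B (n k) (\<tau> k) (\<xi> k) t \<omega> - I t \<omega>)\<^sup>2) \<partial>M)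
              \<longlonglongrightarrow> 0))"

section \<open>The Riemannian manifold \<open>Sol(p,q)\<close>\<close>

type_synonym sol_point = "real \<times> real \<times> real"

definition sol_metric :: "real \<Rightarrow> real \<Rightarrow> sol_point \<Rightarrow> sol_point \<Rightarrow> sol_point \<Rightarrow> real" where
  "sol_metric p q = (\<lambda>(x, y, z) (v1, v2, v3) (w1, w2, w3).
     exp (- 2 * p * z) * v1 * w1 + exp (2 * q * z) * v2 * w2 + v3 * w3)"

definition sol_speed :: "real \<Rightarrow> real \<Rightarrow> (real \<Rightarrow> sol_point) \<Rightarrow> real \<Rightarrow> real" where
  "sol_speed p q \<gamma> t =
     sqrt (sol_metric p q (\<gamma> t) (vector_derivative \<gamma> (at t)) (vector_derivative \<gamma> (at t)))"

text \<open>The derivative of a \<^const>\<open>valid_path\<close> may blow up at its finitely many exceptional points,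
  so its length need not be finite. Using \<^const>\<open>has_integral\<close> rather than \<^const>\<open>integral\<close>
  keeps curves of infinite length from being counted as curves of length \<open>0\<close>.\<close>

definition sol_dist :: "real \<Rightarrow> real \<Rightarrow> sol_point \<Rightarrow> sol_point \<Rightarrow> real" where
  "sol_dist p q P Q =
     Inf {L. \<exists>\<gamma>. valid_path \<gamma> \<and> pathstart \<gamma> = P \<and> pathfinish \<gamma> = Q \<and>
                 (sol_speed p q \<gamma> has_integral L) {0..1}}"

definition limit_ray ::
    "real \<Rightarrow> (real \<Rightarrow> 'a \<Rightarrow> real) \<Rightarrow> (real \<Rightarrow> 'a \<Rightarrow> real) \<Rightarrow> 'a \<Rightarrow> real \<Rightarrow> sol_point" where
  "limit_ray a X Y \<omega> u =
     (if a > 0 then (0, Lim at_top (\<lambda>t. Y t \<omega>), u)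
      else (Lim at_top (\<lambda>t. X t \<omega>), 0, - u))"

definition dist_to_ray :: "real \<Rightarrow> real \<Rightarrow> sol_point \<Rightarrow> (real \<Rightarrow> sol_point) \<Rightarrow> real" where
  "dist_to_ray p q P \<gamma> = (INF u\<in>{0..}. sol_dist p q P (\<gamma> u))"

end

theory Submission
  imports Defs "HOL-Real_Asymp.Real_Asymp"
begin

text \<open>For \<open>a > 0\<close> and a height \<open>h = \<kappa> log t\<close>, descend from \<open>(X\<^sub>t, Y\<^sub>t, Z\<^sub>t)\<close> by \<open>h\<close>, move in the direction of \<open>y\<close> to
  \<open>Y\<^sub>\<infinity>\<close>, climb by \<open>2 h\<close> and move in the direction of \<open>x\<close> to \<open>0\<close>, which ends on the limit ray. If the two
  horizontal moves have length at most \<open>1\<close>, the distance to the ray is at most \<open>3 h + 2\<close>, so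
  \<open>\<kappa> = 2 / (3 a)\<close> is good enough. The horizontal moves are that short as soon as
  \<open>\<bar>X\<^sub>t\<bar> \<le> exp (p (Z\<^sub>t + h))\<close> and \<open>\<bar>Y\<^sub>t - Y\<^sub>\<infinity>\<bar> \<le> exp (- q (Z\<^sub>t - h))\<close>.

  Both bounds are pathwise consequences of two almost sure estimates. First, for every \<open>\<kappa> > 1 / (2 a)\<close>
  the vertical Brownian motion with drift never goes back by more than \<open>\<kappa> log t + O(1)\<close>, with some drift to spare. Second, over
  the unit interval starting at \<open>n\<close> the integral \<open>\<integral> exp (c Z) dB\<close> changes by at most
  \<open>O(n\<^sup>\<delta>) exp (c Z\<^sub>n)\<close> for every \<open>\<delta> > 0\<close>; the changes then add up geometrically. Each estimate follows from
  the exponential bound \<open>E exp (\<theta> (I\<^sub>t - I\<^sub>s) - \<theta>\<^sup>2 \<integral> H\<^sup>2) \<le> 1\<close> by weighting countably many such exponentials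
  so that the sum has finite expectation: the sum is then almost surely finite and dominates all of its terms.
  The case \<open>a < 0\<close> is the mirror image, with \<open>x\<close> and \<open>y\<close> exchanged.\<close>

section \<open>Independence of Brownian increments from the past\<close>

text \<open>The obstacle is that the integrands \<open>exp (c Z)\<close> are unbounded, so
  increments of \<open>X\<close> and \<open>Y\<close> need not have exponential moments. Subtracting
  the pathwise compensator keeps the mean of the exponential at most 1, but the resulting bound has
  the form log / sigma + sigma * a with a random \<open>a\<close> of size
  \<open>exp (2 c Z)\<close>, and the right scale sigma is about \<open>exp (- c Z)\<close>, which
  is random too. It is chosen pathwise from the countable family of scales \<open>exp (m)\<close>
  and \<open>exp (- m)\<close>; index \<open>m\<close> costs only \<open>ln (m + 1)\<close>, and
  since Z grows at most linearly this is O(log t). The threshold 1 / (2 a) comes from the Gaussian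
  exponent: \<open>exp (\<theta> |W k - W i| - \<theta> a |k - i|)\<close> has exponentially
  decaying mean when \<open>\<theta> < 2 a\<close>, and a summable weight over the base time i costs
  \<open>s * ln (i + 1)\<close> with s > 1, so the coefficient of the logarithm is s / \<theta>. The
  route of vertical length 3 h thus costs little more than 3 / (2 a) times log t; the room up to 2 /
  a is spent on simple rational constants and on absorbing small powers of t.\<close>

text \<open>The definition of \<open>brownian_motion\<close> only offers independence of increments
  along a finite grid. On a grid containing 0 and s the past values are almost surely partial sums
  of the increments before s, and \<open>B t - B s\<close> is the last increment, so the two groups
  separate.\<close>

lemma brownian_motion_past_indep:
  fixes A :: "real \<Rightarrow> real set"
  assumes bm: "brownian_motion M B" and U: "finite U" "U \<subseteq> {0..s}" and s: "0 \<le> s" "s < t"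
    and A: "\<And>u. A u \<in> sets borel" and E: "E \<in> sets borel"
  shows "measure M ({\<omega>\<in>space M. \<forall>u\<in>U. B u \<omega> \<in> A u} \<inter> {\<omega>\<in>space M. B t \<omega> - B s \<omega> \<in> E})
       = measure M {\<omega>\<in>space M. \<forall>u\<in>U. B u \<omega> \<in> A u} * measure M {\<omega>\<in>space M. B t \<omega> - B s \<omega> \<in> E}"
proof -
  interpret prob_space M using bm by (simp add: brownian_motion_def)
  have Bm[measurable]: "\<And>u. 0 \<le> u \<Longrightarrow> B u \<in> borel_measurable M"
    using bm by (simp add: brownian_motion_def)
  have B0: "AE \<omega> in M. B 0 \<omega> = 0" using bm by (simp add: brownian_motion_def)
  define P where "P = insert 0 (insert s U)"
  have P: "finite P" "P \<subseteq> {0..s}" "0 \<in> P" "s \<in> P" "U \<subseteq> P" using U s by (auto simp: P_def)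
  define m where "m = card P"
  have m: "m > 0" using P by (auto simp: m_def card_gt_0_iff)
  define xs where "xs = sorted_list_of_set P"
  have xs: "sorted xs" "set xs = P" "length xs = m" using P by (auto simp: xs_def m_def)
  define \<tau> where "\<tau> i = (xs @ [t]) ! i" for i
  have \<tau>P: "\<tau> i \<in> P" if "i < m" for i using that xs by (auto simp: \<tau>_def nth_append)
  have \<tau>m: "\<tau> m = t" using xs by (simp add: \<tau>_def nth_append)
  have mono: "\<tau> i \<le> \<tau> j" if "i \<le> j" "j < m" for i j
    using that xs sorted_nth_mono[of xs i j] by (auto simp: \<tau>_def nth_append)
  have ex: "\<exists>i<m. \<tau> i = u" if "u \<in> P" for u
    using that xs by (metis \<tau>_def in_set_conv_nth nth_append)
  have \<tau>0: "\<tau> 0 = 0"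
  proof -
    obtain i where "i < m" "\<tau> i = 0" using ex P by blast
    then show ?thesis using mono[of 0 i] \<tau>P[OF m] P(2) by force
  qed
  have \<tau>s: "\<tau> (m - 1) = s"
  proof -
    obtain i where "i < m" "\<tau> i = s" using ex P by blast
    then show ?thesis using mono[of i "m-1"] \<tau>P[of "m-1"] m P(2) by force
  qed
  have step: "\<tau> i \<le> \<tau> (Suc i)" if "i < m" for i
  proof (cases "Suc i = m")
    case True then show ?thesis using \<tau>m \<tau>P[OF that] P(2) s by force
  next
    case False then show ?thesis using mono[of i "Suc i"] that by simp
  qed
  define D where "D i \<omega> = B (\<tau> (Suc i)) \<omega> - B (\<tau> i) \<omega>" for i \<omega>
  have iv: "indep_vars (\<lambda>_. borel) D {..<m}"
  proof -
    have "\<forall>n (\<tau> :: nat \<Rightarrow> real). 0 \<le> \<tau> 0 \<and> (\<forall>i<n. \<tau> i \<le> \<tau> (Suc i)) \<longrightarrow>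
        indep_vars (\<lambda>_. borel) (\<lambda>i \<omega>. B (\<tau> (Suc i)) \<omega> - B (\<tau> i) \<omega>) {..<n}"
      using bm by (simp add: brownian_motion_def)
    from this[rule_format, of \<tau> m] show ?thesis
      using \<tau>0 step by (simp add: D_def[abs_def])
  qed
  let ?S = "PiM {..<m-1} (\<lambda>_. borel :: real measure)" and ?T = "PiM {m-1} (\<lambda>_. borel :: real measure)"
  let ?R1 = "\<lambda>\<omega>. restrict (\<lambda>i. D i \<omega>) {..<m-1}" and ?R2 = "\<lambda>\<omega>. restrict (\<lambda>i. D i \<omega>) {m-1}"
  have ivr: "indep_var ?S ?R1 ?T ?R2"
    by (rule indep_var_restrict[OF iv]) (use m in auto)
  \<comment> \<open>The past event in terms of increments: the sum over \<open>l < i\<close> stands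
    for \<open>B (\<tau> i) - B 0\<close>. This is \<open>B (\<tau> i)\<close> only off a null set,
    so \<open>C1\<close> reproduces the event almost everywhere (\<open>GG\<close>).\<close>
  define C1 where "C1 = {f\<in>space ?S. \<forall>i\<in>{i. i < m \<and> \<tau> i \<in> U}. (\<Sum>l<i. f l) \<in> A (\<tau> i)}"
  define C2 where "C2 = {f\<in>space ?T. f (m-1) \<in> E}"
  have C1: "C1 \<in> sets ?S"
    unfolding C1_def
  proof (rule sets.sets_Collect_finite_All)
    fix i assume i: "i \<in> {i. i < m \<and> \<tau> i \<in> U}"
    have [measurable]: "(\<lambda>f. \<Sum>l<i. f l) \<in> borel_measurable ?S"
      by (intro borel_measurable_sum measurable_component_singleton) (use i in auto)
    show "{f \<in> space ?S. (\<Sum>l<i. f l) \<in> A (\<tau> i)} \<in> sets ?S"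
      using A by measurable
  qed simp
  have C2: "C2 \<in> sets ?T" unfolding C2_def using E by measurable
  let ?G = "{\<omega>\<in>space M. \<forall>u\<in>U. B u \<omega> \<in> A u}" and ?N = "{\<omega>\<in>space M. B t \<omega> - B s \<omega> \<in> E}"
  let ?G' = "?R1 -` C1 \<inter> space M" and ?N' = "?R2 -` C2 \<inter> space M"
  have NN: "?N' = ?N"
    using m \<tau>m \<tau>s by (auto simp: C2_def D_def space_PiM)
  have Gm: "?G \<in> sets M"
  proof (rule sets.sets_Collect_finite_All)
    fix u assume "u \<in> U"
    then have "0 \<le> u" using U by auto
    then show "{\<omega>\<in>space M. B u \<omega> \<in> A u} \<in> sets M" using A by measurable
  qed fact
  have Nm: "?N \<in> sets M"
  proof -
    have [measurable]: "B t \<in> borel_measurable M" "B s \<in> borel_measurable M" using Bm s by auto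
    show ?thesis using E by measurable
  qed
  have G'm: "?G' \<in> sets M"
    using indep_var_rv1[OF ivr] C1 by (rule measurable_sets)
  have sumD: "(\<Sum>l<i. D l \<omega>) = B (\<tau> i) \<omega> - B 0 \<omega>" for \<omega> i
    using sum_lessThan_telescope[of "\<lambda>i. B (\<tau> i) \<omega>" i] by (simp add: D_def \<tau>0)
  have GG: "AE \<omega> in M. \<omega> \<in> ?G' \<longleftrightarrow> \<omega> \<in> ?G"
    using B0
  proof eventually_elim
    case (elim \<omega>)
    have "(\<Sum>l<i. restrict (\<lambda>i. D i \<omega>) {..<m-1} l) = B (\<tau> i) \<omega>" if "i < m" for i
      using sumD[of \<omega> i] elim that by (subst sum.cong[OF refl]) auto
    then have "?R1 \<omega> \<in> C1 \<longleftrightarrow> (\<forall>i. i < m \<and> \<tau> i \<in> U \<longrightarrow> B (\<tau> i) \<omega> \<in> A (\<tau> i))"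
      by (auto simp: C1_def space_PiM)
    also have "\<dots> \<longleftrightarrow> (\<forall>u\<in>U. B u \<omega> \<in> A u)"
      using ex P(5) by blast
    finally show ?case by auto
  qed
  have "measure M (?G \<inter> ?N) = measure M (?G' \<inter> ?N')"
    by (rule finite_measure_eq_AE) (use GG Gm G'm Nm NN in auto)
  also have "?G' \<inter> ?N' = (\<lambda>\<omega>. (?R1 \<omega>, ?R2 \<omega>)) -` (C1 \<times> C2) \<inter> space M" by auto
  also have "measure M \<dots> = measure M ?G' * measure M ?N'"
    using indep_varD[OF ivr C1 C2] by (simp add: vimage_def Int_def)
  also have "measure M ?G' = measure M ?G"
    by (rule finite_measure_eq_AE) (use GG Gm G'm in auto)
  finally show ?thesis unfolding NN .
qed

lemma natural_filtration_sets:
  assumes "\<And>B u. B \<in> \<B> \<Longrightarrow> 0 \<le> u \<Longrightarrow> B u \<in> borel_measurable M"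
  shows "space (natural_filtration M \<B> t) = space M"
    and "sets (natural_filtration M \<B> t) \<subseteq> sets M"
    and "s \<le> t \<Longrightarrow> sets (natural_filtration M \<B> s) \<subseteq> sets (natural_filtration M \<B> t)"
    and "B \<in> \<B> \<Longrightarrow> 0 \<le> t \<Longrightarrow> B t \<in> borel_measurable (natural_filtration M \<B> t)"
proof -
  define G where "G t = {B u -` A \<inter> space M | B u A. B \<in> \<B> \<and> u \<in> {0..t} \<and> A \<in> sets borel}" for t :: real
  have F: "natural_filtration M \<B> t = sigma (space M) (G t)" for t
    by (simp add: natural_filtration_def G_def)
  have Gs: "G t \<subseteq> sets M" for t
    unfolding G_def using assms by (auto intro!: measurable_sets)
  then have Gp: "G t \<subseteq> Pow (space M)" for t
    using sets.sets_into_space by blast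
  show 1: "space (natural_filtration M \<B> t) = space M"
    by (simp add: F Gp space_measure_of)
  show "sets (natural_filtration M \<B> t) \<subseteq> sets M"
    using Gs Gp by (simp add: F sets_measure_of sets.sigma_sets_subset)
  show "sets (natural_filtration M \<B> s) \<subseteq> sets (natural_filtration M \<B> t)" if "s \<le> t"
  proof -
    have "G s \<subseteq> G t" using that unfolding G_def by force
    then show ?thesis using Gp by (simp add: F sets_measure_of sigma_sets_mono')
  qed
  show "B t \<in> borel_measurable (natural_filtration M \<B> t)" if "B \<in> \<B>" "0 \<le> t"
  proof (rule measurableI)
    fix A :: "real set" assume "A \<in> sets borel"
    then have "B t -` A \<inter> space M \<in> G t" using that by (auto simp: G_def)
    then show "B t -` A \<inter> space (natural_filtration M \<B> t) \<in> sets (natural_filtration M \<B> t)"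
      using 1 Gp by (simp add: F sets_measure_of)
  qed simp
qed

text \<open>Finite cylinders over all processes form an intersection-stable generator of the past.
  On a cylinder, independence of the processes gives one factor per process; the increment touches
  only the factor of \<open>Bs ! j\<close>, where the one-process lemma applies. Independence then
  passes from the generator to the sigma-algebra.\<close>

lemma natural_filtration_indep_increment:
  assumes bm: "\<And>i. i < length Bs \<Longrightarrow> brownian_motion M (Bs ! i)"
    and ind: "indep_processes M Bs" and j: "j < length Bs" and s: "0 \<le> s" "s < t"
    and A: "A \<in> sets (natural_filtration M (set Bs) s)" and E: "E \<in> sets borel"
  shows "measure M (A \<inter> {\<omega>\<in>space M. (Bs ! j) t \<omega> - (Bs ! j) s \<omega> \<in> E})
    = measure M A * measure M {\<omega>\<in>space M. (Bs ! j) t \<omega> - (Bs ! j) s \<omega> \<in> E}"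
proof -
  let ?n = "length Bs" and ?F = "natural_filtration M (set Bs) s"
  interpret prob_space M using bm[OF j] by (simp add: brownian_motion_def)
  have Bm[measurable]: "\<And>i u. i < ?n \<Longrightarrow> 0 \<le> u \<Longrightarrow> (Bs!i) u \<in> borel_measurable M"
    using bm by (simp add: brownian_motion_def)
  have t0: "0 \<le> t" using s by simp
  have [measurable]: "(Bs!j) t \<in> borel_measurable M" "(Bs!j) s \<in> borel_measurable M"
    using Bm j s t0 by auto
  have Bm': "\<And>B u. B \<in> set Bs \<Longrightarrow> 0 \<le> u \<Longrightarrow> B u \<in> borel_measurable M"
    using Bm by (metis in_set_conv_nth)
  define ev where "ev U A i = {\<omega>\<in>space M. \<forall>u\<in>U. (Bs!i) u \<omega> \<in> A i u}"
    for U :: "real set" and A :: "nat \<Rightarrow> real \<Rightarrow> real set" and i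
  define cyl where "cyl U A = {\<omega>\<in>space M. \<forall>i<?n. \<forall>u\<in>U. (Bs!i) u \<omega> \<in> A i u}"
    for U :: "real set" and A :: "nat \<Rightarrow> real \<Rightarrow> real set"
  define \<P> where "\<P> = {cyl U A | U A. finite U \<and> U \<subseteq> {0..s} \<and> (\<forall>i u. A i u \<in> sets borel)}"
  define N where "N E = {\<omega>\<in>space M. (Bs!j) t \<omega> - (Bs!j) s \<omega> \<in> E}" for E
  have Nm: "N E \<in> sets M" if "E \<in> sets borel" for E
    unfolding N_def using that by measurable
  have evm: "ev U A i \<in> sets M" if "finite U" "U \<subseteq> {0..s}" "\<forall>i u. A i u \<in> sets borel" "i < ?n" for U A i
    unfolding ev_def
  proof (rule sets.sets_Collect_finite_All)
    fix u assume "u \<in> U"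
    then have "0 \<le> u" using that by auto
    then have [measurable]: "(Bs!i) u \<in> borel_measurable M" "A i u \<in> sets borel" using that by auto
    show "{\<omega>\<in>space M. (Bs!i) u \<omega> \<in> A i u} \<in> sets M" by measurable
  qed fact
  have cyl_ev: "cyl U A = (\<Inter>i\<in>{..<?n}. ev U A i)" for U A
    using j by (auto simp: cyl_def ev_def)
  have Ps: "\<P> \<subseteq> sets M"
    unfolding \<P>_def cyl_ev using evm j by (auto intro!: sets.finite_INT)
  have IntP: "Int_stable \<P>"
  proof (rule Int_stableI)
    fix a b assume "a \<in> \<P>" "b \<in> \<P>"
    then obtain U A V C where UV: "a = cyl U A" "b = cyl V C" "finite U" "finite V" "U \<subseteq> {0..s}" "V \<subseteq> {0..s}"
      "\<forall>i u. A i u \<in> sets borel" "\<forall>i u. C i u \<in> sets borel" by (auto simp: \<P>_def)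
    \<comment> \<open>Padding with \<open>UNIV\<close> lets two cylinders over different time sets
      be read over the union of these sets.\<close>
    define D where "D i u = (if u \<in> U then A i u else UNIV) \<inter> (if u \<in> V then C i u else UNIV)" for i u
    have "a \<inter> b = cyl (U \<union> V) D"
      unfolding UV(1,2) cyl_def D_def by auto
    moreover have "D i u \<in> sets borel" for i u using UV by (auto simp: D_def)
    ultimately show "a \<inter> b \<in> \<P>" using UV unfolding \<P>_def by blast
  qed
  have sF: "sets ?F \<subseteq> sigma_sets (space M) \<P>"
  proof -
    have "{B u -` A \<inter> space M | B u A. B \<in> set Bs \<and> u \<in> {0..s} \<and> A \<in> sets borel} \<subseteq> \<P>"
    proof safe
      fix B u and A :: "real set" assume H: "B \<in> set Bs" "u \<in> {0..s}" "A \<in> sets borel"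
      then obtain i where i: "i < ?n" "B = Bs!i" by (auto simp: in_set_conv_nth)
      have "B u -` A \<inter> space M = cyl {u} (\<lambda>k v. if k = i then A else UNIV)"
        using i by (auto simp: cyl_def)
      then show "B u -` A \<inter> space M \<in> \<P>" unfolding \<P>_def using H by fastforce
    qed
    moreover from this Ps have "{B u -` A \<inter> space M | B u A. B \<in> set Bs \<and> u \<in> {0..s} \<and> A \<in> sets borel} \<subseteq> Pow (space M)"
      using sets.sets_into_space by blast
    ultimately show ?thesis
      by (simp add: natural_filtration_def sets_measure_of sigma_sets_mono')
  qed
  let ?Q = "PiM {0::real..} (\<lambda>_. borel :: real measure)"
  let ?p = "\<lambda>i \<omega>. \<lambda>t\<in>{0..}. (Bs ! i) t \<omega>"
  have iv: "indep_vars (\<lambda>_. ?Q) ?p {..<?n}"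
    using ind by (simp add: indep_processes_def)
  have prod: "prob (\<Inter>i\<in>{..<?n}. ?p i -` C i \<inter> space M) = (\<Prod>i<?n. prob (?p i -` C i \<inter> space M))"
    if "\<And>i. i < ?n \<Longrightarrow> C i \<in> sets ?Q" for C
    by (rule indep_varsD_finite[OF iv]) (use j that in auto)
  have key: "prob (cyl U A \<inter> N E) = prob (cyl U A) * prob (N E)"
    if U: "finite U" "U \<subseteq> {0..s}" and A: "\<forall>i u. A i u \<in> sets borel" and E: "E \<in> sets borel" for U A E
  proof -
    define C where "C i = {f\<in>space ?Q. \<forall>u\<in>U. f u \<in> A i u}" for i
    \<comment> \<open>The increment event is folded into the j-th factor, so that the independence
      of whole paths can be applied once more, to the same index set.\<close>
    define C' where "C' i = (if i = j then {f\<in>C i. f t - f s \<in> E} else C i)" for i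
    have Cm: "C i \<in> sets ?Q" for i
      unfolding C_def
    proof (rule sets.sets_Collect_finite_All)
      fix u assume "u \<in> U"
      then have [measurable]: "(\<lambda>f. f u) \<in> borel_measurable ?Q"
        using U by (intro measurable_component_singleton) auto
      have [measurable]: "A i u \<in> sets borel" using A by auto
      show "{f\<in>space ?Q. f u \<in> A i u} \<in> sets ?Q" by measurable
    qed fact
    have [measurable]: "(\<lambda>f. f t) \<in> borel_measurable ?Q" "(\<lambda>f. f s) \<in> borel_measurable ?Q"
      using s by (auto intro!: measurable_component_singleton)
    have "{f\<in>C i. f t - f s \<in> E} = C i \<inter> {f\<in>space ?Q. f t - f s \<in> E}" for i by (auto simp: C_def)
    moreover have "{f\<in>space ?Q. f t - f s \<in> E} \<in> sets ?Q" using E by measurable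
    ultimately have C'm: "C' i \<in> sets ?Q" for i using Cm by (auto simp: C'_def)
    have e1: "?p i -` C i \<inter> space M = ev U A i" for i
      using U by (auto simp: C_def ev_def space_PiM subset_eq)
    have e2: "?p i -` C' i \<inter> space M = (if i = j then ev U A i \<inter> N E else ev U A i)" for i
      using e1[of i] s by (auto simp: C'_def N_def)
    have j1: "prob (ev U A j \<inter> N E) = prob (ev U A j) * prob (N E)"
      unfolding ev_def N_def
      by (rule brownian_motion_past_indep[OF bm[OF j] U s]) (use A E in auto)
    have "cyl U A \<inter> N E = (\<Inter>i\<in>{..<?n}. ?p i -` C' i \<inter> space M)"
      using j unfolding cyl_ev e2 by (auto split: if_splits)
    then have "prob (cyl U A \<inter> N E) = (\<Prod>i<?n. prob (?p i -` C' i \<inter> space M))"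
      using prod[OF C'm] by simp
    also have "\<dots> = (\<Prod>i<?n. prob (ev U A i) * (if i = j then prob (N E) else 1))"
      unfolding e2 using j1 by (intro prod.cong) auto
    also have "\<dots> = (\<Prod>i<?n. prob (ev U A i)) * prob (N E)"
      using j by (simp add: prod.distrib)
    also have "(\<Prod>i<?n. prob (ev U A i)) = prob (cyl U A)"
      unfolding cyl_ev e1[symmetric] using prod[of C] Cm by simp
    finally show ?thesis .
  qed
  let ?Ns = "{(\<lambda>\<omega>. (Bs!j) t \<omega> - (Bs!j) s \<omega>) -` E \<inter> space M | E. E \<in> sets borel}"
  have Ns: "(\<lambda>\<omega>. (Bs!j) t \<omega> - (Bs!j) s \<omega>) -` E \<inter> space M = N E" for E by (auto simp: N_def)
  have "indep_set \<P> ?Ns"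
    by (rule indep_setI) (use Ps Nm key in \<open>auto simp: \<P>_def Ns\<close>)
  moreover have "Int_stable ?Ns"
  proof (rule Int_stableI)
    fix a b assume "a \<in> ?Ns" "b \<in> ?Ns"
    then obtain E E' where "a = N E" "b = N E'" "E \<in> sets borel" "E' \<in> sets borel" by (auto simp: Ns)
    then show "a \<inter> b \<in> ?Ns"
      unfolding Ns by (auto intro!: exI[of _ "E \<inter> E'"] simp: N_def)
  qed
  ultimately have "indep_set (sigma_sets (space M) \<P>) (sigma_sets (space M) ?Ns)"
    by (rule indep_set_sigma_sets[OF _ IntP])
  then show ?thesis
    using sF A E by (fold N_def) (auto intro!: indep_setD sigma_sets.Basic[of "N E"] simp: Ns)
qed

section \<open>Exponential bounds for It\^o integrals\<close>

text \<open>A Brownian motion relative to a filtration that may exceed its own: in the application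
  \<open>F\<close> is generated by all three motions, so that the height Z in the integrand is
  adapted while the increments of the integrator remain independent of the past.\<close>

locale filtered_brownian_motion = prob_space M
  for M :: "'a measure" and F :: "real \<Rightarrow> 'a measure" and B :: "real \<Rightarrow> 'a \<Rightarrow> real" +
  assumes space_F: "space (F t) = space M"
    and sets_F: "sets (F t) \<subseteq> sets M"
    and F_mono: "s \<le> t \<Longrightarrow> sets (F s) \<subseteq> sets (F t)"
    and adapted: "0 \<le> t \<Longrightarrow> B t \<in> borel_measurable (F t)"
    and indep_increment: "0 \<le> s \<Longrightarrow> s < t \<Longrightarrow> A \<in> sets (F s) \<Longrightarrow> E \<in> sets borel \<Longrightarrow>
      prob (A \<inter> {\<omega>\<in>space M. B t \<omega> - B s \<omega> \<in> E}) = prob A * prob {\<omega>\<in>space M. B t \<omega> - B s \<omega> \<in> E}"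
    and increment_distr: "0 \<le> s \<Longrightarrow> s < t \<Longrightarrow>
      distributed M lborel (\<lambda>\<omega>. B t \<omega> - B s \<omega>) (normal_density 0 (sqrt (t - s)))"
begin

lemma measurable_F_M: "f \<in> borel_measurable (F t) \<Longrightarrow> f \<in> borel_measurable M"
  using sets_F[of t] space_F[of t] by (auto simp: measurable_def)

lemma measurable_F_mono: "f \<in> borel_measurable (F s) \<Longrightarrow> s \<le> t \<Longrightarrow> f \<in> borel_measurable (F t)"
  using F_mono[of s t] space_F by (auto simp: measurable_def)

end

text \<open>Completing the square: the exponential shifts the mean of the density.\<close>

lemma nn_integral_normal_exp:
  assumes "0 < d"
  shows "(\<integral>\<^sup>+x. ennreal (normal_density 0 (sqrt d) x) * ennreal (exp (v * x - v\<^sup>2 * d / 2)) \<partial>lborel) = 1"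
proof -
  have "normal_density 0 (sqrt d) x * exp (v * x - v\<^sup>2 * d / 2) = normal_density (v * d) (sqrt d) x" for x
  proof -
    have "- x\<^sup>2 / (2 * d) + (v * x - v\<^sup>2 * d / 2) = - (x - v * d)\<^sup>2 / (2 * d)"
      using assms by (simp add: field_simps power2_eq_square)
    then show ?thesis
      using assms by (simp add: normal_density_def flip: exp_add)
  qed
  then have "(\<integral>\<^sup>+x. ennreal (normal_density 0 (sqrt d) x) * ennreal (exp (v * x - v\<^sup>2 * d / 2)) \<partial>lborel)
     = (\<integral>\<^sup>+x. ennreal (normal_density (v * d) (sqrt d) x) \<partial>lborel)"
    by (simp flip: ennreal_mult)
  also have "\<dots> = emeasure (density lborel (normal_density (v * d) (sqrt d))) (space lborel)"
    by (simp add: emeasure_density)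
  also have "\<dots> = 1"
    using prob_space.emeasure_space_1[OF prob_space_normal_density[of "sqrt d" "v * d"]] assms by simp
  finally show ?thesis .
qed

context filtered_brownian_motion
begin

text \<open>By independence the joint law of the past and the increment is a product, so by Fubini
  the increment can be integrated out with the past fixed. The inner integral is the Gaussian one
  with the constant \<open>v \<omega>\<close> in place of \<open>v\<close>, which is 1.\<close>

lemma nn_integral_exp_increment:
  assumes G[measurable]: "G \<in> borel_measurable (F s)" and v[measurable]: "v \<in> borel_measurable (F s)"
    and st: "0 \<le> s" "s \<le> t"
  shows "(\<integral>\<^sup>+\<omega>. G \<omega> * ennreal (exp (v \<omega> * (B t \<omega> - B s \<omega>) - (v \<omega>)\<^sup>2 * (t - s) / 2)) \<partial>M) = (\<integral>\<^sup>+\<omega>. G \<omega> \<partial>M)"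
proof (cases "s = t")
  case False
  then have st: "0 \<le> s" "s < t" using assms by auto
  define N where "N = (\<lambda>\<omega>. B t \<omega> - B s \<omega>)"
  \<comment> \<open>The identity map, read as a random element of \<open>F s\<close>, is what
    carries the whole past; its law is paired with the law of the increment.\<close>
  have id[measurable]: "(\<lambda>\<omega>. \<omega>) \<in> measurable M (F s)"
    using sets_F[of s] space_F[of s] sets.sets_into_space[of _ M]
    by (intro measurableI) (auto simp: Int_absorb2 subset_iff)
  have N[measurable]: "N \<in> borel_measurable M"
    using measurable_F_M[OF adapted, of s] measurable_F_M[OF adapted, of t] st by (simp add: N_def)
  define h where "h = (\<lambda>(\<omega>, x). G \<omega> * ennreal (exp (v \<omega> * x - (v \<omega>)\<^sup>2 * (t - s) / 2)))"
  have h[measurable]: "h \<in> borel_measurable (F s \<Otimes>\<^sub>M borel)" unfolding h_def by measurable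
  interpret N: prob_space "distr M borel N" by (rule prob_space_distr) measurable
  interpret I: prob_space "distr M (F s) (\<lambda>\<omega>. \<omega>)" by (rule prob_space_distr) measurable
  interpret IN: pair_prob_space "distr M (F s) (\<lambda>\<omega>. \<omega>)" "distr M borel N" ..
  have eq: "distr M (F s) (\<lambda>\<omega>. \<omega>) \<Otimes>\<^sub>M distr M borel N = distr M (F s \<Otimes>\<^sub>M borel) (\<lambda>\<omega>. (\<omega>, N \<omega>))"
  proof (rule pair_measure_eqI)
    fix A E assume "A \<in> sets (distr M (F s) (\<lambda>\<omega>. \<omega>))" "E \<in> sets (distr M borel N)"
    then have AE: "A \<in> sets (F s)" "E \<in> sets borel" by auto
    have "A \<subseteq> space M" using AE sets.sets_into_space[of A "F s"] space_F by simp
    then have 1: "(\<lambda>\<omega>. (\<omega>, N \<omega>)) -` (A \<times> E) \<inter> space M = A \<inter> {\<omega>\<in>space M. N \<omega> \<in> E}"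
      "(\<lambda>\<omega>. \<omega>) -` A \<inter> space M = A" "N -` E \<inter> space M = {\<omega>\<in>space M. N \<omega> \<in> E}" by auto
    show "emeasure (distr M (F s) (\<lambda>\<omega>. \<omega>)) A * emeasure (distr M borel N) E =
      emeasure (distr M (F s \<Otimes>\<^sub>M borel) (\<lambda>\<omega>. (\<omega>, N \<omega>))) (A \<times> E)"
      using indep_increment[OF st AE, folded fun_cong[OF N_def]] AE
      by (simp add: emeasure_distr 1 Int_absorb2[OF \<open>A \<subseteq> space M\<close>] emeasure_eq_measure ennreal_mult)
  qed (simp_all add: I.sigma_finite_measure_axioms N.sigma_finite_measure_axioms)
  have dN: "distr M borel N = density lborel (normal_density 0 (sqrt (t - s)))"
  proof -
    have "distr M borel N = distr M lborel N" by (rule distr_cong) auto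
    then show ?thesis using increment_distr[OF st] by (simp add: distributed_def N_def)
  qed
  have inner: "(\<integral>\<^sup>+x. h (\<omega>, x) \<partial>distr M borel N) = G \<omega>" for \<omega>
  proof -
    have "(\<integral>\<^sup>+x. h (\<omega>, x) \<partial>distr M borel N)
      = G \<omega> * (\<integral>\<^sup>+x. ennreal (exp (v \<omega> * x - (v \<omega>)\<^sup>2 * (t - s) / 2)) \<partial>distr M borel N)"
      by (simp add: h_def nn_integral_cmult)
    also have "(\<integral>\<^sup>+x. ennreal (exp (v \<omega> * x - (v \<omega>)\<^sup>2 * (t - s) / 2)) \<partial>distr M borel N) = 1"
      unfolding dN using nn_integral_normal_exp[of "t - s" "v \<omega>"] st
      by (subst nn_integral_density) auto
    finally show ?thesis by simp
  qed
  have "(\<integral>\<^sup>+\<omega>. G \<omega> * ennreal (exp (v \<omega> * (B t \<omega> - B s \<omega>) - (v \<omega>)\<^sup>2 * (t - s) / 2)) \<partial>M)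
      = (\<integral>\<^sup>+z. h z \<partial>distr M (F s \<Otimes>\<^sub>M borel) (\<lambda>\<omega>. (\<omega>, N \<omega>)))"
    using nn_integral_distr[OF measurable_Pair[OF id N], of h] h
    by (simp only: measurable_distr_eq1 h_def N_def prod.case)
  also have "\<dots> = (\<integral>\<^sup>+\<omega>. (\<integral>\<^sup>+x. h (\<omega>, x) \<partial>distr M borel N) \<partial>distr M (F s) (\<lambda>\<omega>. \<omega>))"
    unfolding eq[symmetric] by (rule N.nn_integral_fst[symmetric]) simp
  also have "\<dots> = (\<integral>\<^sup>+\<omega>. G \<omega> \<partial>distr M (F s) (\<lambda>\<omega>. \<omega>))" by (simp add: inner)
  also have "\<dots> = (\<integral>\<^sup>+\<omega>. G \<omega> \<partial>M)" by (rule nn_integral_distr[OF id]) (simp add: G)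
  finally show ?thesis .
qed (use assms in simp)

text \<open>The mean of the exponential martingale of a piecewise constant integrand. The last
  increment is integrated out first, all other factors being known at time \<open>p n\<close>; since
  everything is nonnegative, no integrability enters the induction.\<close>

lemma nn_integral_exp_sum:
  assumes p: "0 \<le> p 0" "\<And>i. i < n \<Longrightarrow> p i \<le> p (Suc i)"
    and v: "\<And>i. i < n \<Longrightarrow> v i \<in> borel_measurable (F (p i))"
  shows "(\<integral>\<^sup>+\<omega>. ennreal (exp (\<Sum>i<n. v i \<omega> * (B (p (Suc i)) \<omega> - B (p i) \<omega>)
      - (v i \<omega>)\<^sup>2 * (p (Suc i) - p i) / 2)) \<partial>M) = 1"
  using assms
proof (induction n)
  case 0
  then show ?case by (simp add: emeasure_space_1)
next
  case (Suc n)
  have pm: "p i \<le> p j" if "i \<le> j" "j \<le> n" for i j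
    using that by (induction j) (auto simp: le_Suc_eq intro: order_trans[OF _ Suc.prems(2)])
  have p0: "0 \<le> p i" if "i \<le> n" for i using pm[of 0 i] that Suc.prems(1) by simp
  have Bm: "B (p i) \<in> borel_measurable (F (p n))" if "i \<le> n" for i
    using measurable_F_mono[OF adapted[OF p0[OF that]]] pm[of i n] that by simp
  have vm: "v i \<in> borel_measurable (F (p n))" if "i \<le> n" for i
    using measurable_F_mono[OF Suc.prems(3)[of i]] pm[of i n] that by simp
  define E where "E \<omega> = (\<Sum>i<n. v i \<omega> * (B (p (Suc i)) \<omega> - B (p i) \<omega>) - (v i \<omega>)\<^sup>2 * (p (Suc i) - p i) / 2)" for \<omega>
  have E: "(\<lambda>\<omega>. ennreal (exp (E \<omega>))) \<in> borel_measurable (F (p n))"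
  proof -
    have [measurable]: "E \<in> borel_measurable (F (p n))"
      unfolding E_def using Bm vm by (intro borel_measurable_sum borel_measurable_diff borel_measurable_times
        borel_measurable_divide borel_measurable_power) auto
    show ?thesis by measurable
  qed
  have "(\<integral>\<^sup>+\<omega>. ennreal (exp (\<Sum>i<Suc n. v i \<omega> * (B (p (Suc i)) \<omega> - B (p i) \<omega>)
      - (v i \<omega>)\<^sup>2 * (p (Suc i) - p i) / 2)) \<partial>M)
    = (\<integral>\<^sup>+\<omega>. ennreal (exp (E \<omega>)) * ennreal (exp (v n \<omega> * (B (p (Suc n)) \<omega> - B (p n) \<omega>) - (v n \<omega>)\<^sup>2 * (p (Suc n) - p n) / 2)) \<partial>M)"
    by (simp add: E_def flip: ennreal_mult exp_add)
  also have "\<dots> = (\<integral>\<^sup>+\<omega>. ennreal (exp (E \<omega>)) \<partial>M)"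
    by (rule nn_integral_exp_increment[OF E]) (use Suc.prems p0 in auto)
  also have "\<dots> = 1" unfolding E_def using Suc by simp
  finally show ?case .
qed

end

lemma natural_filtration_bm:
  assumes bm: "\<And>i. i < length Bs \<Longrightarrow> brownian_motion M (Bs ! i)"
    and ind: "indep_processes M Bs" and j: "j < length Bs"
  shows "filtered_brownian_motion M (natural_filtration M (set Bs)) (Bs ! j)"
proof -
  interpret prob_space M using bm[OF j] by (simp add: brownian_motion_def)
  have Bm: "B u \<in> borel_measurable M" if "B \<in> set Bs" "0 \<le> u" for B u
    using bm that by (auto simp: in_set_conv_nth brownian_motion_def)
  show ?thesis
  proof (unfold_locales, goal_cases)
    case 1 show ?case using natural_filtration_sets(1)[where \<B> = "set Bs" and M = M] Bm by blast
  next
    case 2 show ?case using natural_filtration_sets(2)[where \<B> = "set Bs" and M = M] Bm by blast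
  next
    case 3 then show ?case using natural_filtration_sets(3)[where \<B> = "set Bs" and M = M] Bm by blast
  next
    case 4 then show ?case
      using natural_filtration_sets(4)[where \<B> = "set Bs" and M = M and B = "Bs ! j"] Bm j by simp
  next
    case 5 then show ?case by (intro natural_filtration_indep_increment[OF bm ind j])
  next
    case 6 then show ?case using bm[OF j] by (simp add: brownian_motion_def)
  qed
qed

section \<open>Simple processes on a common time grid\<close>

text \<open>The right end \<open>p (Suc i)\<close> of a cell lies in \<open>(p k, p l]\<close>
  exactly when the whole cell does, so the indicator selects consecutive cells and the sum
  telescopes.\<close>

lemma sum_indicator_telescope:
  fixes p f :: "nat \<Rightarrow> real"
  assumes p: "\<And>i j. i < j \<Longrightarrow> j \<le> N \<Longrightarrow> p i < p j" and kl: "k \<le> N" "l \<le> N" "p k \<le> p l"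
  shows "(\<Sum>i<N. indicator {p k<..p l} (p (Suc i)) * (f (Suc i) - f i)) = f l - f k"
proof -
  have kl': "k \<le> l" using p[of l k] kl by (meson not_le)
  have le: "p i \<le> p j \<longleftrightarrow> i \<le> j" if "i \<le> N" "j \<le> N" for i j
    using p[of i j] p[of j i] that by (metis not_less order.strict_iff_order linorder_cases)
  have "(\<Sum>i<N. indicator {p k<..p l} (p (Suc i)) * (f (Suc i) - f i)) = (\<Sum>i<N. if i \<in> {k..<l} then f (Suc i) - f i else 0)"
  proof (rule sum.cong)
    fix i assume "i \<in> {..<N}"
    then have "p (Suc i) \<le> p l \<longleftrightarrow> i < l" "p (Suc i) \<le> p k \<longleftrightarrow> i < k"
      using le[of "Suc i" l] le[of "Suc i" k] kl by auto
    then show "indicator {p k<..p l} (p (Suc i)) * (f (Suc i) - f i) = (if i \<in> {k..<l} then f (Suc i) - f i else 0)"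
      by (auto simp: indicator_def not_le)
  qed simp
  also have "\<dots> = (\<Sum>i\<in>{..<N} \<inter> {k..<l}. f (Suc i) - f i)"
    by (rule sum.inter_restrict[symmetric]) simp
  also have "{..<N} \<inter> {k..<l} = {k..<l}" using kl by auto
  also have "(\<Sum>i\<in>{k..<l}. f (Suc i) - f i) = f l - f k" using kl' by (rule sum_Suc_diff')
  finally show ?thesis .
qed

lemma simple_process_times_nonneg:
  assumes "simple_process M F n \<tau> \<xi>" "j \<le> n"
  shows "0 \<le> \<tau> j"
  using assms(2) by (induction j) (use assms(1) in \<open>auto simp: simple_process_def Suc_le_eq intro: order_trans\<close>)

text \<open>The cut-off is put into the interval ends rather than into the value: the result is
  again a step function, whose jump times \<open>min t (\<tau> j)\<close> are just those occurring
  in \<open>simple_integral\<close> at time t.\<close>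

definition stopped_value ::
    "real \<Rightarrow> nat \<Rightarrow> (nat \<Rightarrow> real) \<Rightarrow> (nat \<Rightarrow> 'a \<Rightarrow> real) \<Rightarrow> real \<Rightarrow> 'a \<Rightarrow> real" where
  "stopped_value t n \<tau> \<xi> s \<omega> = (\<Sum>j<n. \<xi> j \<omega> * indicator {min t (\<tau> j)<..min t (\<tau> (Suc j))} s)"

lemma stopped_value_eq: "stopped_value t n \<tau> \<xi> s \<omega> = (if s \<le> t then simple_value n \<tau> \<xi> s \<omega> else 0)"
  unfolding stopped_value_def simple_value_def
  by (auto simp: indicator_def intro!: sum.cong sum.neutral)

lemma stopped_value_const:
  assumes "\<And>j. j \<le> n \<Longrightarrow> min t (\<tau> j) \<notin> {a<..<b}" "r \<in> {a<..b}"
  shows "stopped_value t n \<tau> \<xi> r \<omega> = stopped_value t n \<tau> \<xi> b \<omega>"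
  unfolding stopped_value_def
proof (rule sum.cong)
  fix j assume "j \<in> {..<n}"
  then have "min t (\<tau> j) \<notin> {a<..<b}" "min t (\<tau> (Suc j)) \<notin> {a<..<b}" using assms(1)[of j] assms(1)[of "Suc j"] by auto
  then have "indicator {min t (\<tau> j)<..min t (\<tau> (Suc j))} r = (indicator {min t (\<tau> j)<..min t (\<tau> (Suc j))} b :: real)"
    using assms(2) by (auto simp: indicator_def simp del: min_less_iff_conj)
  then show "\<xi> j \<omega> * indicator {min t (\<tau> j)<..min t (\<tau> (Suc j))} r = \<xi> j \<omega> * indicator {min t (\<tau> j)<..min t (\<tau> (Suc j))} b"
    by simp
qed simp

text \<open>Step functions with intervals open on the left take on each cell the value at its right
  end. Evaluating at \<open>p (Suc i)\<close> is therefore not anticipating: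
  \<open>stopped_value_measurable\<close> shows that this value is known at the left end
  \<open>p i\<close>.\<close>

lemma simple_integral_partition:
  assumes p: "\<And>i j. i < j \<Longrightarrow> j \<le> N \<Longrightarrow> p i < p j"
    and \<tau>: "\<And>j. j < n \<Longrightarrow> \<tau> j \<le> \<tau> (Suc j)" "\<And>j. j \<le> n \<Longrightarrow> min t (\<tau> j) \<in> p ` {..N}"
  shows "simple_integral B n \<tau> \<xi> t \<omega>
    = (\<Sum>i<N. stopped_value t n \<tau> \<xi> (p (Suc i)) \<omega> * (B (p (Suc i)) \<omega> - B (p i) \<omega>))"
proof -
  have "B (min t (\<tau> (Suc j))) \<omega> - B (min t (\<tau> j)) \<omega> = (\<Sum>i<N. indicator {min t (\<tau> j)<..min t (\<tau> (Suc j))} (p (Suc i)) * (B (p (Suc i)) \<omega> - B (p i) \<omega>))"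
    if j: "j < n" for j
  proof -
    obtain k l where kl: "min t (\<tau> j) = p k" "min t (\<tau> (Suc j)) = p l" "k \<le> N" "l \<le> N"
      using \<tau>(2)[of j] \<tau>(2)[of "Suc j"] j by auto
    have "p k \<le> p l" using \<tau>(1)[OF j] unfolding kl(1,2)[symmetric] by linarith
    then show ?thesis
      unfolding kl using sum_indicator_telescope[where p = p, OF p kl(3,4), where f = "\<lambda>i. B (p i) \<omega>"] by simp
  qed
  then have "simple_integral B n \<tau> \<xi> t \<omega> = (\<Sum>j<n. \<xi> j \<omega> * (\<Sum>i<N. indicator {min t (\<tau> j)<..min t (\<tau> (Suc j))} (p (Suc i)) * (B (p (Suc i)) \<omega> - B (p i) \<omega>)))"
    unfolding simple_integral_def by simp
  also have "\<dots> = (\<Sum>i<N. stopped_value t n \<tau> \<xi> (p (Suc i)) \<omega> * (B (p (Suc i)) \<omega> - B (p i) \<omega>))"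
    unfolding stopped_value_def sum_distrib_left sum_distrib_right
    by (subst sum.swap) (simp add: mult.assoc)
  finally show ?thesis .
qed

lemma finite_set_enumeration:
  fixes P :: "real set"
  assumes "finite P" "P \<noteq> {}"
  obtains p :: "nat \<Rightarrow> real" and N where "\<And>i j. i < j \<Longrightarrow> j \<le> N \<Longrightarrow> p i < p j" "p ` {..N} = P"
proof -
  let ?xs = "sorted_list_of_set P"
  have l: "length ?xs > 0" using assms by (simp add: card_gt_0_iff)
  have "\<And>i j. i < j \<Longrightarrow> j \<le> length ?xs - 1 \<Longrightarrow> ?xs ! i < ?xs ! j"
    using l by (intro sorted_wrt_nth_less[of "(<)"]) auto
  moreover have "(!) ?xs ` {..length ?xs - 1} = set ?xs"
  proof -
    have "{..length ?xs - 1} = {0..<length ?xs}" using l by auto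
    then show ?thesis using nth_image[of "length ?xs" ?xs] by simp
  qed
  ultimately show ?thesis using that[of "length ?xs - 1" "(!) ?xs"] assms by simp
qed

context filtered_brownian_motion
begin

text \<open>An interval of the step function that contains b cannot start inside
  \<open>(a, b)\<close>, so it starts at time a or before, and its coefficient is known at time
  a.\<close>

lemma stopped_value_measurable:
  assumes sp: "simple_process M F n \<tau> \<xi>" and ab: "a < b" "\<And>j. j \<le> n \<Longrightarrow> min t (\<tau> j) \<notin> {a<..<b}"
  shows "stopped_value t n \<tau> \<xi> b \<in> borel_measurable (F a)"
  unfolding stopped_value_def
proof (rule borel_measurable_sum)
  fix j assume j: "j \<in> {..<n}"
  show "(\<lambda>\<omega>. \<xi> j \<omega> * indicator {min t (\<tau> j)<..min t (\<tau> (Suc j))} b) \<in> borel_measurable (F a)"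
  proof (cases "b \<in> {min t (\<tau> j)<..min t (\<tau> (Suc j))}")
    case True
    then have "\<tau> j \<le> a" using ab(2)[of j] j ab(1) by (auto simp: min_def split: if_splits)
    moreover have "\<xi> j \<in> borel_measurable (F (\<tau> j))" using sp j by (simp add: simple_process_def)
    ultimately show ?thesis using measurable_F_mono by (intro borel_measurable_times) auto
  qed simp
qed

text \<open>Both simple processes are written on a common refinement of their time grids, which turns the
  difference of their integrals at different times into a single sum.\<close>

lemma nn_integral_exp_simple:
  assumes sp1: "simple_process M F n \<tau> \<xi>" and sp2: "simple_process M F n' \<tau>' \<xi>'" and st: "0 \<le> s" "s \<le> t"
  defines "D \<equiv> \<lambda>r \<omega>. stopped_value t n' \<tau>' \<xi>' r \<omega> - stopped_value s n \<tau> \<xi> r \<omega>"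
  defines "Q \<equiv> \<lambda>\<omega>. \<integral>\<^sup>+r\<in>{0..t}. ennreal ((D r \<omega>)\<^sup>2) \<partial>lborel"
  shows "(\<integral>\<^sup>+\<omega>. (if Q \<omega> = \<infinity> then 0 else ennreal (exp (\<theta> * (simple_integral B n' \<tau>' \<xi>' t \<omega> - simple_integral B n \<tau> \<xi> s \<omega>)
     - \<theta>\<^sup>2 / 2 * enn2real (Q \<omega>)))) \<partial>M) \<le> 1"
proof -
  define P where "P = {0, t} \<union> (\<lambda>j. min t (\<tau>' j)) ` {..n'} \<union> (\<lambda>j. min s (\<tau> j)) ` {..n}"
  have P: "finite P" "P \<noteq> {}" "P \<subseteq> {0..t}"
    using st simple_process_times_nonneg[OF sp1] simple_process_times_nonneg[OF sp2] by (auto simp: P_def min_le_iff_disj)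
  obtain p :: "nat \<Rightarrow> real" and N where p: "\<And>i j. i < j \<Longrightarrow> j \<le> N \<Longrightarrow> p i < p j" "p ` {..N} = P"
    using finite_set_enumeration[OF P(1,2)] by metis
  have pP: "p i \<in> {0..t}" if "i \<le> N" for i using that p(2) P(3) by auto
  have gap: "q \<notin> {p i<..<p (Suc i)}" if "q \<in> P" "i < N" for q and i :: nat
  proof -
    have "q \<in> p ` {..N}" using that(1) by (simp only: p(2))
    then obtain k where k: "k \<le> N" "q = p k" by blast
    show ?thesis
    proof (cases "k \<le> i")
      case True
      then have "p k \<le> p i" using p(1)[of k i] that by (cases "k = i") auto
      then show ?thesis using k by simp
    next
      case False
      then have "p (Suc i) \<le> p k" using p(1)[of "Suc i" k] k by (cases "Suc i = k") auto
      then show ?thesis using k by simp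
    qed
  qed
  have gap': "j \<le> n' \<Longrightarrow> min t (\<tau>' j) \<notin> {p i<..<p (Suc i)}" "j \<le> n \<Longrightarrow> min s (\<tau> j) \<notin> {p i<..<p (Suc i)}" if "i < N" for i j :: nat
    by (rule gap; (use that in \<open>auto simp: P_def\<close>))+
  have pp: "0 \<le> p (Suc i) - p i" "p i \<le> p (Suc i)" if "i < N" for i using p(1)[of i "Suc i"] that by auto
  define v where "v i \<omega> = \<theta> * D (p (Suc i)) \<omega>" for i :: nat and \<omega>
  have v: "v i \<in> borel_measurable (F (p i))" if "i < N" for i :: nat
    unfolding v_def D_def using that p(1)[of i "Suc i"]
    by (intro borel_measurable_times borel_measurable_diff stopped_value_measurable[OF sp1] stopped_value_measurable[OF sp2] gap') auto
  have J: "simple_integral B n' \<tau>' \<xi>' t \<omega> - simple_integral B n \<tau> \<xi> s \<omega> = (\<Sum>i<N. D (p (Suc i)) \<omega> * (B (p (Suc i)) \<omega> - B (p i) \<omega>))" for \<omega>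
  proof -
    have 1: "simple_integral B n' \<tau>' \<xi>' t \<omega> = (\<Sum>i<N. stopped_value t n' \<tau>' \<xi>' (p (Suc i)) \<omega> * (B (p (Suc i)) \<omega> - B (p i) \<omega>))"
      by (rule simple_integral_partition) (use sp2 p in \<open>auto simp: simple_process_def P_def\<close>)
    have 2: "simple_integral B n \<tau> \<xi> s \<omega> = (\<Sum>i<N. stopped_value s n \<tau> \<xi> (p (Suc i)) \<omega> * (B (p (Suc i)) \<omega> - B (p i) \<omega>))"
      by (rule simple_integral_partition) (use sp1 p in \<open>auto simp: simple_process_def P_def\<close>)
    show ?thesis unfolding 1 2 D_def by (simp add: left_diff_distrib sum_subtractf)
  qed
  have Q: "ennreal (\<Sum>i<N. (D (p (Suc i)) \<omega>)\<^sup>2 * (p (Suc i) - p i)) \<le> Q \<omega>" for \<omega>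
  proof -
    have "ennreal (\<Sum>i<N. (D (p (Suc i)) \<omega>)\<^sup>2 * (p (Suc i) - p i)) = (\<Sum>i<N. ennreal ((D (p (Suc i)) \<omega>)\<^sup>2 * (p (Suc i) - p i)))"
      using pp by (intro sum_ennreal[symmetric]) (auto intro!: mult_nonneg_nonneg)
    also have "\<dots> = (\<Sum>i<N. \<integral>\<^sup>+r. ennreal ((D (p (Suc i)) \<omega>)\<^sup>2) * indicator {p i<..p (Suc i)} r \<partial>lborel)"
      using pp by (intro sum.cong) (auto simp: nn_integral_cmult_indicator ennreal_mult)
    also have "\<dots> = (\<integral>\<^sup>+r. (\<Sum>i<N. ennreal ((D (p (Suc i)) \<omega>)\<^sup>2) * indicator {p i<..p (Suc i)} r) \<partial>lborel)"
      by (rule nn_integral_sum[symmetric]) auto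
    also have "\<dots> \<le> Q \<omega>"
      unfolding Q_def
    proof (rule nn_integral_mono)
      fix r :: real
      show "(\<Sum>i<N. ennreal ((D (p (Suc i)) \<omega>)\<^sup>2) * indicator {p i<..p (Suc i)} r) \<le> ennreal ((D r \<omega>)\<^sup>2) * indicator {0..t} r"
      proof (cases "\<exists>i<N. r \<in> {p i<..p (Suc i)}")
        case True
        then obtain i where i: "i < N" "r \<in> {p i<..p (Suc i)}" by auto
        have other: "r \<notin> {p k<..p (Suc k)}" if "k < N" "k \<noteq> i" for k
          using gap[of "p k" i] gap[of "p (Suc k)" i] gap[of "p i" k] gap[of "p (Suc i)" k] p(1)[of k i] p(1)[of i k]
             p(1)[of "Suc k" i] p(1)[of "Suc i" k] p(1)[of k "Suc k"] p(1)[of i "Suc i"] that i p(2)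
          by (cases "k < i"; cases "Suc k = i"; cases "Suc i = k") auto
        have "(\<Sum>k<N. ennreal ((D (p (Suc k)) \<omega>)\<^sup>2) * indicator {p k<..p (Suc k)} r) =
          (\<Sum>k<N. if k = i then ennreal ((D (p (Suc k)) \<omega>)\<^sup>2) else 0)"
          using other i by (intro sum.cong) (auto simp: indicator_def)
        also have "\<dots> = ennreal ((D (p (Suc i)) \<omega>)\<^sup>2)" using i by simp
        also have "D (p (Suc i)) \<omega> = D r \<omega>"
          unfolding D_def using i
          by (intro arg_cong2[where f="(-)"] stopped_value_const[symmetric, where a="p i"] gap')
        also have "ennreal ((D r \<omega>)\<^sup>2) = ennreal ((D r \<omega>)\<^sup>2) * indicator {0..t} r"
          using i pP[of i] pP[of "Suc i"] by (auto simp: indicator_def)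
        finally show ?thesis by simp
      next
        case False
        then have "(\<Sum>i<N. ennreal ((D (p (Suc i)) \<omega>)\<^sup>2) * indicator {p i<..p (Suc i)} r) = 0"
          by (intro sum.neutral) (auto simp: indicator_def)
        then show ?thesis by simp
      qed
    qed
    finally show ?thesis .
  qed
  \<comment> \<open>\<open>enn2real\<close> sends infinity to 0, which would erase the compensator;
    the value 0 on that event avoids this and spares a separate proof that \<open>Q\<close> is
    finite.\<close>
  have "(if Q \<omega> = \<infinity> then 0 else ennreal (exp (\<theta> * (simple_integral B n' \<tau>' \<xi>' t \<omega> - simple_integral B n \<tau> \<xi> s \<omega>)
     - \<theta>\<^sup>2 / 2 * enn2real (Q \<omega>)))) \<le> ennreal (exp (\<Sum>i<N. v i \<omega> * (B (p (Suc i)) \<omega> - B (p i) \<omega>)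
      - (v i \<omega>)\<^sup>2 * (p (Suc i) - p i) / 2))" for \<omega>
  proof (cases "Q \<omega> = \<infinity>")
    case False
    have nonneg: "0 \<le> (\<Sum>i<N. (D (p (Suc i)) \<omega>)\<^sup>2 * (p (Suc i) - p i))"
      using pp by (intro sum_nonneg mult_nonneg_nonneg) auto
    have "(\<Sum>i<N. (D (p (Suc i)) \<omega>)\<^sup>2 * (p (Suc i) - p i)) \<le> enn2real (Q \<omega>)"
      using enn2real_mono[OF Q[of \<omega>]] False by (simp add: enn2real_ennreal[OF nonneg] top.not_eq_extremum)
    then have "\<theta>\<^sup>2 / 2 * (\<Sum>i<N. (D (p (Suc i)) \<omega>)\<^sup>2 * (p (Suc i) - p i)) \<le> \<theta>\<^sup>2 / 2 * enn2real (Q \<omega>)"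
      by (intro mult_left_mono) auto
    then have "\<theta> * (simple_integral B n' \<tau>' \<xi>' t \<omega> - simple_integral B n \<tau> \<xi> s \<omega>) - \<theta>\<^sup>2 / 2 * enn2real (Q \<omega>)
      \<le> (\<Sum>i<N. v i \<omega> * (B (p (Suc i)) \<omega> - B (p i) \<omega>) - (v i \<omega>)\<^sup>2 * (p (Suc i) - p i) / 2)"
      unfolding J v_def by (simp add: sum_subtractf sum_distrib_left power_mult_distrib mult.assoc)
    then show ?thesis using False by simp
  qed simp
  then have "(\<integral>\<^sup>+\<omega>. (if Q \<omega> = \<infinity> then 0 else ennreal (exp (\<theta> * (simple_integral B n' \<tau>' \<xi>' t \<omega> - simple_integral B n \<tau> \<xi> s \<omega>)
     - \<theta>\<^sup>2 / 2 * enn2real (Q \<omega>)))) \<partial>M) \<le> (\<integral>\<^sup>+\<omega>. ennreal (exp (\<Sum>i<N. v i \<omega> * (B (p (Suc i)) \<omega> - B (p i) \<omega>)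
      - (v i \<omega>)\<^sup>2 * (p (Suc i) - p i) / 2)) \<partial>M)"
    by (rule nn_integral_mono)
  also have "\<dots> = 1"
    by (rule nn_integral_exp_sum) (use pP pp v in auto)
  finally show ?thesis .
qed

end

section \<open>Passage from simple processes to the Ito integral\<close>

text \<open>Indices with means below 2^(-k) make the series of the chosen functions integrable,
  hence almost everywhere convergent, so its terms tend to 0.\<close>

lemma AE_subseq_tendsto_0:
  fixes e :: "nat \<Rightarrow> 'a \<Rightarrow> ennreal"
  assumes e[measurable]: "\<And>k. e k \<in> borel_measurable M" and lim: "(\<lambda>k. \<integral>\<^sup>+\<omega>. e k \<omega> \<partial>M) \<longlonglongrightarrow> 0"
  obtains r :: "nat \<Rightarrow> nat" where "AE \<omega> in M. (\<lambda>k. e (r k) \<omega>) \<longlonglongrightarrow> 0"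
proof -
  have "\<exists>j. (\<integral>\<^sup>+\<omega>. e j \<omega> \<partial>M) < ennreal ((1/2) ^ k)" for k :: nat
    using order_tendstoD(2)[OF lim, of "ennreal ((1/2) ^ k)"] by (auto simp: eventually_sequentially)
  then obtain r where r: "\<And>k. (\<integral>\<^sup>+\<omega>. e (r k) \<omega> \<partial>M) < ennreal ((1/2) ^ k)" by metis
  have "(\<integral>\<^sup>+\<omega>. (\<Sum>k. e (r k) \<omega>) \<partial>M) = (\<Sum>k. \<integral>\<^sup>+\<omega>. e (r k) \<omega> \<partial>M)"
    by (rule nn_integral_suminf) simp
  also have "\<dots> \<le> (\<Sum>k. ennreal ((1/2) ^ k))"
    by (intro suminf_le less_imp_le r) auto
  also have "\<dots> = ennreal (\<Sum>k. (1/2) ^ k)" by (rule suminf_ennreal2) (auto intro!: summable_geometric)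
  finally have "(\<integral>\<^sup>+\<omega>. (\<Sum>k. e (r k) \<omega>) \<partial>M) \<noteq> \<infinity>" by (auto simp: top_unique)
  then have "AE \<omega> in M. (\<Sum>k. e (r k) \<omega>) \<noteq> \<infinity>"
    by (intro nn_integral_PInf_AE) measurable
  then have "AE \<omega> in M. (\<lambda>k. e (r k) \<omega>) \<longlonglongrightarrow> 0"
  proof eventually_elim
    case (elim \<omega>)
    have fin: "e (r k) \<omega> \<noteq> \<infinity>" for k
      using elim ennreal_suminf_lessD[of "\<lambda>k. e (r k) \<omega>" \<infinity>] by (auto simp: top.not_eq_extremum)
    define f where "f k = enn2real (e (r k) \<omega>)" for k
    have f: "e (r k) \<omega> = ennreal (f k)" for k using fin[of k] by (simp add: f_def top.not_eq_extremum)
    have "(\<Sum>k. ennreal (f k)) \<noteq> \<infinity>" using elim by (simp flip: f)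
    then have "summable f" by (intro summable_suminf_not_top) (auto simp: f_def)
    then have "f \<longlonglongrightarrow> 0" by (rule summable_LIMSEQ_zero)
    then show ?case using tendsto_ennrealI[of f 0] by (simp add: f)
  qed
  then show ?thesis using that by blast
qed

text \<open>Integrands are jointly measurable only over times in [0, infinity). As
  \<open>0 \<le> a\<close>, the integral equals one against Lebesgue measure restricted to the
  half-line, where the standard result on integrals with a parameter applies.\<close>

lemma borel_measurable_set_nn_integral:
  fixes g :: "real \<times> 'a \<Rightarrow> ennreal"
  assumes g[measurable]: "g \<in> borel_measurable (restrict_space borel {0..} \<Otimes>\<^sub>M M)" and a: "0 \<le> a"
  shows "(\<lambda>\<omega>. \<integral>\<^sup>+r\<in>{a..b}. g (r, \<omega>) \<partial>lborel) \<in> borel_measurable M"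
proof -
  let ?L = "restrict_space lborel {0::real..}"
  interpret L: sigma_finite_measure ?L
    by (rule sigma_finite_measure_restrict_space) (auto simp: sigma_finite_lborel)
  have s: "sets ?L = sets (restrict_space borel {0..})" by (simp add: sets_restrict_space)
  have [measurable]: "g \<in> borel_measurable (?L \<Otimes>\<^sub>M M)"
    using g by (simp cong: measurable_cong_sets sets_pair_measure_cong add: s)
  have 1: "(\<lambda>(r, \<omega>). g (r, \<omega>) * indicator {a..b} r) \<in> borel_measurable (?L \<Otimes>\<^sub>M M)"
  proof -
    have [measurable]: "(\<lambda>r. indicator {a..b} r :: ennreal) \<in> borel_measurable ?L"
      by (intro measurable_restrict_space1) simp
    show ?thesis by measurable
  qed
  then have 2: "(\<lambda>(\<omega>, r). g (r, \<omega>) * indicator {a..b} r) \<in> borel_measurable (M \<Otimes>\<^sub>M ?L)"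
    by (subst measurable_pair_swap_iff) (simp add: case_prod_beta)
  have "(\<lambda>\<omega>. \<integral>\<^sup>+r. g (r, \<omega>) * indicator {a..b} r \<partial>?L) \<in> borel_measurable M"
    by (rule L.borel_measurable_nn_integral[OF 2])
  also have "(\<lambda>\<omega>. \<integral>\<^sup>+r. g (r, \<omega>) * indicator {a..b} r \<partial>?L) = (\<lambda>\<omega>. \<integral>\<^sup>+r\<in>{a..b}. g (r, \<omega>) \<partial>lborel)"
    using a by (auto simp: nn_integral_restrict_space indicator_def fun_eq_iff intro!: nn_integral_cong)
  finally show ?thesis .
qed

lemma ennreal_power2_add_le:
  fixes x y z :: real
  shows "ennreal ((x - z)\<^sup>2) \<le> 2 * ennreal ((x - y)\<^sup>2) + 2 * ennreal ((y - z)\<^sup>2)"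
proof -
  have "(x - z)\<^sup>2 \<le> 2 * (x - y)\<^sup>2 + 2 * (y - z)\<^sup>2"
    using zero_le_power2[of "(x - y) - (y - z)"] by (simp add: power2_eq_square algebra_simps)
  then have "ennreal ((x - z)\<^sup>2) \<le> ennreal (2 * (x - y)\<^sup>2 + 2 * (y - z)\<^sup>2)" by (rule ennreal_leI)
  also have "\<dots> = 2 * ennreal ((x - y)\<^sup>2) + 2 * ennreal ((y - z)\<^sup>2)"
    by (simp add: ennreal_plus ennreal_mult)
  finally show ?thesis .
qed

context filtered_brownian_motion
begin

text \<open>The factor \<open>\<theta>\<^sup>2\<close> instead of the sharp \<open>\<theta>\<^sup>2 / 2\<close> leaves room for the crude bound
  \<open>D\<^sup>2 \<le> 2 H\<^sup>2 + 2 (D - H)\<^sup>2\<close> on the approximating simple processes.\<close>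

lemma nn_integral_exp_ito_increment:
  assumes ito: "is_ito_integral M F B H I" and st: "0 \<le> s" "s \<le> t"
  defines "R \<equiv> \<lambda>\<omega>. \<integral>\<^sup>+r\<in>{s..t}. ennreal ((H r \<omega>)\<^sup>2) \<partial>lborel"
  shows "(\<lambda>\<omega>. ennreal (exp (\<theta> * (I t \<omega> - I s \<omega>) - \<theta>\<^sup>2 * enn2real (R \<omega>)))) \<in> borel_measurable M"
    and "(\<integral>\<^sup>+\<omega>. ennreal (exp (\<theta> * (I t \<omega> - I s \<omega>) - \<theta>\<^sup>2 * enn2real (R \<omega>))) \<partial>M) \<le> 1"
proof -
  let ?P = "restrict_space borel {0::real..} \<Otimes>\<^sub>M M"
  have t: "0 \<le> t" using st by simp
  have H[measurable]: "(\<lambda>(s, \<omega>). H s \<omega>) \<in> borel_measurable ?P"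
    using ito by (simp add: is_ito_integral_def ito_integrand_def)
  have I[measurable]: "I s \<in> borel_measurable M" "I t \<in> borel_measurable M"
    using ito st t by (auto simp: is_ito_integral_def)
  have Bm: "B u \<in> borel_measurable M" if "0 \<le> u" for u
    using measurable_F_M[OF adapted[OF that]] .
  have R[measurable]: "R \<in> borel_measurable M"
    unfolding R_def using borel_measurable_set_nn_integral[of "\<lambda>(r, \<omega>). ennreal ((H r \<omega>)\<^sup>2)" M s t] st by simp
  show "(\<lambda>\<omega>. ennreal (exp (\<theta> * (I t \<omega> - I s \<omega>) - \<theta>\<^sup>2 * enn2real (R \<omega>)))) \<in> borel_measurable M"
    by measurable
  obtain n \<tau> \<xi> where sp: "\<And>k. simple_process M F (n k) (\<tau> k) (\<xi> k)"
    and f0: "(\<lambda>k. \<integral>\<^sup>+\<omega>. (\<integral>\<^sup>+r\<in>{0..s}. ennreal ((simple_value (n k) (\<tau> k) (\<xi> k) r \<omega> - H r \<omega>)\<^sup>2) \<partial>lborel) \<partial>M) \<longlonglongrightarrow> 0"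
    and a0: "(\<lambda>k. \<integral>\<^sup>+\<omega>. ennreal ((simple_integral B (n k) (\<tau> k) (\<xi> k) s \<omega> - I s \<omega>)\<^sup>2) \<partial>M) \<longlonglongrightarrow> 0"
    using ito st unfolding is_ito_integral_def by blast
  obtain n' \<tau>' \<xi>' where sp': "\<And>k. simple_process M F (n' k) (\<tau>' k) (\<xi>' k)"
    and f0': "(\<lambda>k. \<integral>\<^sup>+\<omega>. (\<integral>\<^sup>+r\<in>{0..t}. ennreal ((simple_value (n' k) (\<tau>' k) (\<xi>' k) r \<omega> - H r \<omega>)\<^sup>2) \<partial>lborel) \<partial>M) \<longlonglongrightarrow> 0"
    and a0': "(\<lambda>k. \<integral>\<^sup>+\<omega>. ennreal ((simple_integral B (n' k) (\<tau>' k) (\<xi>' k) t \<omega> - I t \<omega>)\<^sup>2) \<partial>M) \<longlonglongrightarrow> 0"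
    using ito t unfolding is_ito_integral_def by blast
  have sv: "(\<lambda>(r, \<omega>). simple_value n \<tau> \<xi> r \<omega>) \<in> borel_measurable ?P"
    if "simple_process M F n \<tau> \<xi>" for n \<tau> \<xi>
    unfolding simple_value_def split_beta'
  proof (rule borel_measurable_sum)
    fix j assume "j \<in> {..<n}"
    then have [measurable]: "\<xi> j \<in> borel_measurable M"
      using that measurable_F_M by (auto simp: simple_process_def)
    have [measurable]: "(\<lambda>r. indicator {\<tau> j<..\<tau> (Suc j)} r :: real) \<in> borel_measurable (restrict_space borel {0..})"
      by (intro measurable_restrict_space1) simp
    show "(\<lambda>x. \<xi> j (snd x) * indicator {\<tau> j<..\<tau> (Suc j)} (fst x)) \<in> borel_measurable ?P"
      by measurable
  qed
  have si: "simple_integral B n \<tau> \<xi> u \<in> borel_measurable M"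
    if "simple_process M F n \<tau> \<xi>" "0 \<le> u" for n \<tau> \<xi> u
    unfolding simple_integral_def
  proof (rule borel_measurable_sum)
    fix j assume j: "j \<in> {..<n}"
    then have [measurable]: "\<xi> j \<in> borel_measurable M"
      using that measurable_F_M by (auto simp: simple_process_def)
    have [measurable]: "B (min u (\<tau> j)) \<in> borel_measurable M" "B (min u (\<tau> (Suc j))) \<in> borel_measurable M"
      using simple_process_times_nonneg[OF that(1), of j] simple_process_times_nonneg[OF that(1), of "Suc j"] j that(2) by (auto intro!: Bm)
    show "(\<lambda>\<omega>. \<xi> j \<omega> * (B (min u (\<tau> (Suc j))) \<omega> - B (min u (\<tau> j)) \<omega>)) \<in> borel_measurable M"
      by measurable
  qed
  have int: "(\<lambda>\<omega>. \<integral>\<^sup>+r\<in>{0..u}. ennreal ((simple_value n \<tau> \<xi> r \<omega> - H r \<omega>)\<^sup>2) \<partial>lborel) \<in> borel_measurable M"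
    if "simple_process M F n \<tau> \<xi>" for n \<tau> \<xi> u
  proof -
    note [measurable] = sv[OF that]
    have "(\<lambda>(r, \<omega>). ennreal ((simple_value n \<tau> \<xi> r \<omega> - H r \<omega>)\<^sup>2)) \<in> borel_measurable ?P"
      by measurable
    from borel_measurable_set_nn_integral[OF this, of 0 u] show ?thesis by simp
  qed
  define f f' a a' where "f k \<omega> = (\<integral>\<^sup>+r\<in>{0..s}. ennreal ((simple_value (n k) (\<tau> k) (\<xi> k) r \<omega> - H r \<omega>)\<^sup>2) \<partial>lborel)"
    and "f' k \<omega> = (\<integral>\<^sup>+r\<in>{0..t}. ennreal ((simple_value (n' k) (\<tau>' k) (\<xi>' k) r \<omega> - H r \<omega>)\<^sup>2) \<partial>lborel)"
    and "a k \<omega> = ennreal ((simple_integral B (n k) (\<tau> k) (\<xi> k) s \<omega> - I s \<omega>)\<^sup>2)"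
    and "a' k \<omega> = ennreal ((simple_integral B (n' k) (\<tau>' k) (\<xi>' k) t \<omega> - I t \<omega>)\<^sup>2)" for k \<omega>
  have [measurable]: "f k \<in> borel_measurable M" "f' k \<in> borel_measurable M" for k
    unfolding f_def f'_def using int[OF sp] int[OF sp'] by auto
  have [measurable]: "simple_integral B (n k) (\<tau> k) (\<xi> k) s \<in> borel_measurable M"
    "simple_integral B (n' k) (\<tau>' k) (\<xi>' k) t \<in> borel_measurable M" for k
    using si[OF sp st(1)] si[OF sp' t] by auto
  have [measurable]: "a k \<in> borel_measurable M" "a' k \<in> borel_measurable M" for k
    unfolding a_def a'_def by measurable
  \<comment> \<open>All four errors are added up so that a single subsequence makes them vanish
    together.\<close>
  define e where "e k \<omega> = f k \<omega> + f' k \<omega> + a k \<omega> + a' k \<omega>" for k \<omega>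
  have e[measurable]: "e k \<in> borel_measurable M" for k unfolding e_def by measurable
  have "(\<lambda>k. \<integral>\<^sup>+\<omega>. e k \<omega> \<partial>M) = (\<lambda>k. (\<integral>\<^sup>+\<omega>. f k \<omega> \<partial>M) + (\<integral>\<^sup>+\<omega>. f' k \<omega> \<partial>M) + (\<integral>\<^sup>+\<omega>. a k \<omega> \<partial>M) + (\<integral>\<^sup>+\<omega>. a' k \<omega> \<partial>M))"
    unfolding e_def by (simp add: nn_integral_add)
  also have "\<dots> \<longlonglongrightarrow> 0 + 0 + 0 + 0"
    unfolding f_def f'_def a_def a'_def by (intro tendsto_add f0 f0' a0 a0')
  finally obtain \<rho> where \<rho>: "AE \<omega> in M. (\<lambda>k. e (\<rho> k) \<omega>) \<longlonglongrightarrow> 0"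
    using AE_subseq_tendsto_0[of e M, OF e] by auto
  have Rfin: "AE \<omega> in M. R \<omega> \<noteq> \<infinity>"
  proof (rule nn_integral_PInf_AE[OF R])
    have "(\<integral>\<^sup>+\<omega>. R \<omega> \<partial>M) \<le> (\<integral>\<^sup>+\<omega>. (\<integral>\<^sup>+r\<in>{0..t}. ennreal ((H r \<omega>)\<^sup>2) \<partial>lborel) \<partial>M)"
      unfolding R_def using st by (intro nn_integral_mono) (auto simp: indicator_def)
    also have "\<dots> < \<infinity>" using ito t by (simp add: is_ito_integral_def ito_integrand_def)
    finally show "(\<integral>\<^sup>+\<omega>. R \<omega> \<partial>M) \<noteq> \<infinity>" by simp
  qed
  define J where "J k \<omega> = simple_integral B (n' k) (\<tau>' k) (\<xi>' k) t \<omega> - simple_integral B (n k) (\<tau> k) (\<xi> k) s \<omega>" for k \<omega>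
  have [measurable]: "J k \<in> borel_measurable M" for k unfolding J_def by measurable
  \<comment> \<open>The compensator \<open>R + 2 e\<close> dominates half of the squared integral of
    the approximating integrand, and it tends to \<open>R\<close> along the subsequence.\<close>
  define g where "g k \<omega> = (if e k \<omega> = \<infinity> then 0 else ennreal (exp (\<theta> * J k \<omega> - \<theta>\<^sup>2 * (enn2real (R \<omega>) + 2 * enn2real (e k \<omega>)))))" for k \<omega>
  have g[measurable]: "g k \<in> borel_measurable M" for k unfolding g_def by measurable
  have g1: "(\<integral>\<^sup>+\<omega>. g k \<omega> \<partial>M) \<le> 1" for k
  proof -
    define D where "D r \<omega> = stopped_value t (n' k) (\<tau>' k) (\<xi>' k) r \<omega> - stopped_value s (n k) (\<tau> k) (\<xi> k) r \<omega>" for r \<omega>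
    define Q where "Q \<omega> = (\<integral>\<^sup>+r\<in>{0..t}. ennreal ((D r \<omega>)\<^sup>2) \<partial>lborel)" for \<omega>
    \<comment> \<open>Up to time s the two approximations are subtracted and H cancels, leaving only
      errors; after s only the second one survives and is compared with H itself.\<close>
    have Q: "Q \<omega> \<le> 2 * R \<omega> + 4 * e k \<omega>" if \<omega>: "\<omega> \<in> space M" for \<omega>
    proof -
      let ?s = "\<lambda>r. simple_value (n k) (\<tau> k) (\<xi> k) r \<omega>" and ?s' = "\<lambda>r. simple_value (n' k) (\<tau>' k) (\<xi>' k) r \<omega>"
      have "ennreal ((D r \<omega>)\<^sup>2) * indicator {0..t} r \<le> 2 * (ennreal ((H r \<omega>)\<^sup>2) * indicator {s..t} r)
        + 4 * (ennreal ((?s r - H r \<omega>)\<^sup>2) * indicator {0..s} r) + 4 * (ennreal ((?s' r - H r \<omega>)\<^sup>2) * indicator {0..t} r)" for r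
      proof (cases "r \<in> {0..t}")
        case r: True
        show ?thesis
        proof (cases "r \<le> s")
          case True
          then have "ennreal ((D r \<omega>)\<^sup>2) = ennreal ((?s' r - ?s r)\<^sup>2)" using r by (simp add: D_def stopped_value_eq)
          also have "\<dots> \<le> 2 * ennreal ((?s' r - H r \<omega>)\<^sup>2) + 2 * ennreal ((H r \<omega> - ?s r)\<^sup>2)"
            by (rule ennreal_power2_add_le)
          also have "\<dots> \<le> 4 * ennreal ((?s' r - H r \<omega>)\<^sup>2) + 4 * ennreal ((?s r - H r \<omega>)\<^sup>2)"
            by (intro add_mono mult_mono) (auto simp: power2_commute)
          also have "\<dots> \<le> 2 * (ennreal ((H r \<omega>)\<^sup>2) * indicator {s..t} r) +
            (4 * ennreal ((?s' r - H r \<omega>)\<^sup>2) + 4 * ennreal ((?s r - H r \<omega>)\<^sup>2))"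
            by (simp add: add_increasing)
          finally show ?thesis
            using True r by (simp add: ac_simps)
        next
          case False
          then have "ennreal ((D r \<omega>)\<^sup>2) = ennreal ((?s' r - 0)\<^sup>2)" using r by (simp add: D_def stopped_value_eq)
          also have "\<dots> \<le> 2 * ennreal ((?s' r - H r \<omega>)\<^sup>2) + 2 * ennreal ((H r \<omega> - 0)\<^sup>2)"
            by (rule ennreal_power2_add_le)
          also have "\<dots> \<le> 4 * ennreal ((?s' r - H r \<omega>)\<^sup>2) + 2 * ennreal ((H r \<omega>)\<^sup>2)"
            by (intro add_mono mult_mono) auto
          finally show ?thesis
            using False r by (simp add: add.commute)
        qed
      qed simp
      then have "Q \<omega> \<le> (\<integral>\<^sup>+r. 2 * (ennreal ((H r \<omega>)\<^sup>2) * indicator {s..t} r)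
        + 4 * (ennreal ((?s r - H r \<omega>)\<^sup>2) * indicator {0..s} r) + 4 * (ennreal ((?s' r - H r \<omega>)\<^sup>2) * indicator {0..t} r) \<partial>lborel)"
        unfolding Q_def by (intro nn_integral_mono)
      also have "\<dots> = 2 * R \<omega> + 4 * f k \<omega> + 4 * f' k \<omega>"
      proof -
        have sec: "(\<lambda>r. h r \<omega> * indicator A r) \<in> borel_measurable lborel"
          if h: "(\<lambda>(r, \<omega>). h r \<omega>) \<in> borel_measurable ?P" and A: "A \<in> sets borel" "A \<subseteq> {0..}" for h :: "real \<Rightarrow> 'a \<Rightarrow> ennreal" and A
        proof -
          have "(\<lambda>r. h r \<omega>) \<in> borel_measurable (restrict_space borel {0..})"
            using measurable_compose[OF measurable_Pair2'[OF \<omega>] h] by simp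
          then have "(\<lambda>r. h r \<omega> * indicator {0..} r) \<in> borel_measurable borel"
            by (simp add: borel_measurable_restrict_space_iff_ennreal)
          then have "(\<lambda>r. h r \<omega> * indicator {0..} r * indicator A r) \<in> borel_measurable borel"
            using A by measurable
          also have "(\<lambda>r. h r \<omega> * indicator {0..} r * indicator A r) = (\<lambda>r. h r \<omega> * indicator A r)"
            using A by (auto simp: indicator_def fun_eq_iff)
          finally show ?thesis by simp
        qed
        note [measurable] = sv[OF sp[of k]] sv[OF sp'[of k]]
        have [measurable]: "(\<lambda>r. ennreal ((H r \<omega>)\<^sup>2) * indicator {s..t} r) \<in> borel_measurable lborel"
          "(\<lambda>r. ennreal ((?s r - H r \<omega>)\<^sup>2) * indicator {0..s} r) \<in> borel_measurable lborel"
          "(\<lambda>r. ennreal ((?s' r - H r \<omega>)\<^sup>2) * indicator {0..t} r) \<in> borel_measurable lborel"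
        proof -
          have *: "(\<lambda>(r, \<omega>). ennreal ((H r \<omega>)\<^sup>2)) \<in> borel_measurable ?P"
            "(\<lambda>(r, \<omega>). ennreal ((simple_value (n k) (\<tau> k) (\<xi> k) r \<omega> - H r \<omega>)\<^sup>2)) \<in> borel_measurable ?P"
            "(\<lambda>(r, \<omega>). ennreal ((simple_value (n' k) (\<tau>' k) (\<xi>' k) r \<omega> - H r \<omega>)\<^sup>2)) \<in> borel_measurable ?P"
            by measurable
          show "(\<lambda>r. ennreal ((H r \<omega>)\<^sup>2) * indicator {s..t} r) \<in> borel_measurable lborel"
            by (rule sec[OF *(1)]) (use st in auto)
          show "(\<lambda>r. ennreal ((?s r - H r \<omega>)\<^sup>2) * indicator {0..s} r) \<in> borel_measurable lborel"
            by (rule sec[OF *(2)]) (use st in auto)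
          show "(\<lambda>r. ennreal ((?s' r - H r \<omega>)\<^sup>2) * indicator {0..t} r) \<in> borel_measurable lborel"
            by (rule sec[OF *(3)]) (use st in auto)
        qed
        show ?thesis
          by (simp add: nn_integral_add nn_integral_cmult R_def f_def f'_def)
      qed
      also have "\<dots> \<le> 2 * R \<omega> + 4 * e k \<omega>"
      proof -
        have "f k \<omega> + f' k \<omega> \<le> e k \<omega>" unfolding e_def by (metis add.assoc add_increasing2 order_refl zero_le)
        then have "4 * (f k \<omega> + f' k \<omega>) \<le> 4 * e k \<omega>" by (rule mult_left_mono) simp
        then show ?thesis by (simp add: distrib_left add.assoc add_left_mono)
      qed
      finally show ?thesis .
    qed
    have "(\<integral>\<^sup>+\<omega>. g k \<omega> \<partial>M) \<le> (\<integral>\<^sup>+\<omega>. (if Q \<omega> = \<infinity> then 0 else ennreal (exp (\<theta> * J k \<omega> - \<theta>\<^sup>2 / 2 * enn2real (Q \<omega>)))) \<partial>M)"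
    proof (rule nn_integral_mono_AE, use Rfin AE_space in eventually_elim)
      fix \<omega> assume R: "R \<omega> \<noteq> \<infinity>" and \<omega>: "\<omega> \<in> space M"
      show "g k \<omega> \<le> (if Q \<omega> = \<infinity> then 0 else ennreal (exp (\<theta> * J k \<omega> - \<theta>\<^sup>2 / 2 * enn2real (Q \<omega>))))"
      proof (cases "e k \<omega> = \<infinity>")
        case False
        define x y where "x = enn2real (R \<omega>)" and "y = enn2real (e k \<omega>)"
        have xy: "R \<omega> = ennreal x" "e k \<omega> = ennreal y" "0 \<le> x" "0 \<le> y"
          using R False by (auto simp: x_def y_def top.not_eq_extremum)
        have "Q \<omega> \<le> 2 * ennreal x + 4 * ennreal y" using Q[OF \<omega>] by (simp add: xy)
        also have "\<dots> = ennreal (2 * x + 4 * y)" using xy(3,4) by (simp add: ennreal_plus ennreal_mult)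
        finally have Qle: "Q \<omega> \<le> ennreal (2 * x + 4 * y)" .
        have "enn2real (Q \<omega>) \<le> enn2real (ennreal (2 * x + 4 * y))"
          by (rule enn2real_mono[OF Qle]) (rule ennreal_less_top)
        also have "\<dots> = 2 * x + 4 * y" using xy(3,4) by (intro enn2real_ennreal) simp
        finally have "enn2real (Q \<omega>) \<le> 2 * x + 4 * y" .
        then have "\<theta>\<^sup>2 / 2 * enn2real (Q \<omega>) \<le> \<theta>\<^sup>2 / 2 * (2 * x + 4 * y)" by (intro mult_left_mono) auto
        moreover have "Q \<omega> \<noteq> \<infinity>" using Qle by (auto simp: top_unique)
        ultimately show ?thesis
          using False by (simp add: g_def x_def[symmetric] y_def[symmetric] algebra_simps)
      qed (simp add: g_def)
    qed
    also have "\<dots> \<le> 1"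
      unfolding Q_def D_def J_def by (rule nn_integral_exp_simple[OF sp sp' st])
    finally show ?thesis .
  qed
  \<comment> \<open>Along the subsequence the exponentials \<open>g\<close> converge pointwise to
    the desired one, so Fatou's lemma transfers the bound 1 to the limit.\<close>
  have "AE \<omega> in M. ennreal (exp (\<theta> * (I t \<omega> - I s \<omega>) - \<theta>\<^sup>2 * enn2real (R \<omega>))) \<le> liminf (\<lambda>k. g (\<rho> k) \<omega>)"
    using \<rho>
  proof eventually_elim
    case (elim \<omega>)
    have part: "(\<lambda>k. h (\<rho> k) \<omega>) \<longlonglongrightarrow> 0" if "\<And>k. h k \<omega> \<le> e k \<omega>" for h :: "nat \<Rightarrow> 'a \<Rightarrow> ennreal"
      by (rule tendsto_sandwich[OF _ _ tendsto_const elim]) (use that in auto)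
    have sq: "(\<lambda>k. u k) \<longlonglongrightarrow> l" if "(\<lambda>k. ennreal ((u k - l)\<^sup>2)) \<longlonglongrightarrow> 0" for u :: "nat \<Rightarrow> real" and l
    proof -
      have "(\<lambda>k. (u k - l)\<^sup>2) \<longlonglongrightarrow> 0" using that by (simp add: tendsto_ennreal_iff flip: ennreal_0)
      then have "(\<lambda>k. sqrt ((u k - l)\<^sup>2)) \<longlonglongrightarrow> sqrt 0" by (rule tendsto_real_sqrt)
      then have "(\<lambda>k. \<bar>u k - l\<bar>) \<longlonglongrightarrow> 0" by simp
      then show ?thesis by (simp add: LIM_zero_iff tendsto_rabs_zero_iff)
    qed
    have "(\<lambda>k. a (\<rho> k) \<omega>) \<longlonglongrightarrow> 0" "(\<lambda>k. a' (\<rho> k) \<omega>) \<longlonglongrightarrow> 0"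
      by (rule part, simp add: e_def add_increasing add_increasing2)+
    then have J: "(\<lambda>k. J (\<rho> k) \<omega>) \<longlonglongrightarrow> I t \<omega> - I s \<omega>"
      unfolding J_def a_def a'_def by (intro tendsto_diff sq)
    have er: "(\<lambda>k. enn2real (e (\<rho> k) \<omega>)) \<longlonglongrightarrow> 0"
      using tendsto_enn2real[of _ 0, OF elim[folded ennreal_0]] by simp
    have ev: "\<forall>\<^sub>F k in sequentially. e (\<rho> k) \<omega> \<noteq> \<infinity>"
      using order_tendstoD(2)[OF elim, of \<infinity>] by (auto elim!: eventually_mono)
    have "(\<lambda>k. exp (\<theta> * J (\<rho> k) \<omega> - \<theta>\<^sup>2 * (enn2real (R \<omega>) + 2 * enn2real (e (\<rho> k) \<omega>))))
      \<longlonglongrightarrow> exp (\<theta> * (I t \<omega> - I s \<omega>) - \<theta>\<^sup>2 * (enn2real (R \<omega>) + 2 * 0))"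
      by (intro tendsto_intros J er)
    then have "(\<lambda>k. ennreal (exp (\<theta> * J (\<rho> k) \<omega> - \<theta>\<^sup>2 * (enn2real (R \<omega>) + 2 * enn2real (e (\<rho> k) \<omega>)))))
      \<longlonglongrightarrow> ennreal (exp (\<theta> * (I t \<omega> - I s \<omega>) - \<theta>\<^sup>2 * enn2real (R \<omega>)))"
      by (intro tendsto_ennrealI) simp
    then have "(\<lambda>k. g (\<rho> k) \<omega>) \<longlonglongrightarrow> ennreal (exp (\<theta> * (I t \<omega> - I s \<omega>) - \<theta>\<^sup>2 * enn2real (R \<omega>)))"
      by (rule Lim_transform_eventually) (use ev in \<open>auto simp: g_def elim: eventually_mono\<close>)
    then show ?case by (simp add: lim_imp_Liminf)
  qed
  then have "(\<integral>\<^sup>+\<omega>. ennreal (exp (\<theta> * (I t \<omega> - I s \<omega>) - \<theta>\<^sup>2 * enn2real (R \<omega>))) \<partial>M) \<le> (\<integral>\<^sup>+\<omega>. liminf (\<lambda>k. g (\<rho> k) \<omega>) \<partial>M)"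
    by (rule nn_integral_mono_AE)
  also have "\<dots> \<le> liminf (\<lambda>k. \<integral>\<^sup>+\<omega>. g (\<rho> k) \<omega> \<partial>M)"
    by (rule nn_integral_liminf) simp
  also have "\<dots> \<le> liminf (\<lambda>k. 1)"
    by (intro Liminf_mono always_eventually allI g1)
  finally show "(\<integral>\<^sup>+\<omega>. ennreal (exp (\<theta> * (I t \<omega> - I s \<omega>) - \<theta>\<^sup>2 * enn2real (R \<omega>))) \<partial>M) \<le> 1"
    by (simp add: Liminf_const)
qed

end

section \<open>Almost sure bounds from exponential moments\<close>

text \<open>A dyadic point of level j is of level j - 1 or the right neighbour of such a point, so
  it is reached from \<open>a\<close> by at most one step of each level. Continuity extends the
  bound from dyadic points to all of the interval.\<close>

lemma dyadic_chaining:
  fixes f :: "real \<Rightarrow> real"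
  assumes cont: "continuous_on {a..a + 1} f" and b: "\<And>j. 0 \<le> b j" "summable b"
    and inc: "\<And>j k :: nat. k < 2 ^ j \<Longrightarrow> \<bar>f (a + real (Suc k) / 2 ^ j) - f (a + real k / 2 ^ j)\<bar> \<le> b j"
    and t: "t \<in> {a..a + 1}"
  shows "\<bar>f t - f a\<bar> \<le> suminf b"
proof -
  have grid: "\<bar>f (a + real k / 2 ^ j) - f a\<bar> \<le> (\<Sum>l\<le>j. b l)" if "k \<le> 2 ^ j" for j k :: nat
    using that
  proof (induction j arbitrary: k)
    case 0
    then have "k = 0 \<or> k = 1" by auto
    then show ?case using inc[of 0 0] b by auto
  next
    case (Suc j)
    show ?case
    proof (cases "even k")
      case True
      then obtain i where i: "k = 2 * i" by auto
      then have "\<bar>f (a + real i / 2 ^ j) - f a\<bar> \<le> (\<Sum>l\<le>j. b l)" using Suc by simp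
      moreover have "real k / 2 ^ Suc j = real i / 2 ^ j" using i by simp
      ultimately show ?thesis using b(1)[of "Suc j"] by simp
    next
      case False
      then obtain i where i: "k = Suc (2 * i)" by (auto elim: oddE)
      then have ih: "\<bar>f (a + real i / 2 ^ j) - f a\<bar> \<le> (\<Sum>l\<le>j. b l)" using Suc by simp
      have "2 * i < 2 ^ Suc j" using i Suc.prems by simp
      from inc[OF this] have "\<bar>f (a + real k / 2 ^ Suc j) - f (a + real (2 * i) / 2 ^ Suc j)\<bar> \<le> b (Suc j)"
        by (simp only: i)
      moreover have "real (2 * i) / 2 ^ Suc j = real i / 2 ^ j" by simp
      ultimately show ?thesis using ih by simp
    qed
  qed
  define x where "x = t - a"
  have x: "0 \<le> x" "x \<le> 1" using t by (auto simp: x_def)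
  define k where "k j = nat \<lfloor>x * 2 ^ j\<rfloor>" for j :: nat
  have k1: "real (k j) \<le> x * 2 ^ j" "x * 2 ^ j < real (k j) + 1" for j
    using x by (auto simp: k_def)
  have k2: "k j \<le> 2 ^ j" for j
  proof -
    have "real (k j) \<le> 1 * 2 ^ j" using k1(1)[of j] x by (meson mult_right_mono order_trans zero_le_numeral zero_le_power)
    then show ?thesis by simp
  qed
  have lim: "(\<lambda>j. a + real (k j) / 2 ^ j) \<longlonglongrightarrow> t"
  proof -
    have "(\<lambda>j. x - (1/2) ^ j) \<longlonglongrightarrow> x - 0"
      by (intro tendsto_intros LIMSEQ_power_zero) auto
    moreover have "x - (1/2)^j \<le> real (k j) / 2 ^ j" "real (k j) / 2 ^ j \<le> x" for j
    proof -
      have "x - (1/2)^j = (x * 2 ^ j - 1) / 2 ^ j" by (simp add: diff_divide_distrib power_one_over)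
      then show "x - (1/2)^j \<le> real (k j) / 2 ^ j" using k1(2)[of j] by (simp add: divide_right_mono)
      show "real (k j) / 2 ^ j \<le> x" using k1(1)[of j] by (subst pos_divide_le_eq) auto
    qed
    ultimately have "(\<lambda>j. real (k j) / 2 ^ j) \<longlonglongrightarrow> x"
      by - (rule tendsto_sandwich[where f = "\<lambda>j. x - (1/2)^j" and h = "\<lambda>_. x" and g = "\<lambda>j. real (k j) / 2 ^ j", rotated 2], simp_all)
    then have "(\<lambda>j. a + real (k j) / 2 ^ j) \<longlonglongrightarrow> a + x" by (intro tendsto_intros)
    then show ?thesis by (simp add: x_def)
  qed
  have inI: "a + real (k j) / 2 ^ j \<in> {a..a + 1}" for j
  proof -
    have "real (k j) \<le> 2 ^ j" using k2[of j] by (metis of_nat_le_iff of_nat_numeral of_nat_power)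
    then show ?thesis by (simp add: field_simps)
  qed
  have "(\<lambda>j. f (a + real (k j) / 2 ^ j)) \<longlonglongrightarrow> f t"
    by (rule continuous_on_tendsto_compose[OF cont lim t]) (use inI in auto)
  then have "(\<lambda>j. \<bar>f (a + real (k j) / 2 ^ j) - f a\<bar>) \<longlonglongrightarrow> \<bar>f t - f a\<bar>"
    by (intro tendsto_intros)
  moreover have "\<bar>f (a + real (k j) / 2 ^ j) - f a\<bar> \<le> suminf b" for j
    using grid[OF k2[of j]] sum_le_suminf[OF b(2), of "{..j}"] b(1) by simp
  ultimately show ?thesis by (intro LIMSEQ_le_const2) auto
qed

lemma nn_integral_count_space_prod:
  fixes f :: "'i \<Rightarrow> ennreal" and g :: "'j \<Rightarrow> ennreal"
  shows "(\<integral>\<^sup>+z. f (fst z) * g (snd z) \<partial>count_space UNIV)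
    = (\<integral>\<^sup>+i. f i \<partial>count_space UNIV) * (\<integral>\<^sup>+j. g j \<partial>count_space UNIV)"
proof -
  have "(\<integral>\<^sup>+z. f (fst z) * g (snd z) \<partial>count_space UNIV)
    = (\<integral>\<^sup>+i. (\<integral>\<^sup>+j. f i * g j \<partial>count_space UNIV) \<partial>count_space UNIV)"
    using nn_integral_fst_count_space[of "\<lambda>z. f (fst z) * g (snd z)"] by simp
  then show ?thesis by (simp add: nn_integral_cmult nn_integral_multc)
qed

text \<open>This takes the place of Chebyshev and Borel-Cantelli: instead of bounds for all but
  finitely many indices it yields one random constant that serves every index.\<close>

lemma AE_exp_bounded:
  fixes x :: "'i::countable \<Rightarrow> 'a \<Rightarrow> real" and w B :: "'i \<Rightarrow> real"
  assumes x: "\<And>i. (\<lambda>\<omega>. ennreal (exp (x i \<omega>))) \<in> borel_measurable M"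
    and B: "\<And>i. (\<integral>\<^sup>+\<omega>. ennreal (exp (x i \<omega>)) \<partial>M) \<le> ennreal (B i)"
    and fin: "(\<integral>\<^sup>+i. ennreal (exp (- w i)) * ennreal (B i) \<partial>count_space UNIV) < \<infinity>"
  shows "AE \<omega> in M. \<exists>C\<ge>0. \<forall>i. x i \<omega> \<le> C + w i"
proof -
  note [measurable] = x
  define f where "f i \<omega> = ennreal (exp (- w i)) * ennreal (exp (x i \<omega>))" for i \<omega>
  have [measurable]: "f i \<in> borel_measurable M" for i unfolding f_def by measurable
  have "(\<integral>\<^sup>+\<omega>. (\<integral>\<^sup>+i. f i \<omega> \<partial>count_space UNIV) \<partial>M) = (\<integral>\<^sup>+i. (\<integral>\<^sup>+\<omega>. f i \<omega> \<partial>M) \<partial>count_space UNIV)"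
    by (rule nn_integral_count_space_nn_integral) auto
  also have "\<dots> \<le> (\<integral>\<^sup>+i. ennreal (exp (- w i)) * ennreal (B i) \<partial>count_space UNIV)"
    by (intro nn_integral_mono) (simp add: f_def nn_integral_cmult[OF x] mult_left_mono B)
  also note fin
  finally have "(\<integral>\<^sup>+\<omega>. (\<integral>\<^sup>+i. f i \<omega> \<partial>count_space UNIV) \<partial>M) \<noteq> \<infinity>" by simp
  moreover have "(\<lambda>\<omega>. \<integral>\<^sup>+i. f i \<omega> \<partial>count_space UNIV) \<in> borel_measurable M"
  proof -
    interpret I: sigma_finite_measure "count_space (UNIV :: 'i set)"
      by (rule sigma_finite_measure_count_space)
    have "(\<lambda>(i, \<omega>). f i \<omega>) \<in> borel_measurable (count_space UNIV \<Otimes>\<^sub>M M)"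
      by (rule measurable_pair_measure_countable1) auto
    then have "(\<lambda>(\<omega>, i). f i \<omega>) \<in> borel_measurable (M \<Otimes>\<^sub>M count_space UNIV)"
      by (subst measurable_pair_swap_iff) (simp add: case_prod_beta)
    then show ?thesis by (rule I.borel_measurable_nn_integral)
  qed
  ultimately have "AE \<omega> in M. (\<integral>\<^sup>+i. f i \<omega> \<partial>count_space UNIV) \<noteq> \<infinity>"
    by (intro nn_integral_PInf_AE)
  then show ?thesis
  proof eventually_elim
    case (elim \<omega>)
    define S where "S = enn2real (\<integral>\<^sup>+i. f i \<omega> \<partial>count_space UNIV)"
    have S: "(\<integral>\<^sup>+i. f i \<omega> \<partial>count_space UNIV) = ennreal S" "0 \<le> S"
      using elim by (auto simp: S_def top.not_eq_extremum)
    \<comment> \<open>The summand 1 makes the argument of the logarithm positive and the constant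
      nonnegative even when S is 0.\<close>
    have "x i \<omega> \<le> ln (S + 1) + w i" for i
    proof -
      have "f i \<omega> \<le> ennreal S" unfolding S(1)[symmetric] by (rule nn_integral_ge_point) simp
      then have "ennreal (exp (- w i) * exp (x i \<omega>)) \<le> ennreal S" by (simp add: f_def ennreal_mult)
      then have "exp (x i \<omega> - w i) \<le> S + 1" using S by (simp add: ennreal_le_iff flip: exp_add)
      then have "x i \<omega> - w i \<le> ln (S + 1)" using S by (simp add: ln_ge_iff)
      then show ?thesis by simp
    qed
    then show ?case using S by (intro exI[of _ "ln (S + 1)"]) auto
  qed
qed

lemma nn_integral_count_space_powr:
  assumes "1 < s"
  shows "(\<integral>\<^sup>+n. ennreal (exp (- (s * ln (real n + 1)))) \<partial>count_space UNIV) < \<infinity>"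
proof -
  have e: "exp (- (s * ln (real n + 1))) = real (Suc n) powr (- s)" for n
    by (simp add: powr_def add.commute)
  have "summable (\<lambda>n. real (Suc n) powr (- s))"
    using summable_real_powr_iff[of "- s"] summable_Suc_iff[of "\<lambda>n. real n powr (- s)"] assms by simp
  then show ?thesis
    unfolding e by (simp add: nn_integral_count_space_nat suminf_ennreal2 del: of_nat_Suc)
qed

text \<open>The value of \<open>\<Sum>j. (j + 1) * 2 powr (- j / 2)\<close>.\<close>

definition chain_const :: real where "chain_const = 1 / (1 - sqrt (1/2))\<^sup>2"

lemma chain_const_pos: "0 < chain_const"
proof -
  have "sqrt (1/2) < sqrt 1" by (rule real_sqrt_less_mono) simp
  then show ?thesis by (simp add: chain_const_def)
qed

text \<open>The bound holds for all scales \<open>\<sigma> m\<close> at once, so that \<open>m\<close> may later be chosen depending on \<open>n\<close> and the path.\<close>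

lemma AE_unit_interval_bound:
  fixes V :: "real \<Rightarrow> 'a \<Rightarrow> real" and A :: "real \<Rightarrow> real \<Rightarrow> 'a \<Rightarrow> real" and \<sigma> :: "nat \<Rightarrow> real"
  assumes meas: "\<And>\<theta> s t. 0 \<le> s \<Longrightarrow> s \<le> t \<Longrightarrow>
      (\<lambda>\<omega>. ennreal (exp (\<theta> * (V t \<omega> - V s \<omega>) - \<theta>\<^sup>2 * A s t \<omega>))) \<in> borel_measurable M"
    and le: "\<And>\<theta> s t. 0 \<le> s \<Longrightarrow> s \<le> t \<Longrightarrow>
      (\<integral>\<^sup>+\<omega>. ennreal (exp (\<theta> * (V t \<omega> - V s \<omega>) - \<theta>\<^sup>2 * A s t \<omega>)) \<partial>M) \<le> 1"
    and cont: "AE \<omega> in M. continuous_on {0..} (\<lambda>t. V t \<omega>)" and \<sigma>: "\<And>m. 0 < \<sigma> m"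
  shows "AE \<omega> in M. \<exists>C\<ge>0. \<forall>n m :: nat. \<forall>a\<ge>0.
    (\<forall>s t. real n \<le> s \<and> s \<le> t \<and> t \<le> real n + 1 \<longrightarrow> A s t \<omega> \<le> (t - s) * a) \<longrightarrow>
    (\<forall>t\<in>{real n..real n + 1}. \<bar>V t \<omega> - V (real n) \<omega>\<bar> \<le>
       chain_const * ((C + 2 * ln (real n + 1) + 2 * ln (real m + 1)) / \<sigma> m + \<sigma> m * a))"
proof -
  define s where "s n j k = real n + real k / 2 ^ j" for n j k :: nat
  define t where "t n j k = real n + real (Suc k) / 2 ^ j" for n j k :: nat
  have st: "0 \<le> s n j k" "s n j k \<le> t n j k" for n j k by (auto simp: s_def t_def divide_right_mono)
  define u where "u n = 2 * ln (real n + 1)" for n :: nat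
  \<comment> \<open>The indices are the unit interval n, the scale m, the dyadic level j and the
    position k. Each is charged a factor (index + 1)^(-2), so the total weight is a product of four
    convergent series.\<close>
  define w where "w = (\<lambda>(n, m, j, k). u n + (u m + (u j + u k)))"
  have fin: "(\<integral>\<^sup>+i. ennreal (exp (- w i)) * ennreal 1 \<partial>count_space UNIV) < \<infinity>"
  proof -
    define v where "v n = ennreal (exp (- u n))" for n
    have "ennreal (exp (- w i)) * ennreal 1 = v (fst i) * (v (fst (snd i)) * (v (fst (snd (snd i))) * v (snd (snd (snd i)))))" for i
      by (cases i) (simp add: w_def v_def flip: ennreal_mult exp_add)
    then have "(\<integral>\<^sup>+i. ennreal (exp (- w i)) * ennreal 1 \<partial>count_space UNIV)
       = (\<integral>\<^sup>+n. v n \<partial>count_space UNIV) * ((\<integral>\<^sup>+n. v n \<partial>count_space UNIV) * ((\<integral>\<^sup>+n. v n \<partial>count_space UNIV) * (\<integral>\<^sup>+n. v n \<partial>count_space UNIV)))"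
      using nn_integral_count_space_prod[of v "\<lambda>z. v (fst z) * (v (fst (snd z)) * v (snd (snd z)))"]
        nn_integral_count_space_prod[of v "\<lambda>z. v (fst z) * v (snd z)"] nn_integral_count_space_prod[of v v]
      by simp
    also have "\<dots> < \<infinity>"
      using nn_integral_count_space_powr[of 2] by (simp add: v_def u_def ennreal_mult_less_top)
    finally show ?thesis .
  qed
  \<comment> \<open>A dyadic interval of level j has length 2^(-j). The factor
    \<open>sqrt 2 ^ j\<close> in the parameter compensates for this, so that the compensator is at
    most \<open>(\<sigma> m)^2 * a\<close> on every level. The sign \<open>\<epsilon>\<close> yields
    both one-sided bounds.\<close>
  define x where "x \<epsilon> = (\<lambda>(n, m, j, k) \<omega>. (\<epsilon> * sqrt 2 ^ j * \<sigma> m) * (V (t n j k) \<omega> - V (s n j k) \<omega>)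
     - (\<epsilon> * sqrt 2 ^ j * \<sigma> m)\<^sup>2 * A (s n j k) (t n j k) \<omega>)" for \<epsilon> :: real
  have "AE \<omega> in M. \<exists>C\<ge>0. \<forall>i. x \<epsilon> i \<omega> \<le> C + w i" for \<epsilon>
  proof (rule AE_exp_bounded[OF _ _ fin])
    fix i show "(\<lambda>\<omega>. ennreal (exp (x \<epsilon> i \<omega>))) \<in> borel_measurable M"
      using meas[OF st] by (cases i) (simp add: x_def)
    show "(\<integral>\<^sup>+\<omega>. ennreal (exp (x \<epsilon> i \<omega>)) \<partial>M) \<le> ennreal 1"
      using le[OF st] by (cases i) (simp add: x_def)
  qed
  from this[of 1] this[of "-1"] cont show ?thesis
  proof eventually_elim
    case (elim \<omega>)
    from elim(1) obtain C1 where C1: "C1 \<ge> 0" "\<And>i. x 1 i \<omega> \<le> C1 + w i" by auto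
    from elim(2) obtain C2 where C2: "C2 \<ge> 0" "\<And>i. x (-1) i \<omega> \<le> C2 + w i" by auto
    define C where "C = max C1 C2"
    have C: "0 \<le> C" using C1(1) by (simp add: C_def)
    have X: "sqrt 2 ^ j * \<sigma> m * \<bar>V (t n j k) \<omega> - V (s n j k) \<omega>\<bar> - (sqrt 2 ^ j * \<sigma> m)\<^sup>2 * A (s n j k) (t n j k) \<omega>
      \<le> C + (u n + (u m + (u j + u k)))" for n m j k
      using C1(2)[of "(n, m, j, k)"] C2(2)[of "(n, m, j, k)"]
      by (cases "V (t n j k) \<omega> - V (s n j k) \<omega> \<ge> 0") (auto simp: x_def w_def C_def algebra_simps max_def)
    let ?r = "sqrt (1/2)"
    have r: "?r * sqrt 2 = 1" by (simp flip: real_sqrt_mult)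
    have rr: "?r ^ j * sqrt 2 ^ j = 1" for j by (simp flip: power_mult_distrib add: r)
    have "norm ?r < 1" using real_sqrt_less_mono[of "1/2" 1] by simp
    from geometric_deriv_sums[OF this]
    have sums: "(\<lambda>j. real (Suc j) * ?r ^ j) sums chain_const" by (simp add: chain_const_def)
    have "\<bar>V z \<omega> - V (real n) \<omega>\<bar> \<le> chain_const * ((C + 4 + 2 * ln (real n + 1) + 2 * ln (real m + 1)) / \<sigma> m + \<sigma> m * a)"
      if a: "0 \<le> a" "\<And>s t. real n \<le> s \<and> s \<le> t \<and> t \<le> real n + 1 \<Longrightarrow> A s t \<omega> \<le> (t - s) * a"
        and z: "z \<in> {real n..real n + 1}" for n m :: nat and a z
    proof -
      define G where "G = (C + 4 + u n + u m) / \<sigma> m + \<sigma> m * a"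
      have u0: "0 \<le> u n" for n by (simp add: u_def)
      have G: "0 \<le> G" unfolding G_def using \<sigma>[of m] a C u0 by (intro add_nonneg_nonneg divide_nonneg_pos mult_nonneg_nonneg) auto
      have step: "\<bar>V (t n j k) \<omega> - V (s n j k) \<omega>\<bar> \<le> real (Suc j) * ?r ^ j * G" if k: "k < 2 ^ j" for j k
      proof -
        \<comment> \<open>There are only 2^j positions on level j, so the charge for k is linear in
          j, as is that for j. Together they give \<open>4 * real j\<close>, the origin of the 4 in
          \<open>C + 4\<close> and of the factor \<open>Suc j\<close> that
          \<open>chain_const\<close> sums.\<close>
        have uk: "u k \<le> 2 * real j"
        proof -
          have "real k + 1 \<le> 2 ^ j" using k by (metis of_nat_Suc Suc_leI of_nat_le_iff of_nat_numeral of_nat_power add.commute)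
          then have "ln (real k + 1) \<le> ln (2 ^ j)" by (intro ln_mono) auto
          also have "\<dots> = real j * ln 2" by (simp add: ln_realpow)
          also have "\<dots> \<le> real j * 1" using ln_le_minus_one[of "2::real"] by (intro mult_left_mono) auto
          finally show ?thesis by (simp add: u_def)
        qed
        have uj: "u j \<le> 2 * real j" using ln_le_minus_one[of "real j + 1"] by (simp add: u_def)
        have len: "t n j k - s n j k = (?r ^ j)\<^sup>2"
          by (simp add: s_def t_def diff_divide_distrib[symmetric] power_mult[symmetric] mult.commute[of j] power_mult power_divide)
        have "t n j k \<le> real n + 1"
          using k by (simp add: t_def divide_le_eq) (metis Suc_leI of_nat_Suc of_nat_le_iff of_nat_numeral of_nat_power)
        then have "A (s n j k) (t n j k) \<omega> \<le> (?r ^ j)\<^sup>2 * a"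
          using a(2)[of "s n j k" "t n j k"] st(2)[of n j k] unfolding len by (simp add: s_def)
        then have "(sqrt 2 ^ j * \<sigma> m)\<^sup>2 * A (s n j k) (t n j k) \<omega> \<le> (sqrt 2 ^ j * \<sigma> m)\<^sup>2 * ((?r ^ j)\<^sup>2 * a)"
          by (intro mult_left_mono) auto
        also have "\<dots> = (?r ^ j * sqrt 2 ^ j)\<^sup>2 * ((\<sigma> m)\<^sup>2 * a)" by (simp add: power2_eq_square)
        also have "\<dots> = (\<sigma> m)\<^sup>2 * a" by (simp add: rr)
        finally have "sqrt 2 ^ j * \<sigma> m * \<bar>V (t n j k) \<omega> - V (s n j k) \<omega>\<bar> \<le> C + u n + u m + 4 * real j + (\<sigma> m)\<^sup>2 * a"
          using X[of j m n k] uk uj by simp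
        also have "\<dots> \<le> real (Suc j) * (C + 4 + u n + u m + (\<sigma> m)\<^sup>2 * a)"
        proof -
          have "0 \<le> real j * (C + u n + u m + (\<sigma> m)\<^sup>2 * a)" using C u0 a by (intro mult_nonneg_nonneg add_nonneg_nonneg) auto
          then show ?thesis by (simp add: algebra_simps)
        qed
        also have "\<dots> = real (Suc j) * \<sigma> m * G"
          using \<sigma>[of m] by (simp add: G_def field_simps power2_eq_square)
        finally have "(?r ^ j / \<sigma> m) * (sqrt 2 ^ j * \<sigma> m * \<bar>V (t n j k) \<omega> - V (s n j k) \<omega>\<bar>) \<le> (?r ^ j / \<sigma> m) * (real (Suc j) * \<sigma> m * G)"
          using \<sigma>[of m] by (intro mult_left_mono) auto
        moreover have "(?r ^ j / \<sigma> m) * (sqrt 2 ^ j * \<sigma> m * y) = (?r ^ j * sqrt 2 ^ j) * y" for y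
          using \<sigma>[of m] by simp
        moreover have "(?r ^ j / \<sigma> m) * (real (Suc j) * \<sigma> m * G) = real (Suc j) * ?r ^ j * G"
          using \<sigma>[of m] by simp
        ultimately show ?thesis by (simp add: rr)
      qed
      have "\<bar>V z \<omega> - V (real n) \<omega>\<bar> \<le> (\<Sum>j. real (Suc j) * ?r ^ j * G)"
      proof (rule dyadic_chaining[OF _ _ _ _ z])
        show "continuous_on {real n..real n + 1} (\<lambda>z. V z \<omega>)"
          by (rule continuous_on_subset[OF elim(3)]) auto
        show "summable (\<lambda>j. real (Suc j) * ?r ^ j * G)"
          using sums by (intro summable_mult2) (rule sums_summable)
      qed (use step G in \<open>auto simp: s_def t_def\<close>)
      also have "\<dots> = chain_const * G"
        using sums by (intro sums_unique[symmetric] sums_mult2)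
      finally show ?thesis by (simp add: G_def u_def)
    qed
    then show ?case using C by (intro exI[of _ "C + 4"]) auto
  qed
qed

section \<open>Almost sure fluctuations of Brownian motion\<close>

lemma brownian_motion_exp_increment:
  assumes bm: "brownian_motion M W" and st: "0 \<le> s" "s \<le> t"
  shows "(\<integral>\<^sup>+\<omega>. ennreal (exp (\<theta> * (W t \<omega> - W s \<omega>) - \<theta>\<^sup>2 * (t - s) / 2)) \<partial>M) = 1"
proof (cases "s = t")
  case True
  interpret prob_space M using bm by (simp add: brownian_motion_def)
  show ?thesis using True by (simp add: emeasure_space_1)
next
  case False
  then have d: "distributed M lborel (\<lambda>\<omega>. W t \<omega> - W s \<omega>) (normal_density 0 (sqrt (t - s)))"
    using bm st by (simp add: brownian_motion_def)
  have "(\<integral>\<^sup>+\<omega>. ennreal (exp (\<theta> * (W t \<omega> - W s \<omega>) - \<theta>\<^sup>2 * (t - s) / 2)) \<partial>M)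
    = (\<integral>\<^sup>+x. ennreal (normal_density 0 (sqrt (t - s)) x) * ennreal (exp (\<theta> * x - \<theta>\<^sup>2 * (t - s) / 2)) \<partial>lborel)"
    by (rule distributed_nn_integral[OF d, symmetric]) simp
  also have "\<dots> = 1" by (rule nn_integral_normal_exp) (use False st in simp)
  finally show ?thesis .
qed

lemma brownian_motion_measurable:
  "brownian_motion M W \<Longrightarrow> 0 \<le> t \<Longrightarrow> W t \<in> borel_measurable M"
  by (simp add: brownian_motion_def)

text \<open>The mean of \<open>exp (\<theta> |increment| - \<theta> b l)\<close> is at most of order
  \<open>exp (- c l)\<close>, where c = \<theta> (b - \<theta> / 2) is positive because
  \<open>\<theta> < 2 * b\<close>. The sum over l thus converges by itself, and only i needs a
  weight. The map \<open>g\<close> stands for \<open>i + l\<close> and for the truncated difference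
  \<open>i - l\<close>, so both time directions share one proof.\<close>

lemma AE_brownian_pair_bound_aux:
  fixes g :: "nat \<Rightarrow> nat \<Rightarrow> nat"
  assumes bm: "brownian_motion M W" and \<theta>: "0 < \<theta>" "\<theta> < 2 * b" "1 < s"
    and g: "\<And>i l. \<bar>real (g i l) - real i\<bar> \<le> real l"
  shows "AE \<omega> in M. \<exists>C\<ge>0. \<forall>i l. \<theta> * \<bar>W (real (g i l)) \<omega> - W (real i) \<omega>\<bar> \<le> \<theta> * b * real l + s * ln (real i + 1) + C"
proof -
  define c where "c = \<theta> * b - \<theta>\<^sup>2 / 2"
  have c: "0 < c"
  proof -
    have "c = \<theta> * (2 * b - \<theta>) / 2" by (simp add: c_def field_simps power2_eq_square)
    then show ?thesis using \<theta> by (simp only:) (intro divide_pos_pos mult_pos_pos, auto)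
  qed
  note [measurable] = brownian_motion_measurable[OF bm]
  define x where "x \<epsilon> = (\<lambda>(i, l) \<omega>. \<epsilon> * \<theta> * (W (real (g i l)) \<omega> - W (real i) \<omega>) - \<theta> * b * real l)" for \<epsilon> :: real
  define w where "w z = s * ln (real (fst z) + 1)" for z :: "nat \<times> nat"
  define B where "B z = exp (- c) ^ snd z" for z :: "nat \<times> nat"
  have sums: "(\<integral>\<^sup>+l. ennreal (exp (- c) ^ l) \<partial>count_space UNIV) < \<infinity>"
    using c by (simp add: nn_integral_count_space_nat suminf_ennreal2 summable_geometric)
  have fin: "(\<integral>\<^sup>+z. ennreal (exp (- w z)) * ennreal (B z) \<partial>count_space UNIV) < \<infinity>"
    unfolding w_def B_def
    using nn_integral_count_space_prod[of "\<lambda>i. ennreal (exp (- (s * ln (real i + 1))))" "\<lambda>l. ennreal (exp (- c) ^ l)"]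
      nn_integral_count_space_powr[OF \<theta>(3)] sums by (simp add: ennreal_mult_less_top)
  have "AE \<omega> in M. \<exists>C\<ge>0. \<forall>z. x \<epsilon> z \<omega> \<le> C + w z" if \<epsilon>: "\<epsilon>\<^sup>2 = 1" for \<epsilon>
  proof (rule AE_exp_bounded[OF _ _ fin])
    fix z :: "nat \<times> nat"
    obtain i l where z: "z = (i, l)" by (cases z)
    show "(\<lambda>\<omega>. ennreal (exp (x \<epsilon> z \<omega>))) \<in> borel_measurable M" unfolding x_def z by simp
    define d where "d = \<bar>real (g i l) - real i\<bar>"
    have ei: "(\<integral>\<^sup>+\<omega>. ennreal (exp (\<epsilon> * \<theta> * (W (real (g i l)) \<omega> - W (real i) \<omega>) - \<theta>\<^sup>2 * d / 2)) \<partial>M) = 1"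
    proof (cases "i \<le> g i l")
      case True
      then show ?thesis
        using brownian_motion_exp_increment[OF bm, of "real i" "real (g i l)" "\<epsilon> * \<theta>"] \<epsilon>
        by (simp add: d_def power_mult_distrib)
    next
      case False
      have "- (\<epsilon> * \<theta>) * (W (real i) \<omega> - W (real (g i l)) \<omega>) = \<epsilon> * \<theta> * (W (real (g i l)) \<omega> - W (real i) \<omega>)" for \<omega>
        by (simp add: algebra_simps)
      then show ?thesis
        using brownian_motion_exp_increment[OF bm, of "real (g i l)" "real i" "- (\<epsilon> * \<theta>)"] \<epsilon> False
        by (simp add: d_def power_mult_distrib)
    qed
    have "\<theta>\<^sup>2 * d / 2 - \<theta> * b * real l \<le> - c * real l"
      using mult_left_mono[OF g[of i l], of "\<theta>\<^sup>2 / 2"] by (simp add: c_def d_def algebra_simps)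
    then have "x \<epsilon> z \<omega> \<le> (\<epsilon> * \<theta> * (W (real (g i l)) \<omega> - W (real i) \<omega>) - \<theta>\<^sup>2 * d / 2) + - c * real l" for \<omega>
      by (simp add: x_def z)
    then have "(\<integral>\<^sup>+\<omega>. ennreal (exp (x \<epsilon> z \<omega>)) \<partial>M) \<le>
      (\<integral>\<^sup>+\<omega>. ennreal (exp (\<epsilon> * \<theta> * (W (real (g i l)) \<omega> - W (real i) \<omega>) - \<theta>\<^sup>2 * d / 2)) * ennreal (exp (- c * real l)) \<partial>M)"
      by (intro nn_integral_mono) (simp only: ennreal_mult[symmetric] exp_ge_zero exp_add[symmetric] ennreal_leI exp_le_cancel_iff)
    also have "\<dots> = ennreal (B z)"
    proof -
      have "B z = exp (- c * real l)" by (simp add: B_def z mult.commute flip: exp_of_nat_mult)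
      then show ?thesis by (subst nn_integral_multc) (simp_all add: ei)
    qed
    finally show "(\<integral>\<^sup>+\<omega>. ennreal (exp (x \<epsilon> z \<omega>)) \<partial>M) \<le> ennreal (B z)" .
  qed
  from this[of 1, simplified] this[of "-1", simplified] show ?thesis
  proof eventually_elim
    case (elim \<omega>)
    from elim(1) obtain C1 where C1: "C1 \<ge> 0" "\<And>z. x 1 z \<omega> \<le> C1 + w z" by auto
    from elim(2) obtain C2 where C2: "C2 \<ge> 0" "\<And>z. x (-1) z \<omega> \<le> C2 + w z" by auto
    have "\<theta> * \<bar>W (real (g i l)) \<omega> - W (real i) \<omega>\<bar> \<le> \<theta> * b * real l + s * ln (real i + 1) + max C1 C2" for i l
      using C1(2)[of "(i, l)"] C2(2)[of "(i, l)"]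
      by (cases "W (real (g i l)) \<omega> \<ge> W (real i) \<omega>") (auto simp: x_def w_def algebra_simps max_def)
    then show ?case using C1(1) by (intro exI[of _ "max C1 C2"]) auto
  qed
qed

text \<open>Only the base time i enters the logarithm, however far away k is and on whichever side.
  Dividing by \<open>\<theta>\<close> gives it the coefficient s / \<theta>, which can be any number
  above 1 / (2 b).\<close>

lemma AE_brownian_pair_bound:
  assumes bm: "brownian_motion M W" and \<theta>: "0 < \<theta>" "\<theta> < 2 * b" "1 < s"
  shows "AE \<omega> in M. \<exists>C\<ge>0. \<forall>i k :: nat. \<theta> * \<bar>W (real k) \<omega> - W (real i) \<omega>\<bar>
    \<le> \<theta> * b * \<bar>real k - real i\<bar> + s * ln (real i + 1) + C"
proof -
  have "AE \<omega> in M. \<exists>C\<ge>0. \<forall>i l. \<theta> * \<bar>W (real (i + l)) \<omega> - W (real i) \<omega>\<bar> \<le> \<theta> * b * real l + s * ln (real i + 1) + C"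
    by (rule AE_brownian_pair_bound_aux[OF bm \<theta>]) simp
  moreover have "AE \<omega> in M. \<exists>C\<ge>0. \<forall>i l. \<theta> * \<bar>W (real (i - l)) \<omega> - W (real i) \<omega>\<bar> \<le> \<theta> * b * real l + s * ln (real i + 1) + C"
    by (rule AE_brownian_pair_bound_aux[OF bm \<theta>]) linarith
  ultimately show ?thesis
  proof eventually_elim
    case (elim \<omega>)
    from elim(1) obtain C1 where C1: "C1 \<ge> 0" "\<And>i l. \<theta> * \<bar>W (real (i + l)) \<omega> - W (real i) \<omega>\<bar> \<le> \<theta> * b * real l + s * ln (real i + 1) + C1" by blast
    from elim(2) obtain C2 where C2: "C2 \<ge> 0" "\<And>i l. \<theta> * \<bar>W (real (i - l)) \<omega> - W (real i) \<omega>\<bar> \<le> \<theta> * b * real l + s * ln (real i + 1) + C2" by blast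
    have "\<theta> * \<bar>W (real k) \<omega> - W (real i) \<omega>\<bar> \<le> \<theta> * b * \<bar>real k - real i\<bar> + s * ln (real i + 1) + max C1 C2" for i k :: nat
    proof (cases "i \<le> k")
      case True then show ?thesis using C1(2)[of i "k - i"] by (simp add: of_nat_diff)
    next
      case False then show ?thesis using C2(2)[of i "i - k"] by (simp add: of_nat_diff)
    qed
    then show ?case using C1(1) by (intro exI[of _ "max C1 C2"]) auto
  qed
qed

text \<open>In the unit-interval bound with scale m + 1 and a = 1 the logarithm of n has coefficient
  \<open>2 * chain_const / (m + 1)\<close>. A large m brings this below \<open>\<delta>\<close>, at
  the price of a larger constant.\<close>

lemma AE_brownian_oscillation:
  assumes bm: "brownian_motion M W" and \<delta>: "0 < \<delta>"
  shows "AE \<omega> in M. \<exists>C\<ge>0. \<forall>n. \<forall>t\<in>{real n..real n + 1}. \<bar>W t \<omega> - W (real n) \<omega>\<bar> \<le> C + \<delta> * ln (real n + 1)"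
proof -
  note [measurable] = brownian_motion_measurable[OF bm]
  interpret prob_space M using bm by (simp add: brownian_motion_def)
  have "AE \<omega> in M. \<exists>C\<ge>0. \<forall>n m :: nat. \<forall>a\<ge>0.
    (\<forall>s t. real n \<le> s \<and> s \<le> t \<and> t \<le> real n + 1 \<longrightarrow> (\<lambda>s t \<omega>. t - s) s t \<omega> \<le> (t - s) * a) \<longrightarrow>
    (\<forall>t\<in>{real n..real n + 1}. \<bar>W t \<omega> - W (real n) \<omega>\<bar> \<le>
       chain_const * ((C + 2 * ln (real n + 1) + 2 * ln (real m + 1)) / (real m + 1) + (real m + 1) * a))"
  proof (rule AE_unit_interval_bound)
    fix \<theta> s t :: real assume st: "0 \<le> s" "s \<le> t"
    then show "(\<lambda>\<omega>. ennreal (exp (\<theta> * (W t \<omega> - W s \<omega>) - \<theta>\<^sup>2 * (t - s)))) \<in> borel_measurable M"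
      by simp
    have "(\<integral>\<^sup>+\<omega>. ennreal (exp (\<theta> * (W t \<omega> - W s \<omega>) - \<theta>\<^sup>2 * (t - s))) \<partial>M)
      \<le> (\<integral>\<^sup>+\<omega>. ennreal (exp (\<theta> * (W t \<omega> - W s \<omega>) - \<theta>\<^sup>2 * (t - s) / 2)) \<partial>M)"
    proof (intro nn_integral_mono ennreal_leI)
      fix \<omega>
      have "0 \<le> \<theta>\<^sup>2 * (t - s)" using st by simp
      then show "exp (\<theta> * (W t \<omega> - W s \<omega>) - \<theta>\<^sup>2 * (t - s)) \<le> exp (\<theta> * (W t \<omega> - W s \<omega>) - \<theta>\<^sup>2 * (t - s) / 2)"
        unfolding exp_le_cancel_iff by linarith
    qed
    then show "(\<integral>\<^sup>+\<omega>. ennreal (exp (\<theta> * (W t \<omega> - W s \<omega>) - \<theta>\<^sup>2 * (t - s))) \<partial>M) \<le> 1"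
      using brownian_motion_exp_increment[OF bm st] by simp
  next
    show "AE \<omega> in M. continuous_on {0..} (\<lambda>t. W t \<omega>)"
      using bm by (intro AE_I2) (simp add: brownian_motion_def)
  qed simp
  then show ?thesis
  proof eventually_elim
    case (elim \<omega>)
    then obtain C where C: "0 \<le> C" and *: "\<And>n m :: nat. \<And>a. 0 \<le> a \<Longrightarrow> (\<forall>s t. real n \<le> s \<and> s \<le> t \<and> t \<le> real n + 1 \<longrightarrow> t - s \<le> (t - s) * a) \<Longrightarrow>
    (\<forall>t\<in>{real n..real n + 1}. \<bar>W t \<omega> - W (real n) \<omega>\<bar> \<le>
       chain_const * ((C + 2 * ln (real n + 1) + 2 * ln (real m + 1)) / (real m + 1) + (real m + 1) * a))" by blast
    obtain m :: nat where m: "2 * chain_const / \<delta> < real m" using reals_Archimedean2 by blast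
    define D where "D = chain_const * ((C + 2 * ln (real m + 1)) / (real m + 1) + (real m + 1))"
    have "0 \<le> D" unfolding D_def using chain_const_pos C
      by (intro mult_nonneg_nonneg add_nonneg_nonneg divide_nonneg_nonneg) auto
    moreover have "\<bar>W t \<omega> - W (real n) \<omega>\<bar> \<le> D + \<delta> * ln (real n + 1)" if t: "t \<in> {real n..real n + 1}" for n t
    proof -
      have "\<bar>W t \<omega> - W (real n) \<omega>\<bar> \<le> chain_const * ((C + 2 * ln (real n + 1) + 2 * ln (real m + 1)) / (real m + 1) + (real m + 1) * 1)"
        using *[of 1 n m] t by simp
      also have "\<dots> = D + (2 * chain_const / (real m + 1)) * ln (real n + 1)"
        by (simp add: D_def add_divide_distrib algebra_simps)
      also have "\<dots> \<le> D + \<delta> * ln (real n + 1)"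
      proof -
        have "2 * chain_const / (real m + 1) \<le> \<delta>" using m \<delta> by (simp add: field_simps)
        then show ?thesis by (intro add_left_mono mult_right_mono) auto
      qed
      finally show ?thesis .
    qed
    ultimately show ?case by blast
  qed
qed

section \<open>Integrals of exponentials over unit intervals\<close>

text \<open>With z = c Z(n), the squared integrand is comparable to exp (2 z) on the unit interval,
  so a scale near exp (- z) balances both terms of the unit-interval bound at exp (z).
  \<open>osc\<close> controls the comparison up to a small power of n; \<open>growth\<close> keeps
  the logarithmic charge for the scale of order ln n.\<close>

lemma (in filtered_brownian_motion) AE_ito_exp_increment:
  assumes ito: "is_ito_integral M F B (\<lambda>s \<omega>. exp (c * Z s \<omega>)) I" and \<delta>: "0 < \<delta>"
    and osc: "\<And>\<epsilon>. 0 < \<epsilon> \<Longrightarrow> AE \<omega> in M. \<exists>C\<ge>0. \<forall>n. \<forall>t\<in>{real n..real n + 1}. \<bar>Z t \<omega> - Z (real n) \<omega>\<bar> \<le> C + \<epsilon> * ln (real n + 1)"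
    and growth: "AE \<omega> in M. \<exists>C\<ge>0. \<forall>n::nat. \<bar>Z (real n) \<omega>\<bar> \<le> C * (real n + 1)"
  shows "AE \<omega> in M. \<exists>C\<ge>0. \<forall>n. \<forall>t\<in>{real n..real n + 1}. \<bar>I t \<omega> - I (real n) \<omega>\<bar> \<le> C * (real n + 1) powr \<delta> * exp (c * Z (real n) \<omega>)"
proof -
  define A where "A s t \<omega> = enn2real (\<integral>\<^sup>+r\<in>{s..t}. ennreal ((exp (c * Z r \<omega>))\<^sup>2) \<partial>lborel)" for s t \<omega>
  have cont: "AE \<omega> in M. continuous_on {0..} (\<lambda>t. I t \<omega>)" using ito by (simp add: is_ito_integral_def)
  \<comment> \<open>Chosen so that the oscillation factor \<open>exp (2 |c| \<epsilon> ln N)\<close>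
    is at most \<open>N powr \<delta>\<close>; the 1 in the denominator covers c = 0.\<close>
  define \<epsilon> where "\<epsilon> = \<delta> / (2 * \<bar>c\<bar> + 1)"
  have \<epsilon>: "0 < \<epsilon>" "2 * \<bar>c\<bar> * \<epsilon> \<le> \<delta>" using \<delta> by (auto simp: \<epsilon>_def field_simps)
  have unit: "AE \<omega> in M. \<exists>C\<ge>0. \<forall>n m :: nat. \<forall>a\<ge>0.
    (\<forall>s t. real n \<le> s \<and> s \<le> t \<and> t \<le> real n + 1 \<longrightarrow> A s t \<omega> \<le> (t - s) * a) \<longrightarrow>
    (\<forall>t\<in>{real n..real n + 1}. \<bar>I t \<omega> - I (real n) \<omega>\<bar> \<le>
       chain_const * ((C + 2 * ln (real n + 1) + 2 * ln (real m + 1)) / exp (\<mu> * real m) + exp (\<mu> * real m) * a))" for \<mu>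
    unfolding A_def
    by (rule AE_unit_interval_bound) (use nn_integral_exp_ito_increment[OF ito] cont in auto)
  from osc[OF \<epsilon>(1)] growth unit[of 1] unit[of "-1"] show ?thesis
  proof eventually_elim
    case (elim \<omega>)
    from elim(1) obtain C1 where C1: "0 \<le> C1" "\<And>n t. t \<in> {real n..real n + 1} \<Longrightarrow> \<bar>Z t \<omega> - Z (real n) \<omega>\<bar> \<le> C1 + \<epsilon> * ln (real n + 1)" by blast
    from elim(2) obtain C2 where C2: "0 \<le> C2" "\<And>n::nat. \<bar>Z (real n) \<omega>\<bar> \<le> C2 * (real n + 1)" by blast
    from elim(3) obtain C3 where C3: "0 \<le> C3" "\<And>n m :: nat. \<And>a t. 0 \<le> a \<Longrightarrow> (\<And>s t. real n \<le> s \<Longrightarrow> s \<le> t \<Longrightarrow> t \<le> real n + 1 \<Longrightarrow> A s t \<omega> \<le> (t - s) * a) \<Longrightarrow> t \<in> {real n..real n + 1} \<Longrightarrow> \<bar>I t \<omega> - I (real n) \<omega>\<bar> \<le>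
       chain_const * ((C3 + 2 * ln (real n + 1) + 2 * ln (real m + 1)) / exp (1 * real m) + exp (1 * real m) * a)" by blast
    from elim(4) obtain C4 where C4: "0 \<le> C4" "\<And>n m :: nat. \<And>a t. 0 \<le> a \<Longrightarrow> (\<And>s t. real n \<le> s \<Longrightarrow> s \<le> t \<Longrightarrow> t \<le> real n + 1 \<Longrightarrow> A s t \<omega> \<le> (t - s) * a) \<Longrightarrow> t \<in> {real n..real n + 1} \<Longrightarrow> \<bar>I t \<omega> - I (real n) \<omega>\<bar> \<le>
       chain_const * ((C4 + 2 * ln (real n + 1) + 2 * ln (real m + 1)) / exp (- 1 * real m) + exp (- 1 * real m) * a)" by blast
    define C where "C = max C3 C4"
    define D where "D = chain_const * (exp 1 * (C + 2 * ln (\<bar>c\<bar> * C2 + 2) + 4 / \<delta>) + exp (2 * \<bar>c\<bar> * C1))"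
    have D: "0 \<le> D" unfolding D_def using chain_const_pos C3(1) C2(1) \<delta>
      by (intro mult_nonneg_nonneg add_nonneg_nonneg) (auto simp: C_def)
    have "\<bar>I t \<omega> - I (real n) \<omega>\<bar> \<le> D * (real n + 1) powr \<delta> * exp (c * Z (real n) \<omega>)"
      if t: "t \<in> {real n..real n + 1}" for n t
    proof -
      define z where "z = c * Z (real n) \<omega>"
      define N where "N = real n + 1"
      have N: "1 \<le> N" "1 \<le> N powr \<delta>" "0 \<le> ln N" using \<delta> by (auto simp: N_def intro!: ge_one_powr_ge_zero)
      \<comment> \<open>A random bound on the squared integrand. It may be substituted because the
        unit-interval bound holds off one null set for all values of a.\<close>
      define a where "a = exp (2 * z) * exp (2 * \<bar>c\<bar> * (C1 + \<epsilon> * ln N))"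
      have a0: "0 \<le> a" by (simp add: a_def)
      have A: "A s u \<omega> \<le> (u - s) * a" if su: "real n \<le> s" "s \<le> u" "u \<le> real n + 1" for s u
      proof -
        have "(exp (c * Z r \<omega>))\<^sup>2 \<le> a" if "r \<in> {s..u}" for r
        proof -
          have "\<bar>Z r \<omega> - Z (real n) \<omega>\<bar> \<le> C1 + \<epsilon> * ln N" unfolding N_def by (rule C1(2)) (use that su in auto)
          then have "\<bar>c\<bar> * \<bar>Z r \<omega> - Z (real n) \<omega>\<bar> \<le> \<bar>c\<bar> * (C1 + \<epsilon> * ln N)" by (rule mult_left_mono) simp
          then have "c * Z r \<omega> - z \<le> \<bar>c\<bar> * (C1 + \<epsilon> * ln N)"
            unfolding z_def right_diff_distrib[symmetric] abs_mult[symmetric] by linarith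
          then have "exp (2 * (c * Z r \<omega>)) \<le> exp (2 * z + 2 * \<bar>c\<bar> * (C1 + \<epsilon> * ln N))" by simp
          then show ?thesis by (simp add: a_def exp_add exp_double)
        qed
        then have "(\<integral>\<^sup>+r\<in>{s..u}. ennreal ((exp (c * Z r \<omega>))\<^sup>2) \<partial>lborel) \<le> (\<integral>\<^sup>+r. ennreal a * indicator {s..u} r \<partial>lborel)"
          by (intro nn_integral_mono) (auto simp: indicator_def intro!: ennreal_leI)
        also have "\<dots> = ennreal ((u - s) * a)"
          using su a0 by (subst nn_integral_cmult_indicator) (simp_all add: mult.commute flip: ennreal_mult)
        finally have "A s u \<omega> \<le> enn2real (ennreal ((u - s) * a))"
          unfolding A_def by (rule enn2real_mono) simp
        then show ?thesis using su by (simp add: a_def)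
      qed
      \<comment> \<open>The scale is \<open>exp m\<close> for nonpositive z and
        \<open>exp (- m)\<close> for positive z, with m the integer part of |z|, rounded up in the
        second case. Either way it is within a factor e of exp (- z).\<close>
      have key: "\<exists>m :: nat. \<exists>\<sigma>. exp (- z - 1) \<le> \<sigma> \<and> \<sigma> \<le> exp (- z) \<and> real m \<le> \<bar>z\<bar> + 1 \<and>
        \<bar>I t \<omega> - I (real n) \<omega>\<bar> \<le> chain_const * ((C + 2 * ln N + 2 * ln (real m + 1)) / \<sigma> + \<sigma> * a)"
      proof (cases "z \<le> 0")
        case True
        define m where "m = nat \<lfloor>- z\<rfloor>"
        have m: "real m \<le> - z" "- z - 1 \<le> real m" using True by (auto simp: m_def)
        have "\<bar>I t \<omega> - I (real n) \<omega>\<bar> \<le> chain_const * ((C3 + 2 * ln N + 2 * ln (real m + 1)) / exp (1 * real m) + exp (1 * real m) * a)"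
          unfolding N_def by (rule C3(2)[OF a0 A t])
        also have "\<dots> \<le> chain_const * ((C + 2 * ln N + 2 * ln (real m + 1)) / exp (real m) + exp (real m) * a)"
          using chain_const_pos by (intro mult_left_mono) (auto simp: C_def divide_right_mono)
        finally show ?thesis using m True by (intro exI[of _ m] exI[of _ "exp (real m)"]) auto
      next
        case False
        define m where "m = nat \<lceil>z\<rceil>"
        have m: "z \<le> real m" "real m \<le> z + 1" using False by (auto simp: m_def)
        have "\<bar>I t \<omega> - I (real n) \<omega>\<bar> \<le> chain_const * ((C4 + 2 * ln N + 2 * ln (real m + 1)) / exp (- 1 * real m) + exp (- 1 * real m) * a)"
          unfolding N_def by (rule C4(2)[OF a0 A t])
        also have "\<dots> \<le> chain_const * ((C + 2 * ln N + 2 * ln (real m + 1)) / exp (- real m) + exp (- real m) * a)"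
          using chain_const_pos by (intro mult_left_mono) (auto simp: C_def divide_right_mono)
        finally show ?thesis using m False by (intro exI[of _ m] exI[of _ "exp (- real m)"]) auto
      qed
      then obtain m :: nat and \<sigma> where \<sigma>: "exp (- z - 1) \<le> \<sigma>" "\<sigma> \<le> exp (- z)" and m: "real m \<le> \<bar>z\<bar> + 1"
        and I: "\<bar>I t \<omega> - I (real n) \<omega>\<bar> \<le> chain_const * ((C + 2 * ln N + 2 * ln (real m + 1)) / \<sigma> + \<sigma> * a)" by blast
      have lnN: "ln N \<le> N powr \<delta> / \<delta>" by (rule ln_powr_bound[OF N(1) \<delta>])
      have lnm: "ln (real m + 1) \<le> ln (\<bar>c\<bar> * C2 + 2) + ln N"
      proof -
        have "\<bar>z\<bar> \<le> \<bar>c\<bar> * (C2 * N)"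
          unfolding z_def abs_mult N_def by (intro mult_left_mono C2(2)) auto
        then have "real m + 1 \<le> (\<bar>c\<bar> * C2 + 2) * N" using m N(1) by (simp add: algebra_simps)
        then have "ln (real m + 1) \<le> ln ((\<bar>c\<bar> * C2 + 2) * N)" by (intro ln_mono) auto
        also have "\<dots> = ln (\<bar>c\<bar> * C2 + 2) + ln N"
          using N(1) C2(1) by (intro ln_mult_pos) (auto intro!: add_nonneg_pos)
        finally show ?thesis .
      qed
      have l0: "0 \<le> ln (\<bar>c\<bar> * C2 + 2)" using C2(1) by (intro ln_ge_zero) (auto intro!: add_increasing)
      have C0: "0 \<le> C" using C3(1) by (simp add: C_def)
      have p1: "(C + 2 * ln N + 2 * ln (real m + 1)) / \<sigma> \<le> (exp 1 * (C + 2 * ln (\<bar>c\<bar> * C2 + 2) + 4 / \<delta>)) * N powr \<delta> * exp z"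
      proof -
        have "C + 2 * ln N + 2 * ln (real m + 1) \<le> (C + 2 * ln (\<bar>c\<bar> * C2 + 2)) * 1 + 4 * (N powr \<delta> / \<delta>)"
          using lnm lnN by simp
        also have "\<dots> \<le> (C + 2 * ln (\<bar>c\<bar> * C2 + 2)) * N powr \<delta> + 4 * (N powr \<delta> / \<delta>)"
          using N C0 l0 by (intro add_right_mono mult_left_mono) auto
        also have "\<dots> = (C + 2 * ln (\<bar>c\<bar> * C2 + 2) + 4 / \<delta>) * N powr \<delta>" by (simp add: algebra_simps)
        finally have 1: "C + 2 * ln N + 2 * ln (real m + 1) \<le> (C + 2 * ln (\<bar>c\<bar> * C2 + 2) + 4 / \<delta>) * N powr \<delta>" .
        have "(C + 2 * ln N + 2 * ln (real m + 1)) / \<sigma> \<le> ((C + 2 * ln (\<bar>c\<bar> * C2 + 2) + 4 / \<delta>) * N powr \<delta>) / exp (- z - 1)"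
          by (rule frac_le[OF _ 1 _ \<sigma>(1)]) (use C0 l0 \<delta> in auto)
        also have "\<dots> = (exp 1 * (C + 2 * ln (\<bar>c\<bar> * C2 + 2) + 4 / \<delta>)) * N powr \<delta> * exp z"
          by (simp add: exp_diff exp_minus field_simps)
        finally show ?thesis .
      qed
      have p2: "\<sigma> * a \<le> exp (2 * \<bar>c\<bar> * C1) * N powr \<delta> * exp z"
      proof -
        have "\<sigma> * a \<le> exp (- z) * a" using \<sigma>(2) a0 by (rule mult_right_mono)
        also have "\<dots> = exp z * exp (2 * \<bar>c\<bar> * C1) * exp (2 * \<bar>c\<bar> * \<epsilon> * ln N)"
          by (simp add: a_def flip: exp_add) (simp add: algebra_simps)
        also have "\<dots> \<le> exp z * exp (2 * \<bar>c\<bar> * C1) * exp (\<delta> * ln N)"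
          using \<epsilon>(2) N(3) by (intro mult_left_mono) (auto intro!: mult_right_mono)
        also have "\<dots> = exp (2 * \<bar>c\<bar> * C1) * N powr \<delta> * exp z" using N(1) by (simp add: powr_def)
        finally show ?thesis .
      qed
      have "\<bar>I t \<omega> - I (real n) \<omega>\<bar> \<le> chain_const * ((exp 1 * (C + 2 * ln (\<bar>c\<bar> * C2 + 2) + 4 / \<delta>)) * N powr \<delta> * exp z + exp (2 * \<bar>c\<bar> * C1) * N powr \<delta> * exp z)"
        using I p1 p2 chain_const_pos by (meson add_mono mult_left_mono order_trans less_imp_le)
      then show ?thesis by (simp add: D_def N_def z_def algebra_simps)
    qed
    then show ?case using D by blast
  qed
qed

section \<open>Pathwise growth of the horizontal components\<close>

text \<open>The first quarter of the gap between \<open>\<kappa>\<close> and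
  \<open>\<kappa>'\<close> is reserved for the small powers of t collected by the callers. The
  remaining three quarters absorb the constant G and the change from \<open>ln (t + 1)\<close> to
  \<open>ln t\<close>.\<close>

lemma polynomial_absorbed:
  fixes G p \<kappa> \<kappa>' :: real
  assumes G: "0 \<le> G" and p: "0 < p" and \<kappa>: "\<kappa> < \<kappa>'"
  shows "\<forall>\<^sub>F t in at_top. G * exp ((p * \<kappa> + p * (\<kappa>' - \<kappa>) / 4) * ln (t + 1)) \<le> exp (p * \<kappa>' * ln t)"
proof -
  define u v where "u = p * \<kappa> + p * (\<kappa>' - \<kappa>) / 4" and "v = p * (\<kappa>' - \<kappa>) / 4 * 3"
  have uv: "u + v = p * \<kappa>'" by (simp add: u_def v_def field_simps)
  have v: "0 < v" using p \<kappa> by (simp add: v_def)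
  have "filterlim (\<lambda>t. v * ln t) at_top at_top" using v by real_asymp
  then have 1: "\<forall>\<^sub>F t in at_top. ln (G + 1) + 1 \<le> v * ln t" unfolding filterlim_at_top by blast
  have "((\<lambda>t. u * (ln (t + 1) - ln t)) \<longlongrightarrow> 0) at_top" by real_asymp
  from order_tendstoD(2)[OF this, of 1] have 2: "\<forall>\<^sub>F t in at_top. u * (ln (t + 1) - ln t) < 1" by simp
  from 1 2 have "\<forall>\<^sub>F t in at_top. G * exp (u * ln (t + 1)) \<le> exp ((u + v) * ln t)"
  proof eventually_elim
    case (elim t)
    then have "ln (G + 1) + u * ln (t + 1) \<le> (u + v) * ln t" by (simp add: algebra_simps)
    then have "exp (ln (G + 1)) * exp (u * ln (t + 1)) \<le> exp ((u + v) * ln t)"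
      by (simp only: exp_add[symmetric] exp_le_cancel_iff)
    moreover have "G \<le> exp (ln (G + 1))" using G by simp
    ultimately show ?case by (meson exp_ge_zero mult_right_mono order_trans)
  qed
  then show ?thesis by (simp add: uv) (simp add: u_def)
qed

section \<open>Deterministic paths with positive drift\<close>

text \<open>What is kept of one sample path off the null sets. The fluctuations are allowed the rate
  9/10 of the drift, so a / 10 remains and makes the series below geometric; the rate also forces
  \<open>\<kappa>\<close> above 5 / (9 a) when it is supplied by the Brownian bound, still less than
  2 / (3 a). The locale is applied to Z, and for negative drift to -Z.\<close>

locale drifting_path =
  fixes z :: "real \<Rightarrow> real" and a \<kappa> C :: real
  assumes a: "0 < a" and C: "0 \<le> C"
    and pair: "\<And>i k :: nat. \<bar>(z (real k) - a * real k) - (z (real i) - a * real i)\<bar>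
      \<le> 9 / 10 * a * \<bar>real k - real i\<bar> + \<kappa> * ln (real i + 1) + C"
    and osc: "\<And>\<epsilon>. 0 < \<epsilon> \<Longrightarrow> \<exists>D\<ge>0. \<forall>n. \<forall>t\<in>{real n..real n + 1}. \<bar>z t - z (real n)\<bar> \<le> D + \<epsilon> * ln (real n + 1)"
begin

lemma backward: "k \<le> i \<Longrightarrow> z (real k) \<le> z (real i) - a / 10 * real (i - k) + \<kappa> * ln (real i + 1) + C"
proof -
  assume ki: "k \<le> i"
  have abs: "\<bar>real k - real i\<bar> = real i - real k" using ki by simp
  have pair': "\<bar>(z (real k) - a * real k) - (z (real i) - a * real i)\<bar>
      \<le> 9 / 10 * (a * real i) - 9 / 10 * (a * real k) + \<kappa> * ln (real i + 1) + C"
    using pair[of k i] unfolding abs by (simp add: right_diff_distrib)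
  have *: "a / 10 * real (i - k) = (a * real i - a * real k) / 10" using ki by (simp add: of_nat_diff right_diff_distrib diff_divide_distrib)
  show ?thesis using pair' unfolding * abs_le_iff diff_divide_distrib by linarith
qed

lemma forward: "i \<le> k \<Longrightarrow> z (real i) + a / 10 * real (k - i) - \<kappa> * ln (real i + 1) - C \<le> z (real k)"
proof -
  assume ki: "i \<le> k"
  have abs: "\<bar>real k - real i\<bar> = real k - real i" using ki by simp
  have pair': "\<bar>(z (real k) - a * real k) - (z (real i) - a * real i)\<bar>
      \<le> 9 / 10 * (a * real k) - 9 / 10 * (a * real i) + \<kappa> * ln (real i + 1) + C"
    using pair[of k i] unfolding abs by (simp add: right_diff_distrib)
  have *: "a / 10 * real (k - i) = (a * real k - a * real i) / 10" using ki by (simp add: of_nat_diff right_diff_distrib diff_divide_distrib)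
  show ?thesis using pair' unfolding * abs_le_iff diff_divide_distrib by linarith
qed

lemma linear_growth: "\<exists>K. \<forall>t\<ge>0. a / 10 * (t - 1) - ln (t + 1) + K \<le> z t"
proof -
  obtain D where D: "0 \<le> D" "\<And>n t. t \<in> {real n..real n + 1} \<Longrightarrow> \<bar>z t - z (real n)\<bar> \<le> D + 1 * ln (real n + 1)"
    using osc[of 1] by auto
  have "a / 10 * (t - 1) - ln (t + 1) + (z 0 - C - D) \<le> z t" if t: "0 \<le> t" for t
  proof -
    define n where "n = nat \<lfloor>t\<rfloor>"
    have n: "real n \<le> t" "t \<le> real n + 1" using t by (auto simp: n_def)
    have "ln (real n + 1) \<le> ln (t + 1)" using n by simp
    moreover have "a / 10 * (t - 1) \<le> a / 10 * real n" using n a by (intro mult_left_mono) auto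
    moreover have "\<bar>z t - z (real n)\<bar> \<le> D + 1 * ln (real n + 1)" by (rule D(2)) (use n in auto)
    moreover have "z 0 + a / 10 * real n - C \<le> z (real n)" using forward[of 0 n] by simp
    ultimately show ?thesis by linarith
  qed
  then show ?thesis by blast
qed

lemma eventually_nonneg: "\<forall>\<^sub>F t in at_top. 0 \<le> z t"
proof -
  obtain K where K: "\<And>t. 0 \<le> t \<Longrightarrow> a / 10 * (t - 1) - ln (t + 1) + K \<le> z t" using linear_growth by blast
  have "filterlim (\<lambda>t. a / 10 * (t - 1) - ln (t + 1) + K) at_top at_top" using a by real_asymp
  then have "\<forall>\<^sub>F t in at_top. 0 \<le> a / 10 * (t - 1) - ln (t + 1) + K" unfolding filterlim_at_top by blast
  with eventually_ge_at_top[of 0] show ?thesis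
    by eventually_elim (use K order_trans in blast)
qed

lemma grid_tail:
  assumes t: "t \<in> {real n..real n + 1}" and \<epsilon>: "0 < \<epsilon>"
    and D: "0 \<le> D" "\<And>n t. t \<in> {real n..real n + 1} \<Longrightarrow> \<bar>z t - z (real n)\<bar> \<le> D + \<epsilon> * ln (real n + 1)"
  shows "\<bar>z t - z (real n)\<bar> \<le> D + \<epsilon> * ln (t + 1)" "ln (real n + 1) \<le> ln (t + 1)"
proof -
  show *: "ln (real n + 1) \<le> ln (t + 1)" using t by simp
  show "\<bar>z t - z (real n)\<bar> \<le> D + \<epsilon> * ln (t + 1)"
    using D(2)[OF t] mult_left_mono[OF *, of \<epsilon>] \<epsilon> by linarith
qed

text \<open>Seen from time n, the earlier heights lie below \<open>z n + \<kappa> ln n\<close> by an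
  amount growing linearly in n - k. The increments of x are thus dominated by a geometric series
  running backward from n, with sum of the order of its largest term.\<close>

lemma expanding_integral_bound:
  assumes p: "0 < p" and \<kappa>: "0 \<le> \<kappa>" "\<kappa> < \<kappa>'"
    and x: "\<And>\<delta>. 0 < \<delta> \<Longrightarrow> \<exists>D\<ge>0. \<forall>n. \<forall>t\<in>{real n..real n + 1}. \<bar>x t - x (real n)\<bar> \<le> D * (real n + 1) powr \<delta> * exp (p * z (real n))"
  shows "\<forall>\<^sub>F t in at_top. \<bar>x t\<bar> \<le> exp (p * (z t + \<kappa>' * ln t))"
proof -
  \<comment> \<open>The exponent receives \<delta> from the increments of x and p \<delta> from the
    oscillation of z between t and the preceding integer; together they use exactly the quarter of
    the gap left by \<open>polynomial_absorbed\<close>.\<close>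
  define \<delta> where "\<delta> = p * (\<kappa>' - \<kappa>) / 4 / (p + 1)"
  have \<delta>: "0 < \<delta>" "(p + 1) * \<delta> = p * (\<kappa>' - \<kappa>) / 4"
  proof -
    have "p + 1 \<noteq> 0" using p by simp
    then show "(p + 1) * \<delta> = p * (\<kappa>' - \<kappa>) / 4" unfolding \<delta>_def by (metis nonzero_mult_div_cancel_left times_divide_eq_right)
    show "0 < \<delta>" unfolding \<delta>_def using p \<kappa> by (intro divide_pos_pos mult_pos_pos) auto
  qed
  obtain D where D: "0 \<le> D" "\<And>n t. t \<in> {real n..real n + 1} \<Longrightarrow> \<bar>x t - x (real n)\<bar> \<le> D * (real n + 1) powr \<delta> * exp (p * z (real n))"
    using x[OF \<delta>(1)] by blast
  obtain E where E: "0 \<le> E" "\<And>n t. t \<in> {real n..real n + 1} \<Longrightarrow> \<bar>z t - z (real n)\<bar> \<le> E + \<delta> * ln (real n + 1)"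
    using osc[OF \<delta>(1)] by blast
  define K where "K = D + \<bar>x 0\<bar> * exp (- p * z 0)"
  have K: "0 \<le> K" using D by (simp add: K_def)
  define r where "r = exp (- p * a / 10)"
  have r: "0 < r" "r < 1" using p a by (auto simp: r_def)
  define G where "G = K / (1 - r) * exp (p * C + p * E)"
  have G: "0 \<le> G" using K r by (simp add: G_def)
  have bound: "\<bar>x t\<bar> \<le> G * exp (p * z t + (\<delta> + p * \<kappa> + p * \<delta>) * ln (t + 1))" if t: "0 \<le> t" for t
  proof -
    define n where "n = nat \<lfloor>t\<rfloor>"
    have n: "t \<in> {real n..real n + 1}" using t by (auto simp: n_def)
    define l where "l = ln (t + 1)"
    have l: "0 \<le> l" using t by (simp add: l_def)
    have tm: "(real k + 1) powr \<delta> * exp (p * z (real k)) \<le> exp (\<delta> * l + p * (z (real n) + \<kappa> * l + C)) * r ^ (n - k)" if k: "k \<le> n" for k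
    proof -
      have lk: "ln (real k + 1) \<le> l" using k n by (simp add: l_def)
      have lnn: "ln (real n + 1) \<le> l" using n by (simp add: l_def)
      have "p * z (real k) \<le> p * (z (real n) - a / 10 * real (n - k) + \<kappa> * l + C)"
        using backward[OF k] mult_left_mono[OF lnn \<kappa>(1)] p by (intro mult_left_mono) auto
      moreover have "\<delta> * ln (real k + 1) \<le> \<delta> * l" using lk \<delta> by (intro mult_left_mono) auto
      ultimately have "\<delta> * ln (real k + 1) + p * z (real k) \<le> \<delta> * l + p * (z (real n) + \<kappa> * l + C) + real (n - k) * (- p * a / 10)"
        by (simp add: algebra_simps)
      then have "exp (\<delta> * ln (real k + 1) + p * z (real k)) \<le> exp (\<delta> * l + p * (z (real n) + \<kappa> * l + C) + real (n - k) * (- p * a / 10))"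
        by simp
      also have "\<dots> = exp (\<delta> * l + p * (z (real n) + \<kappa> * l + C)) * r ^ (n - k)"
        by (simp only: r_def exp_of_nat_mult[symmetric] exp_add[symmetric])
      finally show ?thesis by (simp add: powr_def exp_add)
    qed
    define e where "e = exp (\<delta> * l + p * (z (real n) + \<kappa> * l + C))"
    \<comment> \<open>The initial value |x 0| is written as a further increment at time 0, so that
      \<open>tm\<close> bounds it together with the others.\<close>
    define X0 where "X0 = \<bar>x 0\<bar> * exp (- p * z 0)"
    have "\<bar>x (real n)\<bar> \<le> \<bar>x 0\<bar> + (\<Sum>k<n. D * ((real k + 1) powr \<delta> * exp (p * z (real k))))" for n
    proof (induction n)
      case (Suc n)
      have "\<bar>x (real (Suc n)) - x (real n)\<bar> \<le> D * (real n + 1) powr \<delta> * exp (p * z (real n))"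
        by (rule D(2)) auto
      then show ?case using Suc by simp
    qed simp
    from this[of n] D(2)[OF n]
    have 1: "\<bar>x t\<bar> \<le> \<bar>x 0\<bar> + (\<Sum>k\<le>n. D * ((real k + 1) powr \<delta> * exp (p * z (real k))))"
      by (simp add: lessThan_Suc_atMost[symmetric])
    have "X0 * ((real 0 + 1) powr \<delta> * exp (p * z (real 0))) \<le> X0 * (e * r ^ (n - 0))"
      unfolding e_def by (intro mult_left_mono tm) (auto simp: X0_def)
    moreover have "r ^ n \<le> 1 / (1 - r)"
    proof -
      have "r ^ n \<le> 1" using r by (simp add: power_le_one)
      also have "\<dots> \<le> 1 / (1 - r)" using r by (simp add: field_simps)
      finally show ?thesis .
    qed
    then have "X0 * (e * r ^ n) \<le> X0 * (e * (1 / (1 - r)))"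
      by (intro mult_left_mono) (auto simp: X0_def e_def)
    ultimately have 2: "\<bar>x 0\<bar> \<le> X0 * (e * (1 / (1 - r)))"
      by (simp add: X0_def mult.assoc flip: exp_add)
    have "(\<Sum>k\<le>n. D * ((real k + 1) powr \<delta> * exp (p * z (real k)))) \<le> (\<Sum>k\<le>n. D * (e * r ^ (n - k)))"
      using D(1) tm by (intro sum_mono mult_left_mono) (auto simp: e_def)
    also have "\<dots> = (\<Sum>k\<le>n. D * (e * r ^ k))"
      by (rule sum.reindex_bij_witness[of _ "\<lambda>k. n - k" "\<lambda>k. n - k"]) auto
    also have "\<dots> = D * (e * (\<Sum>k\<le>n. r ^ k))" by (simp add: sum_distrib_left)
    also have "\<dots> \<le> D * (e * (1 / (1 - r)))"
    proof -
      have "(\<Sum>k\<le>n. r ^ k) \<le> 1 / (1 - r)"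
        using sum_le_suminf[of "\<lambda>k. r ^ k" "{..n}"] suminf_geometric[of r] r by simp
      then show ?thesis using D(1) by (intro mult_left_mono) (auto simp: e_def)
    qed
    finally have "\<bar>x t\<bar> \<le> X0 * (e * (1 / (1 - r))) + D * (e * (1 / (1 - r)))"
      using 1 2 by linarith
    also have "\<dots> = K / (1 - r) * e" by (simp add: K_def X0_def add_divide_distrib distrib_right)
    finally have "\<bar>x t\<bar> \<le> K / (1 - r) * exp (\<delta> * l + p * (z (real n) + \<kappa> * l + C))" by (simp add: e_def)
    also have "\<dots> \<le> K / (1 - r) * exp (\<delta> * l + p * (z t + (E + \<delta> * l) + \<kappa> * l + C))"
      using grid_tail(1)[OF n \<delta>(1) E] K r p
      by (intro mult_left_mono) (auto simp: l_def abs_le_iff)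
    also have "\<dots> = G * exp (p * z t + (\<delta> + p * \<kappa> + p * \<delta>) * l)"
      by (simp add: G_def mult.assoc flip: exp_add) (simp add: algebra_simps)
    finally show ?thesis by (simp add: l_def)
  qed
  note polynomial_absorbed[OF G p \<kappa>(2)]
  with eventually_ge_at_top[of 0] show ?thesis
  proof eventually_elim
    case (elim t)
    have e: "\<delta> + p * \<kappa> + p * \<delta> = p * \<kappa> + p * (\<kappa>' - \<kappa>) / 4" using \<delta>(2) by (simp add: algebra_simps)
    have "\<bar>x t\<bar> \<le> exp (p * z t) * (G * exp ((p * \<kappa> + p * (\<kappa>' - \<kappa>) / 4) * ln (t + 1)))"
      using bound[OF elim(1)] unfolding e exp_add by (simp add: mult_ac)
    also have "\<dots> \<le> exp (p * z t) * exp (p * \<kappa>' * ln t)" using elim(2) by (intro mult_left_mono) auto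
    also have "\<dots> = exp (p * (z t + \<kappa>' * ln t))" by (simp add: algebra_simps flip: exp_add)
    finally show ?case .
  qed
qed

text \<open>The mirror argument in forward time: from n on, the heights stay above
  \<open>z n - \<kappa> ln n\<close> by a linearly growing amount, so the remaining increments of y
  form a geometric tail. This yields convergence and the rate at once.\<close>

lemma contracting_integral_bound:
  assumes q: "0 < q" and \<kappa>: "0 \<le> \<kappa>" "\<kappa> < \<kappa>'"
    and y: "\<And>\<delta>. 0 < \<delta> \<Longrightarrow> \<exists>D\<ge>0. \<forall>n. \<forall>t\<in>{real n..real n + 1}. \<bar>y t - y (real n)\<bar> \<le> D * (real n + 1) powr \<delta> * exp (- q * z (real n))"
  shows "\<exists>L. (y \<longlongrightarrow> L) at_top \<and> (\<forall>\<^sub>F t in at_top. \<bar>y t - L\<bar> \<le> exp (- q * (z t - \<kappa>' * ln t)))"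
proof -
  \<comment> \<open>The first bound respects the quarter of the gap, as before. The second keeps the
    ratio \<open>exp (\<delta> - q a / 10)\<close> below 1 although the increments carry a growing
    power of k.\<close>
  define \<delta> where "\<delta> = min (q * (\<kappa>' - \<kappa>) / 4 / (q + 1)) (q * a / 20)"
  have \<delta>: "0 < \<delta>" "(q + 1) * \<delta> \<le> q * (\<kappa>' - \<kappa>) / 4" "\<delta> < q * a / 10"
  proof -
    have q1: "0 < q + 1" using q by simp
    show "0 < \<delta>" unfolding \<delta>_def using q a \<kappa> by (simp only: min_less_iff_conj) (auto intro!: divide_pos_pos)
    have "\<delta> \<le> q * (\<kappa>' - \<kappa>) / 4 / (q + 1)" unfolding \<delta>_def by (rule min.cobounded1)
    then show "(q + 1) * \<delta> \<le> q * (\<kappa>' - \<kappa>) / 4" using q1 by (simp only: pos_le_divide_eq mult.commute)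
    have "\<delta> \<le> q * a / 20" unfolding \<delta>_def by (rule min.cobounded2)
    moreover have "0 < q * a" using q a by simp
    ultimately show "\<delta> < q * a / 10" by linarith
  qed
  obtain D where D: "0 \<le> D" "\<And>n t. t \<in> {real n..real n + 1} \<Longrightarrow> \<bar>y t - y (real n)\<bar> \<le> D * (real n + 1) powr \<delta> * exp (- q * z (real n))"
    using y[OF \<delta>(1)] by blast
  obtain E where E: "0 \<le> E" "\<And>n t. t \<in> {real n..real n + 1} \<Longrightarrow> \<bar>z t - z (real n)\<bar> \<le> E + \<delta> * ln (real n + 1)"
    using osc[OF \<delta>(1)] by blast
  define r where "r = exp (\<delta> - q * a / 10)"
  have r: "0 < r" "r < 1" using \<delta>(3) by (auto simp: r_def)
  define e where "e n = D * exp ((\<delta> + q * \<kappa>) * ln (real n + 1) - q * z (real n) + q * C)" for n :: nat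
  define d where "d k = D * (real k + 1) powr \<delta> * exp (- q * z (real k))" for k :: nat
  have e0: "0 \<le> e n" for n using D(1) by (simp add: e_def)
  have de: "d k \<le> e n * r ^ (k - n)" if k: "n \<le> k" for n k
  proof -
    \<comment> \<open>The power of k + 1 is split into one of n + 1 and a factor exponential in k -
      n, which joins the geometric ratio.\<close>
    have "real k + 1 \<le> (real n + 1) * (1 + real (k - n))"
      using k by (simp add: of_nat_diff algebra_simps) (simp add: mult_left_mono flip: of_nat_mult)
    also have "\<dots> \<le> (real n + 1) * exp (real (k - n))" by (intro mult_left_mono exp_ge_add_one_self) auto
    finally have "ln (real k + 1) \<le> ln ((real n + 1) * exp (real (k - n)))" by (subst ln_le_cancel_iff) auto
    also have "\<dots> = ln (real n + 1) + real (k - n)" by (subst ln_mult_pos) auto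
    finally have "\<delta> * ln (real k + 1) \<le> \<delta> * (ln (real n + 1) + real (k - n))" using \<delta>(1) by (intro mult_left_mono) auto
    moreover have "q * (z (real n) + a / 10 * real (k - n) - \<kappa> * ln (real n + 1) - C) \<le> q * z (real k)"
      using forward[OF k] q by (intro mult_left_mono) auto
    ultimately have "\<delta> * ln (real k + 1) - q * z (real k) \<le> ((\<delta> + q * \<kappa>) * ln (real n + 1) - q * z (real n) + q * C) + real (k - n) * (\<delta> - q * a / 10)"
      by (simp add: algebra_simps)
    then have "exp (\<delta> * ln (real k + 1) - q * z (real k)) \<le> exp (((\<delta> + q * \<kappa>) * ln (real n + 1) - q * z (real n) + q * C) + real (k - n) * (\<delta> - q * a / 10))"
      by simp
    also have "\<dots> = exp ((\<delta> + q * \<kappa>) * ln (real n + 1) - q * z (real n) + q * C) * r ^ (k - n)"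
      by (simp only: r_def exp_of_nat_mult[symmetric] exp_add[symmetric])
    finally have "D * exp (\<delta> * ln (real k + 1) - q * z (real k)) \<le> D * (exp ((\<delta> + q * \<kappa>) * ln (real n + 1) - q * z (real n) + q * C) * r ^ (k - n))"
      using D(1) by (rule mult_left_mono)
    moreover have "d k = D * exp (\<delta> * ln (real k + 1) - q * z (real k))"
      by (simp add: d_def powr_def exp_diff exp_minus divide_inverse)
    ultimately show ?thesis by (simp add: e_def mult.assoc)
  qed
  have d0: "0 \<le> d k" for k using D(1) by (simp add: d_def)
  have ei: "e n \<le> e n * (1 / (1 - r))" for n
    using e0[of n] r mult_left_mono[of 1 "1 / (1 - r)" "e n"] by (simp add: field_simps)
  have dd: "d k \<le> e n * (1 / (1 - r))" if "n \<le> k" for n k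
  proof -
    have "e n * r ^ (k - n) \<le> e n * 1" using e0 r by (intro mult_left_mono power_le_one) auto
    then show ?thesis using de[OF that] ei[of n] by simp
  qed
  have grid: "\<bar>y (real m) - y (real n)\<bar> \<le> e n * (1 / (1 - r))" if "n \<le> m" for n m
  proof -
    have "\<bar>y (real (n + j)) - y (real n)\<bar> \<le> e n * (\<Sum>k<j. r ^ k)" for j
    proof (induction j)
      case (Suc j)
      have "\<bar>y (real (n + Suc j)) - y (real (n + j))\<bar> \<le> d (n + j)"
        unfolding d_def by (rule D(2)) auto
      also have "\<dots> \<le> e n * r ^ j" using de[of n "n + j"] by simp
      finally show ?case using Suc by (simp add: distrib_left)
    qed simp
    from this[of "m - n"] that have "\<bar>y (real m) - y (real n)\<bar> \<le> e n * (\<Sum>k<m - n. r ^ k)" by simp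
    also have "\<dots> \<le> e n * (1 / (1 - r))"
    proof -
      have "(\<Sum>k<m - n. r ^ k) \<le> 1 / (1 - r)"
        using sum_le_suminf[of "\<lambda>k. r ^ k" "{..<m - n}"] suminf_geometric[of r] r by simp
      then show ?thesis using e0 by (intro mult_left_mono)
    qed
    finally show ?thesis .
  qed
  \<comment> \<open>The 2 accounts for two contributions, the tail from n on and the part of the
    current unit interval up to t, each at most \<open>e n / (1 - r)\<close>.\<close>
  define G where "G = 2 * (D / (1 - r) * exp (q * C + q * E))"
  have G: "0 \<le> G" using D(1) r by (simp add: G_def)
  define b where "b t = G * exp ((\<delta> + q * \<kappa> + q * \<delta>) * ln (t + 1) - q * z t)" for t
  have fromt: "\<bar>y (real m) - y t\<bar> \<le> b t" if t: "0 \<le> t" "t \<le> real m" for t m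
  proof -
    define n where "n = nat \<lfloor>t\<rfloor>"
    have n: "t \<in> {real n..real n + 1}" using t by (auto simp: n_def)
    have nm: "n \<le> m" using n t by simp
    have "\<bar>y (real m) - y t\<bar> \<le> \<bar>y (real m) - y (real n)\<bar> + \<bar>y t - y (real n)\<bar>" by simp
    also have "\<dots> \<le> e n * (1 / (1 - r)) + d n"
      using grid[OF nm] D(2)[OF n] unfolding d_def by (rule add_mono)
    also have "\<dots> \<le> 2 * (e n * (1 / (1 - r)))" using dd[of n n] by simp
    also have "\<dots> \<le> b t"
    proof -
      have "(\<delta> + q * \<kappa>) * ln (real n + 1) \<le> (\<delta> + q * \<kappa>) * ln (t + 1)"
        using grid_tail(2)[OF n \<delta>(1) E] \<delta> q \<kappa> by (intro mult_left_mono) auto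
      moreover have "q * (z t - z (real n)) \<le> q * (E + \<delta> * ln (t + 1))"
        using grid_tail(1)[OF n \<delta>(1) E] q by (intro mult_left_mono) (auto simp: abs_le_iff)
      ultimately have "(\<delta> + q * \<kappa>) * ln (real n + 1) - q * z (real n) + q * C \<le> (q * C + q * E) + ((\<delta> + q * \<kappa> + q * \<delta>) * ln (t + 1) - q * z t)"
        by (simp add: algebra_simps)
      then have "exp ((\<delta> + q * \<kappa>) * ln (real n + 1) - q * z (real n) + q * C) \<le> exp (q * C + q * E) * exp ((\<delta> + q * \<kappa> + q * \<delta>) * ln (t + 1) - q * z t)"
        by (simp only: exp_add[symmetric] exp_le_cancel_iff)
      then have "2 * (D / (1 - r)) * exp ((\<delta> + q * \<kappa>) * ln (real n + 1) - q * z (real n) + q * C) \<le> 2 * (D / (1 - r)) * (exp (q * C + q * E) * exp ((\<delta> + q * \<kappa> + q * \<delta>) * ln (t + 1) - q * z t))"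
        using D(1) r by (intro mult_left_mono) auto
      then show ?thesis by (simp add: e_def b_def G_def mult_ac)
    qed
    finally show ?thesis .
  qed
  \<comment> \<open>The linear growth of z beats all powers of t, so the tail bound vanishes. This
    gives first the limit along the integers and then, through \<open>Lb\<close>, the limit along
    real times.\<close>
  have b0: "(b \<longlongrightarrow> 0) at_top"
  proof -
    define c where "c = \<delta> + q * \<kappa> + q * \<delta>"
    obtain K where K: "\<And>t. 0 \<le> t \<Longrightarrow> a / 10 * (t - 1) - ln (t + 1) + K \<le> z t" using linear_growth by blast
    define w where "w = q * a / 10"
    have w: "0 < w" using q a by (simp add: w_def)
    have "((\<lambda>t. G * exp (c * ln (t + 1) - (w * (t - 1) - q * ln (t + 1) + q * K))) \<longlongrightarrow> 0) at_top"
      using w by real_asymp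
    then show ?thesis
    proof (rule tendsto_sandwich[OF _ _ tendsto_const, rotated 2])
      show "\<forall>\<^sub>F t in at_top. 0 \<le> b t" using G by (simp add: b_def)
      show "\<forall>\<^sub>F t in at_top. b t \<le> G * exp (c * ln (t + 1) - (w * (t - 1) - q * ln (t + 1) + q * K))"
        using eventually_ge_at_top[of 0]
      proof eventually_elim
        case (elim t)
        have "q * (a / 10 * (t - 1) - ln (t + 1) + K) \<le> q * z t" using K[OF elim] q by (intro mult_left_mono) auto
        then show ?case unfolding b_def c_def[symmetric] using G by (intro mult_left_mono) (auto simp: w_def algebra_simps)
      qed
    qed
  qed
  have "Cauchy (\<lambda>n. y (real n))"
  proof (rule metric_CauchyI)
    fix \<epsilon> :: real assume \<epsilon>: "0 < \<epsilon>"
    have "\<forall>\<^sub>F t in at_top. b t < \<epsilon> / 2" using order_tendstoD(2)[OF b0, of "\<epsilon> / 2"] \<epsilon> by simp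
    then obtain T where T: "\<And>t. T \<le> t \<Longrightarrow> b t < \<epsilon> / 2" by (auto simp: eventually_at_top_linorder)
    define N where "N = nat \<lceil>T\<rceil>"
    have N: "T \<le> real N" by (simp add: N_def of_nat_ceiling)
    have "dist (y (real m)) (y (real n)) < \<epsilon>" if "N \<le> m" "N \<le> n" for m n
      using fromt[of "real N" m] fromt[of "real N" n] T[OF N] that by (simp add: dist_real_def)
    then show "\<exists>N. \<forall>m\<ge>N. \<forall>n\<ge>N. dist (y (real m)) (y (real n)) < \<epsilon>" by blast
  qed
  then obtain L where L: "(\<lambda>n. y (real n)) \<longlonglongrightarrow> L"
    using Cauchy_convergent convergent_def by blast
  have Lb: "\<bar>y t - L\<bar> \<le> b t" if t: "0 \<le> t" for t
  proof -
    have "(\<lambda>m. \<bar>y (real m) - y t\<bar>) \<longlonglongrightarrow> \<bar>L - y t\<bar>" by (intro tendsto_intros L)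
    moreover have "\<forall>\<^sub>F m in sequentially. \<bar>y (real m) - y t\<bar> \<le> b t"
      using eventually_ge_at_top[of "nat \<lceil>t\<rceil>"] by eventually_elim (use fromt[OF t] in \<open>auto simp: nat_ceiling_le_eq\<close>)
    ultimately have "\<bar>L - y t\<bar> \<le> b t" by (intro tendsto_upperbound) auto
    then show ?thesis by (simp add: abs_minus_commute)
  qed
  have "(y \<longlongrightarrow> L) at_top"
  proof -
    have "((\<lambda>t. y t - L) \<longlongrightarrow> 0) at_top"
      by (rule Lim_null_comparison[OF _ b0]) (use Lb in \<open>auto intro!: eventually_mono[OF eventually_ge_at_top[of 0]]\<close>)
    then show ?thesis by (simp add: LIM_zero_iff)
  qed
  moreover have "\<forall>\<^sub>F t in at_top. \<bar>y t - L\<bar> \<le> exp (- q * (z t - \<kappa>' * ln t))"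
    using polynomial_absorbed[OF G q \<kappa>(2)] eventually_ge_at_top[of 0]
  proof eventually_elim
    case (elim t)
    have "(\<delta> + q * \<kappa> + q * \<delta>) * ln (t + 1) \<le> (q * \<kappa> + q * (\<kappa>' - \<kappa>) / 4) * ln (t + 1)"
      using \<delta>(2) elim(2) by (intro mult_right_mono) (auto simp: algebra_simps)
    then have "b t \<le> G * exp ((q * \<kappa> + q * (\<kappa>' - \<kappa>) / 4) * ln (t + 1) - q * z t)"
      unfolding b_def using G by (intro mult_left_mono) auto
    also have "\<dots> = G * exp ((q * \<kappa> + q * (\<kappa>' - \<kappa>) / 4) * ln (t + 1)) * exp (- q * z t)"
      by (simp add: mult.assoc flip: exp_add)
    also have "\<dots> \<le> exp (q * \<kappa>' * ln t) * exp (- q * z t)" using elim(1) by (rule mult_right_mono) simp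
    also have "\<dots> = exp (- q * (z t - \<kappa>' * ln t))" by (simp add: algebra_simps flip: exp_add)
    finally show ?case using Lb[OF elim(2)] by simp
  qed
  ultimately show ?thesis by blast
qed

end

section \<open>Paths in \<open>Sol(p,q)\<close>\<close>

definition has_sol_length :: "real \<Rightarrow> real \<Rightarrow> (real \<Rightarrow> sol_point) \<Rightarrow> real \<Rightarrow> bool" where
  "has_sol_length p q \<gamma> L \<longleftrightarrow> valid_path \<gamma> \<and> (sol_speed p q \<gamma> has_integral L) {0..1}"

lemma sol_metric_nonneg: "0 \<le> sol_metric p q P v v"
  by (cases P; cases v) (simp add: sol_metric_def mult.assoc)

lemma sol_metric_scaleR: "sol_metric p q P (c *\<^sub>R v) (c *\<^sub>R v) = c\<^sup>2 * sol_metric p q P v v"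
  by (cases P; cases v) (simp add: sol_metric_def power2_eq_square algebra_simps)

text \<open>Each half of a concatenation agrees with a rescaled path only locally, hence the open
  set S instead of an identity of functions.\<close>

lemma sol_speed_rescale:
  assumes c: "0 < c" and der: "\<gamma> differentiable at (c * x + d)"
    and S: "open S" "x \<in> S" "\<And>y. y \<in> S \<Longrightarrow> \<gamma>' y = \<gamma> (c * y + d)"
  shows "sol_speed p q \<gamma>' x = c * sol_speed p q \<gamma> (c * x + d)"
proof -
  let ?v = "vector_derivative \<gamma> (at (c * x + d))"
  have "((\<lambda>y. c * y + d) has_vector_derivative c) (at x)"
    unfolding has_real_derivative_iff_has_vector_derivative[symmetric] by (auto intro!: derivative_eq_intros)
  moreover have "(\<gamma> has_vector_derivative ?v) (at (c * x + d))"
    using der by (simp add: vector_derivative_works)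
  ultimately have "((\<gamma> \<circ> (\<lambda>y. c * y + d)) has_vector_derivative c *\<^sub>R ?v) (at x)"
    by (rule vector_diff_chain_at)
  then have "(\<gamma>' has_vector_derivative c *\<^sub>R ?v) (at x)"
    by (rule has_vector_derivative_transform_within_open[OF _ S(1,2)]) (simp add: S(3))
  then have "vector_derivative \<gamma>' (at x) = c *\<^sub>R ?v" by (rule vector_derivative_at)
  then show ?thesis
    using c S(2,3) by (simp add: sol_speed_def sol_metric_scaleR real_sqrt_mult)
qed

text \<open>Each half is traversed at double speed over half the time. The midpoint and the images
  of the break points, where the derivative need not exist, form a finite set that the integral
  ignores.\<close>

lemma has_sol_length_join:
  assumes "has_sol_length p q \<gamma>1 L1" "has_sol_length p q \<gamma>2 L2" "pathfinish \<gamma>1 = pathstart \<gamma>2"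
  shows "has_sol_length p q (\<gamma>1 +++ \<gamma>2) (L1 + L2)"
proof -
  have diff: "\<exists>S. finite S \<and> (\<forall>x\<in>{0..1} - S. \<gamma> differentiable at x)" if "has_sol_length p q \<gamma> L" for \<gamma> L
  proof -
    have "\<gamma> piecewise_C1_differentiable_on {0..1}"
      using that by (simp add: has_sol_length_def valid_path_def)
    then obtain S where "finite S" "\<gamma> C1_differentiable_on ({0..1} - S)"
      unfolding piecewise_C1_differentiable_on_def by blast
    then show ?thesis by (auto simp: C1_differentiable_on_eq)
  qed
  obtain S1 where S1: "finite S1" "\<forall>x\<in>{0..1} - S1. \<gamma>1 differentiable at x" using diff[OF assms(1)] by blast
  obtain S2 where S2: "finite S2" "\<forall>x\<in>{0..1} - S2. \<gamma>2 differentiable at x" using diff[OF assms(2)] by blast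
  have i1: "((\<lambda>x. sol_speed p q \<gamma>1 (2 * x)) has_integral (L1 / 2)) {0..1/2}"
    using has_integral_affinity'[of "sol_speed p q \<gamma>1" L1 0 1 2 0] assms(1) by (simp add: has_sol_length_def)
  have i2: "((\<lambda>x. sol_speed p q \<gamma>2 (2 * x - 1)) has_integral (L2 / 2)) {1/2..1}"
    using has_integral_affinity'[of "sol_speed p q \<gamma>2" L2 0 1 2 "-1"] assms(2) by (simp add: has_sol_length_def)
  have "(sol_speed p q (\<gamma>1 +++ \<gamma>2) has_integral L1) {0..1/2}"
  proof (rule has_integral_spike_finite)
    show "finite (insert (1/2) ((\<lambda>x. x / 2) ` S1))" using S1 by simp
    show "((\<lambda>x. 2 * sol_speed p q \<gamma>1 (2 * x)) has_integral L1) {0..1/2}"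
      using has_integral_mult_right[OF i1, of 2] by simp
    fix x assume "x \<in> {0..1/2} - insert (1/2) ((\<lambda>x. x / 2) ` S1)"
    moreover have "2 * x \<in> S1 \<Longrightarrow> x \<in> (\<lambda>x. x / 2) ` S1" using imageI[of "2 * x" S1 "\<lambda>x. x / 2"] by simp
    ultimately have x: "0 \<le> x" "x < 1/2" "2 * x \<notin> S1" by force+
    then show "sol_speed p q (\<gamma>1 +++ \<gamma>2) x = 2 * sol_speed p q \<gamma>1 (2 * x)"
      using sol_speed_rescale[of 2 \<gamma>1 x 0 "{..<1/2}" "\<gamma>1 +++ \<gamma>2"] S1(2) by (simp add: joinpaths_def)
  qed
  moreover have "(sol_speed p q (\<gamma>1 +++ \<gamma>2) has_integral L2) {1/2..1}"
  proof (rule has_integral_spike_finite)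
    show "finite (insert (1/2) ((\<lambda>x. (x + 1) / 2) ` S2))" using S2 by simp
    show "((\<lambda>x. 2 * sol_speed p q \<gamma>2 (2 * x - 1)) has_integral L2) {1/2..1}"
      using has_integral_mult_right[OF i2, of 2] by simp
    fix x assume "x \<in> {1/2..1} - insert (1/2) ((\<lambda>x. (x + 1) / 2) ` S2)"
    moreover have "2 * x - 1 \<in> S2 \<Longrightarrow> x \<in> (\<lambda>x. (x + 1) / 2) ` S2" using imageI[of "2 * x - 1" S2 "\<lambda>x. (x + 1) / 2"] by simp
    ultimately have x: "x \<le> 1" "1/2 < x" "2 * x - 1 \<notin> S2" by force+
    then show "sol_speed p q (\<gamma>1 +++ \<gamma>2) x = 2 * sol_speed p q \<gamma>2 (2 * x - 1)"
      using sol_speed_rescale[of 2 \<gamma>2 x "-1" "{1/2<..}" "\<gamma>1 +++ \<gamma>2"] S2(2) by (simp add: joinpaths_def)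
  qed
  ultimately have "(sol_speed p q (\<gamma>1 +++ \<gamma>2) has_integral (L1 + L2)) {0..1}"
    by (rule has_integral_combine[rotated 2]) auto
  then show ?thesis
    using assms valid_path_join by (auto simp: has_sol_length_def)
qed

section \<open>Coordinate segments and distances to a vertical ray\<close>

text \<open>This serves coordinate segments: along a horizontal one the height and hence the metric
  are constant, and along a vertical one the metric coefficient is 1, so the speed is
  constant.\<close>

lemma sol_linepath_length:
  assumes "\<And>t. t \<in> {0..1} \<Longrightarrow> sol_metric p q (linepath P Q t) (Q - P) (Q - P) = L\<^sup>2" "0 \<le> L"
  shows "has_sol_length p q (linepath P Q) L"
proof -
  have "((\<lambda>t. L) has_integral L) {0..1::real}" using has_integral_const_real[of L 0 1] by simp
  then have "(sol_speed p q (linepath P Q) has_integral L) {0..1}"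
    by (rule has_integral_eq[rotated]) (use assms in \<open>simp add: sol_speed_def\<close>)
  then show ?thesis by (simp add: has_sol_length_def valid_path_linepath)
qed

lemma sol_length_vertical: "has_sol_length p q (linepath (x, y, z) (x, y, z')) \<bar>z' - z\<bar>"
  by (rule sol_linepath_length) (simp_all add: sol_metric_def linepath_def power2_eq_square)

lemma sol_length_x: "has_sol_length p q (linepath (x, y, z) (x', y, z)) (exp (- p * z) * \<bar>x' - x\<bar>)"
proof (rule sol_linepath_length)
  have e: "exp (- 2 * p * z) = (exp (- p * z))\<^sup>2" by (simp add: power2_eq_square flip: exp_add)
  fix t :: real
  have t: "(1 - t) * z + t * z = z" by (simp add: algebra_simps)
  show "sol_metric p q (linepath (x, y, z) (x', y, z) t) ((x', y, z) - (x, y, z)) ((x', y, z) - (x, y, z)) = (exp (- p * z) * \<bar>x' - x\<bar>)\<^sup>2"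
    unfolding linepath_def sol_metric_def
    by (simp add: t e[simplified] zero_prod_def power_mult_distrib) (simp add: power2_eq_square)
qed simp

lemma sol_length_y: "has_sol_length p q (linepath (x, y, z) (x, y', z)) (exp (q * z) * \<bar>y' - y\<bar>)"
proof (rule sol_linepath_length)
  have e: "exp (2 * q * z) = (exp (q * z))\<^sup>2" by (simp add: power2_eq_square flip: exp_add)
  fix t :: real
  have t: "(1 - t) * z + t * z = z" by (simp add: algebra_simps)
  show "sol_metric p q (linepath (x, y, z) (x, y', z) t) ((x, y', z) - (x, y, z)) ((x, y', z) - (x, y, z)) = (exp (q * z) * \<bar>y' - y\<bar>)\<^sup>2"
    unfolding linepath_def sol_metric_def
    by (simp add: t e[simplified] zero_prod_def power_mult_distrib) (simp add: power2_eq_square)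
qed simp

lemma sol_length_nonneg: "has_sol_length p q \<gamma> L \<Longrightarrow> 0 \<le> L"
  unfolding has_sol_length_def
  by (elim conjE, erule has_integral_nonneg) (simp add: sol_speed_def sol_metric_nonneg)

lemma sol_dist_eq: "sol_dist p q P Q = Inf {L. \<exists>\<gamma>. has_sol_length p q \<gamma> L \<and> pathstart \<gamma> = P \<and> pathfinish \<gamma> = Q}"
  unfolding sol_dist_def has_sol_length_def by (intro arg_cong[where f = Inf]) auto

lemma sol_dist_le:
  assumes "has_sol_length p q \<gamma> L" "pathstart \<gamma> = P" "pathfinish \<gamma> = Q"
  shows "sol_dist p q P Q \<le> L"
proof -
  have "L \<in> {L. \<exists>\<gamma>. has_sol_length p q \<gamma> L \<and> pathstart \<gamma> = P \<and> pathfinish \<gamma> = Q}" using assms by blast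
  moreover have "bdd_below {L. \<exists>\<gamma>. has_sol_length p q \<gamma> L \<and> pathstart \<gamma> = P \<and> pathfinish \<gamma> = Q}"
    by (rule bdd_belowI[of _ 0]) (use sol_length_nonneg in blast)
  ultimately show ?thesis unfolding sol_dist_eq by (rule cInf_lower)
qed

lemma has_sol_length_join4:
  assumes "has_sol_length p q \<gamma>1 L1" "has_sol_length p q \<gamma>2 L2" "has_sol_length p q \<gamma>3 L3" "has_sol_length p q \<gamma>4 L4"
    and "pathfinish \<gamma>1 = pathstart \<gamma>2" "pathfinish \<gamma>2 = pathstart \<gamma>3" "pathfinish \<gamma>3 = pathstart \<gamma>4"
  shows "\<exists>\<gamma>. has_sol_length p q \<gamma> (L1 + L2 + L3 + L4) \<and> pathstart \<gamma> = pathstart \<gamma>1 \<and> pathfinish \<gamma> = pathfinish \<gamma>4"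
proof -
  have 12: "has_sol_length p q (\<gamma>1 +++ \<gamma>2) (L1 + L2)"
    by (rule has_sol_length_join[OF assms(1,2,5)])
  have 123: "has_sol_length p q ((\<gamma>1 +++ \<gamma>2) +++ \<gamma>3) (L1 + L2 + L3)"
    by (rule has_sol_length_join[OF 12 assms(3)]) (simp only: pathfinish_join assms)
  have "has_sol_length p q (((\<gamma>1 +++ \<gamma>2) +++ \<gamma>3) +++ \<gamma>4) (L1 + L2 + L3 + L4)"
    by (rule has_sol_length_join[OF 123 assms(4)]) (simp only: pathfinish_join assms)
  then show ?thesis
    by (intro exI[of _ "((\<gamma>1 +++ \<gamma>2) +++ \<gamma>3) +++ \<gamma>4"]) (simp only: pathstart_join pathfinish_join simp_thms)
qed

lemma sol_path_yx:
  fixes p q x y z x' y' z1 z2 :: real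
  shows "\<exists>\<gamma>. has_sol_length p q \<gamma> (\<bar>z1 - z\<bar> + exp (q * z1) * \<bar>y' - y\<bar> + \<bar>z2 - z1\<bar> + exp (- p * z2) * \<bar>x' - x\<bar>)
    \<and> pathstart \<gamma> = (x, y, z) \<and> pathfinish \<gamma> = (x', y', z2)"
  using has_sol_length_join4[OF sol_length_vertical[of p q x y z z1] sol_length_y[of p q x y z1 y']
    sol_length_vertical[of p q x y' z1 z2] sol_length_x[of p q x y' z2 x']]
  unfolding pathstart_linepath pathfinish_linepath by (simp only: simp_thms)

lemma sol_path_xy:
  fixes p q x y z x' y' z1 z2 :: real
  shows "\<exists>\<gamma>. has_sol_length p q \<gamma> (\<bar>z1 - z\<bar> + exp (- p * z1) * \<bar>x' - x\<bar> + \<bar>z2 - z1\<bar> + exp (q * z2) * \<bar>y' - y\<bar>)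
    \<and> pathstart \<gamma> = (x, y, z) \<and> pathfinish \<gamma> = (x', y', z2)"
  using has_sol_length_join4[OF sol_length_vertical[of p q x y z z1] sol_length_x[of p q x y z1 x']
    sol_length_vertical[of p q x' y z1 z2] sol_length_y[of p q x' y z2 y']]
  unfolding pathstart_linepath pathfinish_linepath by (simp only: simp_thms)

text \<open>The infimum of an empty set of reals has no known sign, so a connecting curve of finite
  length has to be exhibited first.\<close>

lemma sol_dist_nonneg: "0 \<le> sol_dist p q P Q"
proof -
  obtain x y z x' y' z' where "P = (x, y, z)" "Q = (x', y', z')" by (cases P, cases Q) blast
  then have "{L. \<exists>\<gamma>. has_sol_length p q \<gamma> L \<and> pathstart \<gamma> = P \<and> pathfinish \<gamma> = Q} \<noteq> {}"
    using sol_path_yx[of p q z z y' y z' x' x] by blast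
  then show ?thesis unfolding sol_dist_eq by (rule cInf_greatest) (use sol_length_nonneg in blast)
qed

lemma dist_to_ray_le:
  assumes "0 \<le> u" "has_sol_length p q \<gamma> L" "pathstart \<gamma> = P" "pathfinish \<gamma> = \<rho> u"
  shows "dist_to_ray p q P \<rho> \<le> L"
proof -
  have "dist_to_ray p q P \<rho> \<le> sol_dist p q P (\<rho> u)"
    unfolding dist_to_ray_def
  proof (rule cINF_lower[where f = "\<lambda>u. sol_dist p q P (\<rho> u)" and x = u])
    show "bdd_below ((\<lambda>u. sol_dist p q P (\<rho> u)) ` {0..})"
      by (rule bdd_belowI[of _ 0]) (auto simp: sol_dist_nonneg)
  qed (use assms(1) in simp)
  also have "\<dots> \<le> L" using sol_dist_le[OF assms(2-4)] .
  finally show ?thesis .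
qed

text \<open>The curve ends at parameter z + k of the ray, which therefore has to be
  nonnegative.\<close>

lemma sol_dist_to_ray_up:
  fixes p q x y y' z k :: real
  assumes k: "0 \<le> k" "0 \<le> z + k" and x: "\<bar>x\<bar> \<le> exp (p * (z + k))" and y: "\<bar>y - y'\<bar> \<le> exp (- q * (z - k))"
  shows "dist_to_ray p q (x, y, z) (\<lambda>u. (0, y', u)) \<le> 3 * k + 2"
proof -
  define c d where "c = exp (q * (z - k)) * \<bar>y' - y\<bar>" and "d = exp (- p * (z + k)) * \<bar>0 - x\<bar>"
  define L where "L = \<bar>(z - k) - z\<bar> + c + \<bar>(z + k) - (z - k)\<bar> + d"
  have "c \<le> exp (q * (z - k)) * exp (- q * (z - k))"
    unfolding c_def abs_minus_commute[of y'] by (rule mult_left_mono) (use y in simp_all)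
  also have "\<dots> = 1" by (simp flip: exp_add)
  finally have c1: "c \<le> 1" .
  have "d \<le> exp (- p * (z + k)) * exp (p * (z + k))"
    unfolding d_def by (rule mult_left_mono) (use x in simp_all)
  also have "\<dots> = 1" by (simp flip: exp_add)
  finally have d1: "d \<le> 1" .
  from c1 d1 have L: "L \<le> 3 * k + 2" using k by (simp add: L_def)
  have "\<exists>\<gamma>. has_sol_length p q \<gamma> L \<and> pathstart \<gamma> = (x, y, z) \<and> pathfinish \<gamma> = (0, y', z + k)"
    unfolding L_def c_def d_def by (rule sol_path_yx)
  then obtain \<gamma> where \<gamma>: "has_sol_length p q \<gamma> L" "pathstart \<gamma> = (x, y, z)" "pathfinish \<gamma> = (0, y', z + k)" by blast
  have "dist_to_ray p q (x, y, z) (\<lambda>u. (0, y', u)) \<le> L"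
    by (rule dist_to_ray_le[where u = "z + k", OF k(2) \<gamma>(1,2)]) (simp add: \<gamma>(3))
  with L show ?thesis by simp
qed

text \<open>The image of the upward case under (x, y, z) -> (y, x, -z) with p and q exchanged. The
  hypotheses are phrased in -z so that they match the pathwise bounds for the reflected
  height.\<close>

lemma sol_dist_to_ray_down:
  fixes p q x x' y z k :: real
  assumes k: "0 \<le> k" "0 \<le> - z + k" and y: "\<bar>y\<bar> \<le> exp (q * (- z + k))" and x: "\<bar>x - x'\<bar> \<le> exp (- p * (- z - k))"
  shows "dist_to_ray p q (x, y, z) (\<lambda>u. (x', 0, - u)) \<le> 3 * k + 2"
proof -
  define c d where "c = exp (- p * (z + k)) * \<bar>x' - x\<bar>" and "d = exp (q * (z - k)) * \<bar>0 - y\<bar>"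
  define L where "L = \<bar>(z + k) - z\<bar> + c + \<bar>(z - k) - (z + k)\<bar> + d"
  have "c \<le> exp (- p * (z + k)) * exp (- p * (- z - k))"
    unfolding c_def abs_minus_commute[of x'] by (rule mult_left_mono) (use x in simp_all)
  also have "\<dots> = 1" by (simp add: algebra_simps flip: exp_add)
  finally have c1: "c \<le> 1" .
  have "d \<le> exp (q * (z - k)) * exp (q * (- z + k))"
    unfolding d_def by (rule mult_left_mono) (use y in simp_all)
  also have "\<dots> = 1" by (simp add: algebra_simps flip: exp_add)
  finally have d1: "d \<le> 1" .
  from c1 d1 have L: "L \<le> 3 * k + 2" using k by (simp add: L_def)
  have "\<exists>\<gamma>. has_sol_length p q \<gamma> L \<and> pathstart \<gamma> = (x, y, z) \<and> pathfinish \<gamma> = (x', 0, z - k)"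
    unfolding L_def c_def d_def by (rule sol_path_xy)
  then obtain \<gamma> where \<gamma>: "has_sol_length p q \<gamma> L" "pathstart \<gamma> = (x, y, z)" "pathfinish \<gamma> = (x', 0, z - k)" by blast
  have "dist_to_ray p q (x, y, z) (\<lambda>u. (x', 0, - u)) \<le> L"
    by (rule dist_to_ray_le[where u = "- z + k", OF k(2) \<gamma>(1,2)]) (simp add: \<gamma>(3))
  with L show ?thesis by simp
qed

section \<open>The distance to the limit ray\<close>

text \<open>Monotonicity lets the values 1 / (m + 1) stand for all positive reals, so countably many
  null sets suffice and one exceptional set serves every \<open>\<delta>\<close>.\<close>

lemma AE_all_pos:
  fixes P :: "real \<Rightarrow> 'a \<Rightarrow> bool"
  assumes P: "\<And>\<delta>. 0 < \<delta> \<Longrightarrow> AE \<omega> in M. P \<delta> \<omega>" and mono: "\<And>\<delta> \<delta>' \<omega>. 0 < \<delta> \<Longrightarrow> \<delta> \<le> \<delta>' \<Longrightarrow> P \<delta> \<omega> \<Longrightarrow> P \<delta>' \<omega>"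
  shows "AE \<omega> in M. \<forall>\<delta>>0. P \<delta> \<omega>"
proof -
  have "AE \<omega> in M. \<forall>m. P (inverse (real (Suc m))) \<omega>"
    unfolding AE_all_countable by (intro allI P) simp
  then show ?thesis
  proof eventually_elim
    case (elim \<omega>)
    show ?case
    proof (intro allI impI)
      fix \<delta> :: real assume "0 < \<delta>"
      then obtain m where "inverse (real (Suc m)) < \<delta>" using reals_Archimedean by blast
      then show "P \<delta> \<omega>" using elim mono[of "inverse (real (Suc m))" \<delta> \<omega>] by simp
    qed
  qed
qed

text \<open>The hypothesis has the shape \<open>3 * k + 2\<close> of the distance bounds with k = c
  / 3 * ln t; the additive constant disappears on division by \<open>ln t\<close>.\<close>

lemma Limsup_div_ln_le:
  fixes f :: "real \<Rightarrow> real"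
  assumes "\<forall>\<^sub>F t in at_top. f t \<le> 3 * (c / 3 * ln t) + d"
  shows "Limsup at_top (\<lambda>t. ereal (f t / ln t)) \<le> ereal c"
proof -
  have "Limsup at_top (\<lambda>t. ereal (f t / ln t)) \<le> Limsup at_top (\<lambda>t. ereal (c + d / ln t))"
  proof (rule Limsup_mono, use assms eventually_gt_at_top[of 1] in eventually_elim)
    fix t :: real assume "f t \<le> 3 * (c / 3 * ln t) + d" "1 < t"
    then have "f t / ln t \<le> (c * ln t + d) / ln t" by (intro divide_right_mono) auto
    also have "\<dots> = c + d / ln t" using \<open>1 < t\<close> by (simp add: add_divide_distrib)
    finally show "ereal (f t / ln t) \<le> ereal (c + d / ln t)" by simp
  qed
  also have "\<dots> = ereal c"
  proof (rule lim_imp_Limsup)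
    have "((\<lambda>t. c + d / ln t) \<longlongrightarrow> c) at_top" by real_asymp
    then show "((\<lambda>t. ereal (c + d / ln t)) \<longlongrightarrow> ereal c) at_top" by simp
  qed simp
  finally show ?thesis .
qed

theorem theorem4p4:
  fixes M :: "'a measure"
    and p q a :: real
    and W W1 W2 X Y Z :: "real \<Rightarrow> 'a \<Rightarrow> real"
  assumes "p > 0" and "q > 0" and "a \<noteq> 0"
    and "prob_space M"
    and "brownian_motion M W" and "brownian_motion M W1" and "brownian_motion M W2"
    and "indep_processes M [W, W1, W2]"
    and "\<And>t \<omega>. t \<ge> 0 \<Longrightarrow> \<omega> \<in> space M \<Longrightarrow> Z t \<omega> = a * t + W t \<omega>"
    and "is_ito_integral M (natural_filtration M {W, W1, W2}) W1 (\<lambda>s \<omega>. exp (p * Z s \<omega>)) X"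
    and "is_ito_integral M (natural_filtration M {W, W1, W2}) W2 (\<lambda>s \<omega>. exp (- q * Z s \<omega>)) Y"
  shows "AE \<omega> in M.
    Limsup at_top (\<lambda>t. ereal (dist_to_ray p q (X t \<omega>, Y t \<omega>, Z t \<omega>) (limit_ray a X Y \<omega>) / ln t))
      \<le> ereal (2 / \<bar>a\<bar>)"
proof -
  note p = assms(1) and q = assms(2) and Z = assms(9)
  define \<alpha> where "\<alpha> = \<bar>a\<bar>"
  have \<alpha>: "0 < \<alpha>" using assms(3) by (simp add: \<alpha>_def)
  have bms: "brownian_motion M ([W, W1, W2] ! i)" if "i < length [W, W1, W2]" for i
    using that assms(5-7) by (auto simp: less_Suc_eq nth_Cons')
  have F1: "filtered_brownian_motion M (natural_filtration M {W, W1, W2}) W1"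
    using natural_filtration_bm[OF bms assms(8), of 1] by simp
  have F2: "filtered_brownian_motion M (natural_filtration M {W, W1, W2}) W2"
    using natural_filtration_bm[OF bms assms(8), of 2] by simp
  \<comment> \<open>\<open>\<kappa>\<close> is 21/20, a summable weight exponent above 1, divided by
    17/10 \<alpha>, an admissible parameter below 2 * (9/10 \<alpha>). \<open>\<kappa>'\<close> is a
    third of the target constant, and 21/34 < 2/3.\<close>
  define \<kappa> \<kappa>' where "\<kappa> = 21 / (34 * \<alpha>)" and "\<kappa>' = 2 / \<alpha> / 3"
  have \<kappa>: "0 \<le> \<kappa>" "\<kappa> < \<kappa>'" using \<alpha> by (auto simp: \<kappa>_def \<kappa>'_def field_simps)
  have pair: "AE \<omega> in M. \<exists>C\<ge>0. \<forall>i k :: nat. \<bar>W (real k) \<omega> - W (real i) \<omega>\<bar> \<le> 9 / 10 * \<alpha> * \<bar>real k - real i\<bar> + \<kappa> * ln (real i + 1) + C"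
  proof -
    define s where "s = 17 / 10 * \<alpha>"
    have s: "0 < s" "s < 2 * (9 / 10 * \<alpha>)" "s * \<kappa> = 21 / 20" using \<alpha> by (auto simp: s_def \<kappa>_def)
    have "AE \<omega> in M. \<exists>C\<ge>0. \<forall>i k :: nat. s * \<bar>W (real k) \<omega> - W (real i) \<omega>\<bar>
      \<le> s * (9 / 10 * \<alpha>) * \<bar>real k - real i\<bar> + 21 / 20 * ln (real i + 1) + C"
      by (rule AE_brownian_pair_bound[OF assms(5) s(1,2)]) simp
    then show ?thesis
    proof eventually_elim
      case (elim \<omega>)
      then obtain C where C: "0 \<le> C" "\<And>i k :: nat. s * \<bar>W (real k) \<omega> - W (real i) \<omega>\<bar>
        \<le> s * (9 / 10 * \<alpha>) * \<bar>real k - real i\<bar> + 21 / 20 * ln (real i + 1) + C" by blast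
      have "\<bar>W (real k) \<omega> - W (real i) \<omega>\<bar> \<le> 9 / 10 * \<alpha> * \<bar>real k - real i\<bar> + \<kappa> * ln (real i + 1) + C / s" for i k :: nat
      proof (rule mult_left_le_imp_le[OF _ s(1)])
        have "s * (9 / 10 * \<alpha> * \<bar>real k - real i\<bar> + \<kappa> * ln (real i + 1) + C / s)
          = s * (9 / 10 * \<alpha>) * \<bar>real k - real i\<bar> + 21 / 20 * ln (real i + 1) + C"
          using s(1) unfolding s(3)[symmetric] by (simp add: distrib_left mult.assoc)
        then show "s * \<bar>W (real k) \<omega> - W (real i) \<omega>\<bar> \<le> s * (9 / 10 * \<alpha> * \<bar>real k - real i\<bar> + \<kappa> * ln (real i + 1) + C / s)"
          using C(2)[of k i] by (simp only:)
      qed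
      then show ?case using C(1) s(1) by (intro exI[of _ "C / s"]) auto
    qed
  qed
  have osc: "AE \<omega> in M. \<exists>C\<ge>0. \<forall>n. \<forall>t\<in>{real n..real n + 1}. \<bar>Z t \<omega> - Z (real n) \<omega>\<bar> \<le> C + \<epsilon> * ln (real n + 1)"
    if \<epsilon>: "0 < \<epsilon>" for \<epsilon>
    using AE_brownian_oscillation[OF assms(5) \<epsilon>] AE_space
  proof eventually_elim
    case (elim \<omega>)
    then obtain C where C: "0 \<le> C" "\<And>n t. t \<in> {real n..real n + 1} \<Longrightarrow> \<bar>W t \<omega> - W (real n) \<omega>\<bar> \<le> C + \<epsilon> * ln (real n + 1)" by blast
    have "\<bar>Z t \<omega> - Z (real n) \<omega>\<bar> \<le> (C + \<alpha>) + \<epsilon> * ln (real n + 1)" if t: "t \<in> {real n..real n + 1}" for n t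
    proof -
      have "0 \<le> t" using t by (auto intro: order_trans[OF of_nat_0_le_iff])
      then have "Z t \<omega> - Z (real n) \<omega> = a * (t - real n) + (W t \<omega> - W (real n) \<omega>)"
        using elim(2) by (simp add: Z algebra_simps)
      moreover have "\<bar>a * (t - real n)\<bar> \<le> \<alpha> * 1"
        unfolding abs_mult \<alpha>_def using t by (intro mult_left_mono) auto
      ultimately show ?thesis using C(2)[OF t] by linarith
    qed
    then show ?case using C(1) \<alpha> by (intro exI[of _ "C + \<alpha>"]) auto
  qed
  \<comment> \<open>This crude linear bound suffices because it enters the estimate of the integrals
    only through a logarithm.\<close>
  have growth: "AE \<omega> in M. \<exists>C\<ge>0. \<forall>n::nat. \<bar>Z (real n) \<omega>\<bar> \<le> C * (real n + 1)"
    using pair AE_space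
  proof eventually_elim
    case (elim \<omega>)
    then obtain C where C: "0 \<le> C" "\<And>i k :: nat. \<bar>W (real k) \<omega> - W (real i) \<omega>\<bar> \<le> 9 / 10 * \<alpha> * \<bar>real k - real i\<bar> + \<kappa> * ln (real i + 1) + C" by blast
    have "\<bar>Z (real n) \<omega>\<bar> \<le> (2 * \<alpha> + C + \<bar>W 0 \<omega>\<bar>) * (real n + 1)" for n :: nat
    proof -
      have "\<bar>W (real n) \<omega> - W 0 \<omega>\<bar> \<le> 9 / 10 * (\<alpha> * real n) + C" using C(2)[of n 0] by simp
      moreover have "\<bar>a * real n\<bar> = \<alpha> * real n" by (simp add: abs_mult \<alpha>_def)
      moreover have "0 \<le> \<alpha> * real n" "0 \<le> (C + \<bar>W 0 \<omega>\<bar>) * real n" using \<alpha> C(1) by simp_all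
      ultimately show ?thesis using elim(2) \<alpha> by (simp add: Z distrib_left distrib_right)
    qed
    then show ?case using C(1) \<alpha> by (intro exI[of _ "2 * \<alpha> + C + \<bar>W 0 \<omega>\<bar>"]) auto
  qed
  have powr_mono: "D * (real n + 1) powr \<delta> * exp b \<le> D * (real n + 1) powr \<delta>' * exp b"
    if "0 \<le> D" "\<delta> \<le> \<delta>'" for D \<delta> \<delta>' b and n :: nat
    using that by (intro mult_right_mono mult_left_mono powr_mono) auto
  have ito: "AE \<omega> in M. \<forall>\<delta>>0. \<exists>D\<ge>0. \<forall>n. \<forall>t\<in>{real n..real n + 1}. \<bar>I t \<omega> - I (real n) \<omega>\<bar> \<le> D * (real n + 1) powr \<delta> * exp (c * Z (real n) \<omega>)"
    if "filtered_brownian_motion M F B" "is_ito_integral M F B (\<lambda>s \<omega>. exp (c * Z s \<omega>)) I" for F B c I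
  proof (rule AE_all_pos)
    fix \<delta> :: real assume \<delta>: "0 < \<delta>"
    show "AE \<omega> in M. \<exists>D\<ge>0. \<forall>n. \<forall>t\<in>{real n..real n + 1}. \<bar>I t \<omega> - I (real n) \<omega>\<bar> \<le> D * (real n + 1) powr \<delta> * exp (c * Z (real n) \<omega>)"
      by (rule filtered_brownian_motion.AE_ito_exp_increment[OF that \<delta> osc growth])
  next
    fix \<delta> \<delta>' \<omega> assume \<delta>: "0 < \<delta>" "\<delta> \<le> \<delta>'"
      and "\<exists>D\<ge>0. \<forall>n. \<forall>t\<in>{real n..real n + 1}. \<bar>I t \<omega> - I (real n) \<omega>\<bar> \<le> D * (real n + 1) powr \<delta> * exp (c * Z (real n) \<omega>)"
    then obtain D where D: "0 \<le> D" "\<And>n t. t \<in> {real n..real n + 1} \<Longrightarrow> \<bar>I t \<omega> - I (real n) \<omega>\<bar> \<le> D * (real n + 1) powr \<delta> * exp (c * Z (real n) \<omega>)" by blast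
    show "\<exists>D\<ge>0. \<forall>n. \<forall>t\<in>{real n..real n + 1}. \<bar>I t \<omega> - I (real n) \<omega>\<bar> \<le> D * (real n + 1) powr \<delta>' * exp (c * Z (real n) \<omega>)"
      using D(1) order_trans[OF D(2) powr_mono[OF D(1) \<delta>(2)]] by blast
  qed
  have osc': "AE \<omega> in M. \<forall>\<epsilon>>0. \<exists>C\<ge>0. \<forall>n. \<forall>t\<in>{real n..real n + 1}. \<bar>Z t \<omega> - Z (real n) \<omega>\<bar> \<le> C + \<epsilon> * ln (real n + 1)"
  proof (rule AE_all_pos[OF osc])
    fix \<delta> \<delta>' \<omega> assume \<delta>: "0 < \<delta>" "\<delta> \<le> \<delta>'"
      and "\<exists>C\<ge>0. \<forall>n. \<forall>t\<in>{real n..real n + 1}. \<bar>Z t \<omega> - Z (real n) \<omega>\<bar> \<le> C + \<delta> * ln (real n + 1)"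
    then obtain C where C: "0 \<le> C" "\<And>n t. t \<in> {real n..real n + 1} \<Longrightarrow> \<bar>Z t \<omega> - Z (real n) \<omega>\<bar> \<le> C + \<delta> * ln (real n + 1)" by blast
    have "C + \<delta> * ln (real n + 1) \<le> C + \<delta>' * ln (real n + 1)" for n :: nat
      using \<delta>(2) by (intro add_left_mono mult_right_mono) auto
    then show "\<exists>C\<ge>0. \<forall>n. \<forall>t\<in>{real n..real n + 1}. \<bar>Z t \<omega> - Z (real n) \<omega>\<bar> \<le> C + \<delta>' * ln (real n + 1)"
      using C(1) order_trans[OF C(2)] by blast
  qed
  from pair osc' ito[OF F1 assms(10)] ito[OF F2 assms(11)] AE_space show ?thesis
  proof eventually_elim
    case (elim \<omega>)
    from elim(1) obtain C where C: "0 \<le> C" "\<And>i k :: nat. \<bar>W (real k) \<omega> - W (real i) \<omega>\<bar> \<le> 9 / 10 * \<alpha> * \<bar>real k - real i\<bar> + \<kappa> * ln (real i + 1) + C" by blast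
    have Zn: "Z (real n) \<omega> = a * real n + W (real n) \<omega>" for n :: nat using Z elim(5) by simp
    have "\<forall>\<^sub>F t in at_top. dist_to_ray p q (X t \<omega>, Y t \<omega>, Z t \<omega>) (limit_ray a X Y \<omega>) \<le> 3 * (2 / \<alpha> / 3 * ln t) + 2"
    proof (cases "0 < a")
      case True
      then have a\<alpha>: "\<alpha> = a" by (simp add: \<alpha>_def)
      interpret drifting_path "\<lambda>t. Z t \<omega>" a \<kappa> C
        by unfold_locales (use True C elim(2) in \<open>simp_all add: Zn a\<alpha>\<close>)
      obtain L where L: "((\<lambda>t. Y t \<omega>) \<longlongrightarrow> L) at_top" "\<forall>\<^sub>F t in at_top. \<bar>Y t \<omega> - L\<bar> \<le> exp (- q * (Z t \<omega> - \<kappa>' * ln t))"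
        using contracting_integral_bound[OF q \<kappa>, of "\<lambda>t. Y t \<omega>"] elim(4) by blast
      have lim: "limit_ray a X Y \<omega> = (\<lambda>u. (0, L, u))"
        using tendsto_Lim[OF _ L(1)] True by (simp add: limit_ray_def fun_eq_iff)
      have "\<forall>\<^sub>F t in at_top. \<bar>X t \<omega>\<bar> \<le> exp (p * (Z t \<omega> + \<kappa>' * ln t))"
        using expanding_integral_bound[OF p \<kappa>, of "\<lambda>t. X t \<omega>"] elim(3) by blast
      from this L(2) eventually_nonneg eventually_ge_at_top[of 1] show ?thesis
      proof eventually_elim
        case (elim t)
        have "0 \<le> \<kappa>' * ln t" using elim(4) \<kappa> by simp
        then show ?case
          unfolding lim \<kappa>'_def[symmetric] using elim by (intro sol_dist_to_ray_up) auto
      qed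
    next
      case False
      then have a\<alpha>: "\<alpha> = - a" and a0: "a < 0" using assms(3) by (auto simp: \<alpha>_def)
      \<comment> \<open>After reflection the drift -a is positive. The integrand
        \<open>exp (p Z)\<close> of X now decays with rate p and that of Y grows with rate q, so the
        two lemmas exchange their roles.\<close>
      interpret drifting_path "\<lambda>t. - Z t \<omega>" "- a" \<kappa> C
      proof
        show "\<bar>(- Z (real k) \<omega> - - a * real k) - (- Z (real i) \<omega> - - a * real i)\<bar>
          \<le> 9 / 10 * - a * \<bar>real k - real i\<bar> + \<kappa> * ln (real i + 1) + C" for i k :: nat
          using C(2)[of k i] by (simp add: Zn a\<alpha> abs_minus_commute)
        show "\<exists>D\<ge>0. \<forall>n. \<forall>t\<in>{real n..real n + 1}. \<bar>- Z t \<omega> - - Z (real n) \<omega>\<bar> \<le> D + \<epsilon> * ln (real n + 1)" if "0 < \<epsilon>" for \<epsilon>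
          using elim(2) that by (simp add: abs_minus_commute)
      qed (use a0 C(1) in auto)
      obtain L where L: "((\<lambda>t. X t \<omega>) \<longlongrightarrow> L) at_top" "\<forall>\<^sub>F t in at_top. \<bar>X t \<omega> - L\<bar> \<le> exp (- p * (- Z t \<omega> - \<kappa>' * ln t))"
        using contracting_integral_bound[OF p \<kappa>, of "\<lambda>t. X t \<omega>"] elim(3) by auto
      have lim: "limit_ray a X Y \<omega> = (\<lambda>u. (L, 0, - u))"
        using tendsto_Lim[OF _ L(1)] False by (simp add: limit_ray_def fun_eq_iff)
      have "\<forall>\<^sub>F t in at_top. \<bar>Y t \<omega>\<bar> \<le> exp (q * (- Z t \<omega> + \<kappa>' * ln t))"
        using expanding_integral_bound[OF q \<kappa>, of "\<lambda>t. Y t \<omega>"] elim(4) by auto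
      from this L(2) eventually_nonneg eventually_ge_at_top[of 1] show ?thesis
      proof eventually_elim
        case (elim t)
        have "0 \<le> \<kappa>' * ln t" using elim(4) \<kappa> by simp
        then show ?case
          unfolding lim \<kappa>'_def[symmetric] using elim by (intro sol_dist_to_ray_down) auto
      qed
    qed
    then show ?case unfolding \<alpha>_def by (rule Limsup_div_ln_le)
  qed
qed

end
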